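(* Let $(g_1,\dots,g_n)$ be a random element of $G(n)=\mathrm{SU}(2)^n$ distributed according to the (normalized) Haar measure, and define the random real numbers $s_{ij}=s_{ji}$ by $$\det\Bigl(\sum_j\lambda_jg_j\Bigr)=\sum_j\lambda_j^2+2\sum_{i<j}s_{ij}\lambda_i\lambda_j .$$ Then: a) The coefficients $s_{12},s_{13},s_{23}$ are distributed as $\mathrm{const}\cdot ds_{12}\,ds_{13}\,ds_{23}$ in the domain $$\begin{pmatrix} 1 & s_{12} & s_{13} \\ s_{12} & 1 & s_{23} \\ s_{13} & s_{23} & 1 \end{pmatrix}\ge0 .$$ b) For fixed $s_{12},s_{13},s_{23}$ in general position and each $j\ge4$, the vector $v_j=(s_{1j},s_{2j},s_{3j})$ is (conditionally) distributed as $$\mathrm{const}\cdot\det(\Delta_j)^{-1/2}\,ds_{1j}\,ds_{2j}\,ds_{3j},\qquad \Delta_j=\begin{pmatrix} 1 & s_{12} & s_{13} & s_{1j} \\ s_{12} & 1 & s_{23} & s_{2j} \\ s_{13} & s_{23} & 1 & s_{3j} \\ s_{1j} & s_{2j} & s_{3j} & 1 \end{pmatrix},$$ where the vector $(s_{1j},s_{2j},s_{3j})$ ranges in the domain $\Delta_j\ge0$. c) (For such fixed $s_{12},s_{13},s_{23}$) the random variables $v_4,v_5,\dots,v_n$ are independent. d) Fix $s_{1j},s_{2j},s_{3j}$ for all $j$. For such a collection in general position, for each $j=5,6,\dots,n$ there are exactly $2$ equiprobable variants of the choice of $s_{4j}$; these choices are independent for $j=5,6,\dots,n$. e) Fix $s_{1j},s_{2j},s_{3j}$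 for all $j$ and fix $s_{4j}$ for all $j$. Then almost surely all the other variables $s_{ij}$ are uniquely determined.
   Context: $\mathrm{SU}(2)$ is the group of unitary $2\times 2$ matrices of determinant $1$. For a real symmetric matrix, $\ge0$ means positive semidefinite. "$\mathrm{const}$" denotes a positive normalizing constant. "Fixed" values refer to conditioning on those values, with all other variables distributed according to the resulting conditional law; "in general position" means for almost every value of the conditioning variables. $n$ is such that the variables mentioned in each part are present ($n\ge3$ in (a), $n\ge4$ in (b) and (c), $n\ge5$ in (d) and (e)). *)

theory Defs
  imports "HOL-Analysis.Analysis" "HOL-Probability.Probability"
begin

section \<open>Random elements of products of $SU(2)$\<close>

definition conj_transpose :: "complex^'n^'m \<Rightarrow> complex^'m^'n" where
  "conj_transpose A = (\<chi> i j. cnj (A $ j $ i))"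

definition SU2 :: "(complex^2^2) set" where
  "SU2 = {A. A ** conj_transpose A = mat 1 \<and> conj_transpose A ** A = mat 1 \<and> det A = 1}"

text \<open>The group $SU(2)^n$, with factors indexed by $1,\dots,n$, and its Borel sets: since
  \<^term>\<open>SU2\<close> is second countable, the product $\sigma$-algebra is the Borel $\sigma$-algebra of
  the product. Only the measurable space underlying this measure is relevant.\<close>

definition SU2_pow :: "nat \<Rightarrow> (nat \<Rightarrow> complex^2^2) measure" where
  "SU2_pow n = (\<Pi>\<^sub>M j\<in>{1..n}. restrict_space borel SU2)"

text \<open>On a compact group, normalized Haar measure is the unique Borel probability measure
  invariant under all left translations.\<close>

definition normalized_haar :: "nat \<Rightarrow> (nat \<Rightarrow> complex^2^2) measure \<Rightarrow> bool" where
  "normalized_haar n \<mu> \<longleftrightarrow>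
     prob_space \<mu> \<and> sets \<mu> = sets (SU2_pow n) \<and>
     (\<forall>h\<in>space (SU2_pow n). distr \<mu> \<mu> (\<lambda>g. \<lambda>j\<in>{1..n}. h j ** g j) = \<mu>)"

section \<open>The coefficients of the determinant\<close>

text \<open>Only the values of \<^term>\<open>S i j\<close> for distinct \<^term>\<open>i\<close> and \<^term>\<open>j\<close> in $\{1,\dots,n\}$ are
  constrained; the identity and the symmetry determine them.\<close>

definition det_coeffs :: "nat \<Rightarrow> (nat \<Rightarrow> complex^2^2) \<Rightarrow> (nat \<Rightarrow> nat \<Rightarrow> real) \<Rightarrow> bool" where
  "det_coeffs n g S \<longleftrightarrow>
     (\<forall>i\<in>{1..n}. \<forall>j\<in>{1..n}. S i j = S j i) \<and>
     (\<forall>l :: nat \<Rightarrow> real.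
        det (\<Sum>j=1..n. l j *\<^sub>R g j) =
        complex_of_real ((\<Sum>j=1..n. (l j)\<^sup>2) + 2 * (\<Sum>j=1..n. \<Sum>i=1..<j. S i j * l i * l j)))"

lemma SU2_entries:
  assumes "A \<in> SU2"
  shows "A $ 2 $ 2 = cnj (A $ 1 $ 1)" "A $ 2 $ 1 = - cnj (A $ 1 $ 2)"
    "A $ 1 $ 1 * cnj (A $ 1 $ 1) + A $ 1 $ 2 * cnj (A $ 1 $ 2) = 1"
proof -
  define a b c d where abcd: "a = A $ 1 $ 1" "b = A $ 1 $ 2" "c = A $ 2 $ 1" "d = A $ 2 $ 2"
  have P: "A ** conj_transpose A = mat 1" and D: "a * d - b * c = 1"
    using assms by (auto simp: SU2_def det_2 abcd)
  have "(A ** conj_transpose A) $ 1 $ 1 = 1" "(A ** conj_transpose A) $ 2 $ 1 = 0"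
    by (simp_all add: P mat_def)
  then have r: "a * cnj a + b * cnj b = 1" "c * cnj a + d * cnj b = 0"
    by (simp_all add: matrix_matrix_mult_def conj_transpose_def sum_2 abcd)
  have "cnj a = d" "cnj b = - c"
    using r D by algebra+
  then show "A $ 2 $ 2 = cnj (A $ 1 $ 1)" "A $ 2 $ 1 = - cnj (A $ 1 $ 2)"
    "A $ 1 $ 1 * cnj (A $ 1 $ 1) + A $ 1 $ 2 * cnj (A $ 1 $ 2) = 1"
    using r(1) by (simp_all add: abcd)
qed

lemma inner_sum_expand:
  fixes x :: "nat \<Rightarrow> 'a::real_inner" and l :: "nat \<Rightarrow> real"
  shows "(\<Sum>j=1..n. l j *\<^sub>R x j) \<bullet> (\<Sum>j=1..n. l j *\<^sub>R x j) =
    (\<Sum>j=1..n. (l j)\<^sup>2 * (x j \<bullet> x j)) + 2 * (\<Sum>j=1..n. \<Sum>i=1..<j. (x i \<bullet> x j) * l i * l j)"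
proof (induction n)
  case (Suc n)
  have "(\<Sum>j=1..n. l j *\<^sub>R x j) \<bullet> (l (Suc n) *\<^sub>R x (Suc n)) =
      (\<Sum>i=1..<Suc n. (x i \<bullet> x (Suc n)) * l i * l (Suc n))"
    by (simp add: inner_sum_left atLeastLessThanSuc_atLeastAtMost sum_distrib_left mult_ac)
  then show ?case
    using Suc
    by (simp add: inner_add_left inner_add_right power2_eq_square inner_commute algebra_simps)
qed simp

text \<open>The coefficients exist: identifying $SU(2)$ with the unit sphere of $\mathbb{C}^2$ through the
  first row, they are the real inner products of the corresponding unit vectors.\<close>

lemma det_coeffs_exists:
  assumes "\<And>j. j \<in> {1..n} \<Longrightarrow> g j \<in> SU2"
  shows "\<exists>S. det_coeffs n g S"
proof -
  define x where "x j = (g j $ 1 $ 1, g j $ 1 $ 2)" for j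
  have xx: "x j \<bullet> x j = 1" if "j \<in> {1..n}" for j
  proof -
    have "Re (g j $ 1 $ 1 * cnj (g j $ 1 $ 1) + g j $ 1 $ 2 * cnj (g j $ 1 $ 2)) = Re 1"
      using SU2_entries(3)[OF assms[OF that]] by simp
    then show ?thesis
      by (simp add: x_def inner_complex_def)
  qed
  have "det (\<Sum>j=1..n. l j *\<^sub>R g j) =
      complex_of_real ((\<Sum>j=1..n. l j *\<^sub>R x j) \<bullet> (\<Sum>j=1..n. l j *\<^sub>R x j))" for l :: "nat \<Rightarrow> real"
  proof -
    define a b where ab: "a = (\<Sum>j=1..n. l j *\<^sub>R g j $ 1 $ 1)" "b = (\<Sum>j=1..n. l j *\<^sub>R g j $ 1 $ 2)"
    have "(\<Sum>j=1..n. l j *\<^sub>R g j $ 2 $ 2) = cnj a" "(\<Sum>j=1..n. l j *\<^sub>R g j $ 2 $ 1) = - cnj b"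
      unfolding ab by (simp_all add: SU2_entries(1,2)[OF assms] scaleR_conv_of_real sum_negf)
    then have "det (\<Sum>j=1..n. l j *\<^sub>R g j) = a * cnj a + b * cnj b"
      by (simp add: det_2 ab)
    moreover have "(\<Sum>j=1..n. l j *\<^sub>R x j) = (a, b)"
      by (simp add: x_def ab prod_eq_iff fst_sum snd_sum)
    ultimately show ?thesis
      by (simp add: complex_eq_iff inner_complex_def)
  qed
  then have "det_coeffs n g (\<lambda>i j. x i \<bullet> x j)"
    unfolding det_coeffs_def inner_sum_expand by (simp add: xx inner_commute)
  then show ?thesis
    by (intro exI)
qed

section \<open>Gram matrices\<close>

definition pos_semidef :: "real^'n^'n \<Rightarrow> bool" where
  "pos_semidef A \<longleftrightarrow> transpose A = A \<and> (\<forall>x. 0 \<le> x \<bullet> (A *v x))"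

fun gram3 :: "real \<times> real \<times> real \<Rightarrow> real^3^3" where
  "gram3 (s12, s13, s23) =
     vector [vector [1,   s12, s13],
             vector [s12, 1,   s23],
             vector [s13, s23, 1]]"

fun gram4 :: "real \<times> real \<times> real \<Rightarrow> real \<times> real \<times> real \<Rightarrow> real^4^4" where
  "gram4 (s12, s13, s23) (s1j, s2j, s3j) =
     vector [vector [1,   s12, s13, s1j],
             vector [s12, 1,   s23, s2j],
             vector [s13, s23, 1,   s3j],
             vector [s1j, s2j, s3j, 1]]"

section \<open>Conditional laws\<close>

text \<open>\<^term>\<open>K\<close> is a regular conditional distribution of \<^term>\<open>Y\<close> given \<^term>\<open>X\<close>: a probability
  kernel such that \<^term>\<open>K x\<close> is the law of \<^term>\<open>Y\<close> for the fixed value \<^term>\<open>x\<close> of \<^term>\<open>X\<close>.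
  Its values are determined only up to a null set of the law of \<^term>\<open>X\<close>.\<close>

definition cond_law ::
    "'w measure \<Rightarrow> 'x measure \<Rightarrow> ('w \<Rightarrow> 'x) \<Rightarrow> 'y measure \<Rightarrow> ('w \<Rightarrow> 'y) \<Rightarrow> ('x \<Rightarrow> 'y measure) \<Rightarrow> bool"
  where
  "cond_law M N X L Y K \<longleftrightarrow>
     X \<in> M \<rightarrow>\<^sub>M N \<and> Y \<in> M \<rightarrow>\<^sub>M L \<and> K \<in> N \<rightarrow>\<^sub>M prob_algebra L \<and>
     (\<forall>A\<in>sets N. \<forall>B\<in>sets L.
        emeasure M {\<omega>\<in>space M. X \<omega> \<in> A \<and> Y \<omega> \<in> B} =
        (\<integral>\<^sup>+x\<in>A. emeasure (K x) B \<partial>distr M N X))"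

section \<open>Families of coefficients\<close>

text \<open>The off-diagonal positions in the first \<^term>\<open>k\<close> rows; by symmetry it suffices to keep those
  above the diagonal.\<close>

definition first_rows :: "nat \<Rightarrow> nat \<Rightarrow> (nat \<times> nat) set" where
  "first_rows n k = {(i, j). 1 \<le> i \<and> i \<le> k \<and> i < j \<and> j \<le> n}"

definition other_entries :: "nat \<Rightarrow> (nat \<times> nat) set" where
  "other_entries n = {(i, j). 5 \<le> i \<and> i < j \<and> j \<le> n}"

definition entries ::
    "(nat \<Rightarrow> nat \<Rightarrow> 'w \<Rightarrow> real) \<Rightarrow> (nat \<times> nat) set \<Rightarrow> 'w \<Rightarrow> nat \<times> nat \<Rightarrow> real" where
  "entries s I \<omega> = restrict (\<lambda>(i, j). s i j \<omega>) I"

definition col :: "(nat \<Rightarrow> nat \<Rightarrow> 'w \<Rightarrow> real) \<Rightarrow> nat \<Rightarrow> 'w \<Rightarrow> real \<times> real \<times> real" where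
  "col s j \<omega> = (s 1 j \<omega>, s 2 j \<omega>, s 3 j \<omega>)"

definition upper3 :: "(nat \<Rightarrow> nat \<Rightarrow> 'w \<Rightarrow> real) \<Rightarrow> 'w \<Rightarrow> real \<times> real \<times> real" where
  "upper3 s \<omega> = (s 1 2 \<omega>, s 1 3 \<omega>, s 2 3 \<omega>)"

abbreviation real_families :: "(nat \<times> nat) set \<Rightarrow> (nat \<times> nat \<Rightarrow> real) measure" where
  "real_families I \<equiv> \<Pi>\<^sub>M p\<in>I. borel"

end

theory Submission
  imports Defs
begin

text \<open>Identify $SU(2)$ with the unit sphere $S^3$ of the quaternions. By uniqueness of Haar
  measure the $g_j$ become independent uniform points of $S^3$, and polarising the determinant turns
  $s_{ij}$ into their inner products. The inner products are invariant under a common orthogonal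
  transformation, so that the first three points may be replaced by the triangular (Cholesky) frame
  of their Gram matrix without changing the law of the remaining ones. In this frame
  $(s_{1j},s_{2j},s_{3j})$ is a linear image of the first three coordinates of a uniform point of
  $S^3$, which have the density $\mathrm{const}\cdot(1-|v|^2)^{-1/2}$; these coordinates determine the
  fourth one up to an independent fair sign. The signs enter $s_{4j}$ only through their products with
  the sign of the fourth point, and these products determine all the other $s_{ij}$.\<close>

text \<open>The rotation carrying the first three points to the frame depends on those points. It is
  chosen inside the integral over the remaining points, with the first three held fixed, and leaves
  that integral unchanged; hence it never has to depend measurably on anything. The frame makes
  sense only where the Gram matrix is positive definite. That this holds almost surely comes from
  the law of the three coefficients, which is computed without the frame by rotating at most two
  points at a time. That law is flat because two square roots cancel: two coordinates of a uniform
  point of S^3 are uniform in the unit disc, so s_12 has a density proportional to sqrt(1 - s_12^2),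
  while for fixed s_12 the pair (s_13, s_23) is an affine image of the disc with Jacobian sqrt(1 -
  s_12^2). The power -1/2 of det Delta_j arises from det Delta_j = det G (1 - |v|^2), with G the
  first Gram matrix, since the triangular map has Jacobian sqrt(det G). No normalizing constant is
  evaluated: positivity and finiteness are read off from the total mass one.\<close>

section \<open>Lebesgue measure and orthogonal maps\<close>

text \<open>For the unit ball $B$, Fubini and a shift in each variable give
  $N(A)\,\lambda(B) = \lambda(A)\,N(B)$.\<close>

lemma translation_invariant_eq_lborel:
  fixes N :: "'a::euclidean_space measure"
  assumes [simp, measurable_cong]: "sets N = sets borel"
    and sf: "sigma_finite_measure N"
    and inv: "\<And>c. distr N borel (\<lambda>x. c + x) = N"
    and B: "emeasure N (ball 0 1) = emeasure lborel (ball (0::'a) 1)"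
  shows "N = lborel"
proof (rule measure_eqI)
  fix A assume "A \<in> sets N"
  then have [measurable]: "A \<in> sets borel" by simp
  interpret N: sigma_finite_measure N by fact
  interpret P: pair_sigma_finite lborel N
    by standard
  let ?B = "ball (0::'a) 1"
  have [measurable]: "ball c r \<in> sets borel" for c :: 'a and r
    by (intro borel_open open_ball)
  have shiftN: "(\<integral>\<^sup>+x. f x \<partial>N) = (\<integral>\<^sup>+x. f (c + x) \<partial>N)" if "f \<in> borel_measurable borel" for f c
    by (subst inv[of c, symmetric]) (use that in \<open>simp add: nn_integral_distr\<close>)
  have shiftL: "(\<integral>\<^sup>+x. f x \<partial>lborel) = (\<integral>\<^sup>+x. f (c + x) \<partial>lborel)" if "f \<in> borel_measurable borel"
      for f and c :: 'a
    by (subst lborel_distr_plus[of c, symmetric]) (use that in \<open>simp add: nn_integral_distr\<close>)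
  have ballN: "emeasure N (ball y 1) = emeasure lborel ?B" for y
  proof -
    have "emeasure N (ball y 1) = (\<integral>\<^sup>+x. indicator (ball y 1) x \<partial>N)" by simp
    also have "\<dots> = (\<integral>\<^sup>+x. indicator (ball y 1) (y + x) \<partial>N)"
      by (rule shiftN) (intro borel_measurable_indicator borel_open open_ball)
    also have "\<dots> = (\<integral>\<^sup>+x. indicator ?B x \<partial>N)"
      by (rule nn_integral_cong) (simp add: indicator_def dist_norm norm_minus_commute)
    finally show ?thesis using B by simp
  qed
  have "emeasure N A * emeasure lborel ?B
      = (\<integral>\<^sup>+y. (\<integral>\<^sup>+x. indicator A x * indicator ?B y \<partial>N) \<partial>lborel)"
    by (simp add: nn_integral_multc nn_integral_cmult nn_integral_cmult_indicator)
  also have "\<dots> = (\<integral>\<^sup>+y. (\<integral>\<^sup>+x. indicator A (y + x) * indicator ?B y \<partial>N) \<partial>lborel)"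
    by (rule nn_integral_cong, subst shiftN) auto
  also have "\<dots> = (\<integral>\<^sup>+x. (\<integral>\<^sup>+y. indicator A (y + x) * indicator ?B y \<partial>lborel) \<partial>N)"
    by (rule P.Fubini'[symmetric]) measurable
  also have "\<dots> = (\<integral>\<^sup>+x. (\<integral>\<^sup>+y. indicator A y * indicator ?B (y - x) \<partial>lborel) \<partial>N)"
  proof (rule nn_integral_cong)
    fix x
    show "(\<integral>\<^sup>+y. indicator A (y + x) * indicator ?B y \<partial>lborel)
        = (\<integral>\<^sup>+y. indicator A y * indicator ?B (y - x) \<partial>lborel)"
      by (subst shiftL[where c = x and f = "\<lambda>y. indicator A y * indicator ?B (y - x)"])
         (auto simp: add.commute)
  qed
  also have "\<dots> = (\<integral>\<^sup>+y. (\<integral>\<^sup>+x. indicator A y * indicator ?B (y - x) \<partial>N) \<partial>lborel)"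
    by (rule P.Fubini') measurable
  also have "\<dots> = (\<integral>\<^sup>+y. (\<integral>\<^sup>+x. indicator A y * indicator (ball y 1) x \<partial>N) \<partial>lborel)"
    by (intro nn_integral_cong) (auto simp: indicator_def dist_norm norm_minus_commute)
  also have "\<dots> = emeasure lborel A * emeasure lborel ?B"
    by (simp add: nn_integral_cmult nn_integral_multc ballN)
  finally have "emeasure N A * emeasure lborel ?B = emeasure lborel A * emeasure lborel ?B" .
  moreover have "emeasure lborel ?B = ennreal (measure lborel ?B)"
    using emeasure_lborel_ball_finite[of "0::'a" 1] by (simp add: emeasure_eq_ennreal_measure)
  moreover have "measure lborel ?B > 0"
    by (simp add: content_ball_pos)
  ultimately show "emeasure N A = emeasure lborel A"
    by (simp add: ennreal_mult_cancel_left mult.commute[of _ "ennreal _"])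
qed simp

lemma orthogonal_transformation_inner:
  "orthogonal_transformation R \<Longrightarrow> R x \<bullet> R y = x \<bullet> y"
  by (simp add: orthogonal_transformation_def)

lemma orthogonal_transformation_measurable:
  fixes f :: "'a::euclidean_space \<Rightarrow> 'a"
  assumes "orthogonal_transformation f"
  shows "f \<in> borel \<rightarrow>\<^sub>M borel"
  using assms
  by (intro borel_measurable_continuous_onI linear_continuous_on linear_linear[THEN iffD2])
     (auto simp: linear_conv_bounded_linear[symmetric] orthogonal_transformation_linear)

text \<open>As \<open>c + f x = f (g c + x)\<close> for the inverse \<open>g\<close> of
  \<open>f\<close>, the image of Lebesgue measure is again translation invariant; as
  \<open>f\<close> preserves norms, the unit ball keeps its mass. No determinant enters.\<close>

lemma lborel_distr_orthogonal:
  fixes f :: "'a::euclidean_space \<Rightarrow> 'a"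
  assumes f: "orthogonal_transformation f"
  shows "distr lborel borel f = lborel"
proof (rule translation_invariant_eq_lborel)
  note [measurable] = orthogonal_transformation_measurable[OF f]
  obtain g where g: "orthogonal_transformation g" "\<And>x. g (f x) = x" "\<And>x. f (g x) = x"
    using f
    by (metis orthogonal_transformation_bij orthogonal_transformation_inv inv_f_f surj_f_inv_f
        bij_def)
  note [measurable] = orthogonal_transformation_measurable[OF g(1)]
  have nf: "norm (f x) = norm x" for x
    using f by (simp add: orthogonal_transformation)
  have vball: "f -` ball 0 r = ball 0 r" for r
    by (auto simp: nf)
  show "sigma_finite_measure (distr lborel borel f)"
  proof
    show "\<exists>A. countable A \<and> A \<subseteq> sets (distr lborel borel f) \<and> \<Union>A = space (distr lborel borel f)
        \<and> (\<forall>a\<in>A. emeasure (distr lborel borel f) a \<noteq> \<infinity>)"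
    proof (intro exI conjI)
      show "countable (range (\<lambda>n::nat. ball (0::'a) (real n)))" by simp
      show "\<Union>(range (\<lambda>n::nat. ball (0::'a) (real n))) = space (distr lborel borel f)"
        using reals_Archimedean2 by auto
    qed (auto simp: emeasure_distr vball emeasure_lborel_ball_finite[unfolded
        infinity_ennreal_def, THEN less_imp_neq])
  qed
  show "distr (distr lborel borel f) borel (\<lambda>x. c + x) = distr lborel borel f" for c
  proof -
    have "distr (distr lborel borel f) borel (\<lambda>x. c + x) = distr lborel borel (\<lambda>x. f (g c + x))"
      using orthogonal_transformation_linear[OF f]
      by (subst distr_distr) (auto simp: o_def linear_add g)
    also have "\<dots> = distr (distr lborel borel (\<lambda>x. g c + x)) borel f"
      by (subst distr_distr) (auto simp: o_def)
    finally show ?thesis by (simp add: lborel_distr_plus)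
  qed
  show "emeasure (distr lborel borel f) (ball 0 1) = emeasure lborel (ball (0::'a) 1)"
    by (simp add: emeasure_distr vball)
qed simp

text \<open>The reflection in the hyperplane orthogonal to $a - b$; for $a = b$ the division by $0$ turns the
  formula into the identity.\<close>

lemma householder:
  fixes a b :: "'a::real_inner"
  assumes "norm a = norm b"
  shows "\<exists>R. orthogonal_transformation R \<and> R a = b \<and> (\<forall>z. z \<bullet> a = z \<bullet> b \<longrightarrow> R z = z)"
proof -
  define d where "d = a - b"
  define R where "R z = z - (2 * (z \<bullet> d) / (d \<bullet> d)) *\<^sub>R d" for z
  have ab: "a \<bullet> a = b \<bullet> b" using assms by (simp add: norm_eq)
  have "linear R"
    by (rule linearI) (auto simp: R_def inner_add_left algebra_simps add_divide_distrib)
  moreover have "R v \<bullet> R w = v \<bullet> w" for v w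
    by (cases "d \<bullet> d = 0") (simp_all add: R_def inner_diff_left inner_diff_right inner_commute
        field_simps)
  moreover have "R a = b"
  proof (cases "d = 0")
    case False
    have "2 * (a \<bullet> d) = d \<bullet> d"
      using ab by (simp add: d_def inner_diff_left inner_diff_right inner_commute)
    then show ?thesis using False by (simp add: R_def) (simp add: d_def)
  qed (simp add: R_def d_def)
  moreover have "R z = z" if "z \<bullet> a = z \<bullet> b" for z
    using that by (simp add: R_def d_def inner_diff_right)
  ultimately show ?thesis
    unfolding orthogonal_transformation_def by (intro exI[of _ R]) auto
qed

text \<open>One reflection per index: the one carrying the current image of $x_k$ to $y_k$ fixes the earlier
  $y_i$, since these have the same inner product with both points.\<close>

lemma gram_eq_imp_orthogonal:
  fixes x y :: "nat \<Rightarrow> 'a::real_inner"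
  assumes "\<And>i j. i < k \<Longrightarrow> j < k \<Longrightarrow> x i \<bullet> x j = y i \<bullet> y j"
  shows "\<exists>R. orthogonal_transformation R \<and> (\<forall>i<k. R (x i) = y i)"
  using assms
proof (induction k)
  case 0
  show ?case by (intro exI[of _ "\<lambda>x. x"]) (simp add: orthogonal_transformation_def
      linear_id[unfolded id_def])
next
  case (Suc k)
  obtain R where R: "orthogonal_transformation R" "\<And>i. i < k \<Longrightarrow> R (x i) = y i"
    using Suc by auto
  have "norm (R (x k)) = norm (y k)"
    using R(1) Suc.prems[of k k] by (simp add: orthogonal_transformation norm_eq)
  then obtain H where H: "orthogonal_transformation H" "H (R (x k)) = y k"
      "\<And>z. z \<bullet> R (x k) = z \<bullet> y k \<Longrightarrow> H z = z"
    using householder by meson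
  have "H (R (x i)) = y i" if "i < Suc k" for i
  proof (cases "i = k")
    case False
    then have i: "i < k" using that by simp
    have "y i \<bullet> R (x k) = R (x i) \<bullet> R (x k)" by (simp add: R i)
    also have "\<dots> = y i \<bullet> y k"
      using R(1) Suc.prems[of i k] i by (simp add: orthogonal_transformation_def)
    finally show ?thesis by (simp add: R i H)
  qed (simp add: H)
  then show ?case
    using orthogonal_transformation_compose[OF H(1) R(1)]
        by (intro exI[of _ "H \<circ> R"]) (simp add: o_def)
qed

section \<open>The uniform measure on a sphere\<close>

text \<open>The radial projection of the uniform law on the unit ball stands in for the normalized
  surface measure: integrals reduce to Lebesgue integrals, and invariance under orthogonal maps is
  inherited. The origin, where \<open>sgn\<close> is \<open>0\<close>, is a null set.\<close>

definition sphere_measure :: "'a::euclidean_space measure" where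
  "sphere_measure = distr (uniform_measure lborel (cball 0 1)) borel sgn"

lemma sets_sphere_measure [simp, measurable_cong]: "sets sphere_measure = sets borel"
  and space_sphere_measure [simp]: "space sphere_measure = UNIV"
  by (simp_all add: sphere_measure_def)

lemma sgn_borel_measurable [measurable]:
  "(sgn :: 'a::euclidean_space \<Rightarrow> 'a) \<in> borel_measurable borel"
  unfolding sgn_div_norm by measurable

lemma cball_borel_measurable [measurable]: "cball (c :: 'a::euclidean_space) r \<in> sets borel"
  by (intro borel_closed closed_cball)

lemma fst_borel_measurable [measurable]:
  "(fst :: 'a::second_countable_topology \<times> 'b::second_countable_topology \<Rightarrow> 'a)
      \<in> borel_measurable borel"
  unfolding borel_prod[symmetric] by measurable

lemma snd_borel_measurable [measurable]:
  "(snd :: 'a::second_countable_topology \<times> 'b::second_countable_topology \<Rightarrow> 'b)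
      \<in> borel_measurable borel"
  unfolding borel_prod[symmetric] by measurable

lemma emeasure_lborel_cball:
  "emeasure lborel (cball (0::'a::euclidean_space) 1) \<noteq> 0"
  "emeasure lborel (cball (0::'a::euclidean_space) 1) \<noteq> \<top>"
proof -
  have "emeasure lborel (cball (0::'a) 1) = ennreal (measure lborel (cball (0::'a) 1))"
    using emeasure_lborel_cball_finite[of "0::'a" 1] by (simp add: emeasure_eq_ennreal_measure)
  moreover have "measure lborel (cball (0::'a) 1) > 0"
    by (simp add: content_cball_pos)
  ultimately show "emeasure lborel (cball (0::'a) 1) \<noteq> 0" "emeasure lborel (cball (0::'a) 1) \<noteq> \<top>"
    by auto
qed

lemma prob_space_sphere_measure: "prob_space (sphere_measure :: 'a::euclidean_space measure)"
  unfolding sphere_measure_def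
  using emeasure_lborel_cball[where 'a='a]
  by (intro prob_space.prob_space_distr prob_space_uniform_measure) auto

lemma nn_integral_sphere_measure:
  fixes f :: "'a::euclidean_space \<Rightarrow> ennreal"
  assumes [measurable]: "f \<in> borel_measurable borel"
  shows "(\<integral>\<^sup>+x. f x \<partial>sphere_measure)
    = (\<integral>\<^sup>+x. f (sgn x) * indicator (cball 0 1) x \<partial>lborel) / emeasure lborel (cball (0::'a) 1)"
  unfolding sphere_measure_def by (simp add: nn_integral_distr nn_integral_uniform_measure)

lemma AE_sphere_measure_norm: "AE x in (sphere_measure :: 'a::euclidean_space measure). norm x = 1"
proof -
  have "AE x in uniform_measure lborel (cball (0::'a) 1). norm (sgn x) = 1"
    by (rule AE_uniform_measureI) (use AE_lborel_singleton[of "0::'a"] in \<open>auto simp: norm_sgn\<close>)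
  then show ?thesis
    unfolding sphere_measure_def by (subst AE_distr_iff) auto
qed

text \<open>An orthogonal map commutes with \<open>sgn\<close> and preserves both the ball and
  Lebesgue measure.\<close>

lemma distr_sphere_measure_orthogonal:
  fixes R :: "'a::euclidean_space \<Rightarrow> 'a"
  assumes R: "orthogonal_transformation R"
  shows "distr sphere_measure borel R = sphere_measure"
proof (rule measure_eqI)
  note [measurable] = orthogonal_transformation_measurable[OF R]
  have nR: "norm (R x) = norm x" for x using R by (simp add: orthogonal_transformation)
  have sR: "R (sgn x) = sgn (R x)" for x
    using orthogonal_transformation_linear[OF R] by (simp add: sgn_div_norm nR linear_scale)
  fix A assume "A \<in> sets (distr sphere_measure borel R)"
  then have [measurable]: "A \<in> sets borel" by simp
  have "emeasure (distr sphere_measure borel R) A = (\<integral>\<^sup>+x. indicator A (R x) \<partial>sphere_measure)"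
    by (subst nn_integral_distr[symmetric, of R _ borel]) auto
  also have "\<dots> = (\<integral>\<^sup>+x. indicator A (sgn (R x)) * indicator (cball 0 1) (R x) \<partial>lborel) / emeasure
      lborel (cball (0::'a) 1)"
    by (subst nn_integral_sphere_measure) (auto simp: sR nR indicator_def intro!: arg_cong2[where
        f="(/)"] nn_integral_cong)
  also have "\<dots> = (\<integral>\<^sup>+x. indicator A (sgn x) * indicator (cball 0 1) x \<partial>distr lborel borel R) /
      emeasure lborel (cball (0::'a) 1)"
    by (subst nn_integral_distr) auto
  also have "\<dots> = emeasure sphere_measure A"
    by (simp add: lborel_distr_orthogonal[OF R] nn_integral_sphere_measure[symmetric])
  finally show "emeasure (distr sphere_measure borel R) A = emeasure sphere_measure A" .
qed simp

section \<open>Projection of the uniform measure along the last coordinate\<close>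

lemma nn_integral_lborel_scale:
  fixes f :: "'a::euclidean_space \<Rightarrow> ennreal"
  assumes [measurable]: "f \<in> borel_measurable borel" and r: "r > 0"
  shows "(\<integral>\<^sup>+x. f x \<partial>lborel) = ennreal (r ^ DIM('a)) * (\<integral>\<^sup>+x. f (r *\<^sub>R x) \<partial>lborel)"
  using r by (subst lborel_affine[of r 0]) (auto simp: nn_integral_density nn_integral_distr
      nn_integral_cmult)

text \<open>The substitution $r = \sqrt{|x|^2 + h^2}$, for which $dh = r\,dr / \sqrt{r^2 - |x|^2}$. A further scaling
  $x = r v$ then yields the density $(1 - |v|^2)^{-1/2}$ without a multivariate change of variables.\<close>

lemma nn_integral_halfspace_radial:
  fixes x :: "'a::euclidean_space" and f :: "'a \<Rightarrow> ennreal"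
  assumes [measurable]: "f \<in> borel_measurable borel" and x: "x \<noteq> 0"
  shows "(\<integral>\<^sup>+h. f (x /\<^sub>R sqrt ((norm x)\<^sup>2 + h\<^sup>2)) * indicator {h. 0 < h \<and> (norm x)\<^sup>2
      + h\<^sup>2 \<le> 1} h \<partial>lborel)
    = (\<integral>\<^sup>+r. f (x /\<^sub>R r) * ennreal (r / sqrt (r\<^sup>2 - (norm x)\<^sup>2)) * indicator {norm x<..1} r
        \<partial>lborel)"
    (is "?L = ?R")
proof (cases "norm x < 1")
  case False
  have "(norm x)\<^sup>2 + h\<^sup>2 > 1" if "h > 0" for h :: real
  proof -
    have "1 \<le> (norm x)\<^sup>2" using False
        by (simp add: power2_eq_square) (metis mult_mono' mult_1 zero_le_one linorder_not_less)
    then show ?thesis using that by (smt (verit) zero_less_power2)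
  qed
  then have "?L = (\<integral>\<^sup>+h. 0 \<partial>(lborel :: real measure))"
    by (intro nn_integral_cong) (force simp: indicator_def not_less[symmetric])
  moreover have "?R = (\<integral>\<^sup>+h. 0 \<partial>(lborel :: real measure))"
    using False by (intro nn_integral_cong) (auto simp: indicator_def)
  ultimately show ?thesis by simp
next
  case True
  \<comment> \<open>\<open>g\<close> maps the interval from \<open>0\<close> to \<open>H\<close>
    onto the one from \<open>norm x\<close> to \<open>1\<close>.\<close>
  define H where "H = sqrt (1 - (norm x)\<^sup>2)"
  define g where "g h = sqrt ((norm x)\<^sup>2 + h\<^sup>2)" for h :: real
  define F where "F r = f (x /\<^sub>R r) * ennreal (r / sqrt (r\<^sup>2 - (norm x)\<^sup>2))" for r :: real
  have n1: "(norm x)\<^sup>2 < 1" using True by (simp add: power_less_one_iff)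
  have pos: "(norm x)\<^sup>2 + h\<^sup>2 > 0" for h :: real using x by (simp add: add_pos_nonneg)
  have H: "0 < H" "H\<^sup>2 = 1 - (norm x)\<^sup>2" using n1 by (auto simp: H_def)
  have g0: "g 0 = norm x" "g H = 1" by (simp_all add: g_def H)
  have gpos: "g h > 0" for h using pos by (simp add: g_def)
  \<comment> \<open>Closing the interval on the left changes nothing: at \<open>r = norm x\<close>
    the divisor is \<open>0\<close>, and division by \<open>0\<close> gives
    \<open>0\<close>.\<close>
  have "?R = (\<integral>\<^sup>+r. F r * indicator {g 0..g H} r \<partial>lborel)"
    unfolding F_def g0 by (intro nn_integral_cong) (auto simp: indicator_def)
  also have "\<dots> = (\<integral>\<^sup>+h. F (g h) * ennreal (h / g h) * indicator {0..H} h \<partial>lborel)"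
  proof (rule nn_integral_substitution_aux)
    show "F \<in> borel_measurable borel" unfolding F_def by measurable
    show "(g has_real_derivative h / g h) (at h)" for h
    proof -
      have "((\<lambda>h. (norm x)\<^sup>2 + h\<^sup>2) has_real_derivative 2 * h) (at h)"
        by (auto intro!: derivative_eq_intros)
      from DERIV_chain2[OF DERIV_real_sqrt[OF pos] this] show ?thesis
        by (simp add: g_def[abs_def] field_simps)
    qed
    show "continuous_on {0..H} (\<lambda>h. h / g h)"
      using gpos by (auto simp: g_def intro!: continuous_intros)
    show "0 \<le> h / g h" if "h \<in> {0..H}" for h using that gpos[of h] by simp
  qed (use H in auto)
  also have "\<dots> = ?L"
  proof (rule nn_integral_cong)
    fix h :: real
    have eq: "ennreal (g h / sqrt ((g h)\<^sup>2 - (norm x)\<^sup>2)) * ennreal (h / g h) = 1" if "h > 0"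
    proof -
      have "(g h)\<^sup>2 - (norm x)\<^sup>2 = h\<^sup>2" using pos[of h] by (simp add: g_def)
      then show ?thesis using that gpos[of h] by (simp add: ennreal_mult[symmetric])
    qed
    have mem: "0 < h \<and> (norm x)\<^sup>2 + h\<^sup>2 \<le> 1 \<longleftrightarrow> 0 < h \<and> h \<le> H"
    proof -
      have "h \<le> H \<longleftrightarrow> h\<^sup>2 \<le> H\<^sup>2" if "0 < h" using that H(1)
          by (simp add: abs_le_square_iff[symmetric])
      then show ?thesis by (auto simp: H(2))
    qed
    show "F (g h) * ennreal (h / g h) * indicator {0..H} h
        = f (x /\<^sub>R sqrt ((norm x)\<^sup>2 + h\<^sup>2)) * indicator {h. 0 < h \<and> (norm x)\<^sup>2 + h\<^sup>2 \<le> 1} h"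
    proof (cases "0 < h")
      case True
      then show ?thesis using eq mem
        by (auto simp: F_def indicator_def mult.assoc g_def[symmetric])
    next
      case False
      then have "h = 0 \<or> h \<notin> {0..H}" by auto
      then show ?thesis using False by (auto simp: indicator_def)
    qed
  qed
  finally show ?thesis by simp
qed

lemma nn_integral_lborel_pair:
  fixes F :: "'a::euclidean_space \<times> 'b::euclidean_space \<Rightarrow> ennreal"
  assumes "F \<in> borel_measurable borel"
  shows "(\<integral>\<^sup>+y. F y \<partial>lborel) = (\<integral>\<^sup>+x. (\<integral>\<^sup>+h. F (x, h) \<partial>lborel) \<partial>lborel)"
  using assms lborel.nn_integral_fst[of F "lborel :: 'a measure"]
  by (simp add: lborel_prod)

text \<open>After the order of integration is exchanged, the scaling \<open>x = r v\<close> turns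
  the integrand for a fixed radius \<open>r\<close> into one depending on \<open>v\<close> only. The
  Jacobian \<open>r ^ DIM('a)\<close> is all that remains of \<open>r\<close>, and its integral goes
  into the constant. The factor \<open>2\<close> accounts for the two half-spaces.\<close>

lemma nn_integral_sphere_measure_fst:
  fixes f :: "'a::euclidean_space \<Rightarrow> ennreal"
  assumes [measurable]: "f \<in> borel_measurable borel"
  shows "(\<integral>\<^sup>+y. f (fst y) \<partial>(sphere_measure :: ('a \<times> real) measure))
    = 2 * (\<integral>\<^sup>+r. ennreal (r ^ DIM('a)) * indicator {0<..1} r \<partial>lborel) / emeasure lborel (cball
        (0::'a \<times> real) 1)
      * (\<integral>\<^sup>+v. f v * ennreal (1 / sqrt (1 - (norm v)\<^sup>2)) * indicator {v. norm v < 1} v \<partial>lborel)"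
proof -
  define g where "g x h = f (x /\<^sub>R sqrt ((norm x)\<^sup>2 + h\<^sup>2))" for x :: 'a and h :: real
  define P where "P x h \<longleftrightarrow> (norm x)\<^sup>2 + h\<^sup>2 \<le> 1" for x :: 'a and h :: real
  define W where "W v = f v * ennreal (1 / sqrt (1 - (norm v)\<^sup>2)) * indicator {v. norm v < 1} v"
      for v :: 'a
  have [measurable]: "W \<in> borel_measurable borel" unfolding W_def by measurable
  have [measurable]: "(\<lambda>(x, h). g x h) \<in> borel_measurable (borel \<Otimes>\<^sub>M borel)"
    unfolding g_def by measurable
  have [measurable]: "Measurable.pred (borel \<Otimes>\<^sub>M borel) (\<lambda>(x, h). P x h)"
    unfolding P_def by measurable
  \<comment> \<open>The integrand depends on \<open>h\<close> only through its square; the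
    hyperplane \<open>h = 0\<close> is dropped as a null set.\<close>
  have half: "(\<integral>\<^sup>+h. g x h * indicator {h. P x h} h \<partial>lborel)
      = 2 * (\<integral>\<^sup>+h. g x h * indicator {h. 0 < h \<and> P x h} h \<partial>lborel)" for x
  proof -
    have "(\<integral>\<^sup>+h. g x h * indicator {h. P x h} h \<partial>lborel)
      = (\<integral>\<^sup>+h. g x h * indicator {h. 0 < h \<and> P x h} h + g x (-h) * indicator {h. 0 < h
          \<and> P x h} (-h) \<partial>lborel)"
      by (rule nn_integral_cong_AE, use AE_lborel_singleton[of "0::real"] in eventually_elim)
         (auto simp: indicator_def g_def P_def)
    also have "\<dots> = (\<integral>\<^sup>+h. g x h * indicator {h. 0 < h \<and> P x h} h \<partial>lborel)
       + (\<integral>\<^sup>+h. g x (-h) * indicator {h. 0 < h \<and> P x h} (-h) \<partial>lborel)"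
      by (rule nn_integral_add) measurable
    also have "(\<integral>\<^sup>+h. g x (-h) * indicator {h. 0 < h \<and> P x h} (-h) \<partial>lborel)
      = (\<integral>\<^sup>+h. g x h * indicator {h. 0 < h \<and> P x h} h \<partial>lborel)"
      by (subst (2) nn_integral_real_affine[where c="-1" and t=0]) auto
    finally show ?thesis by (simp add: mult_2)
  qed
  have slice: "(\<integral>\<^sup>+x. f (x /\<^sub>R r) * ennreal (r / sqrt (r\<^sup>2 - (norm x)\<^sup>2)) * indicator {norm x<..1}
      r \<partial>lborel)
     = ennreal (r ^ DIM('a)) * indicator {0<..1} r * (\<integral>\<^sup>+v. W v \<partial>lborel)" for r
  proof (cases "0 < r \<and> r \<le> 1")
    case True
    then have r: "r > 0" by simp
    have "(\<integral>\<^sup>+x. f (x /\<^sub>R r) * ennreal (r / sqrt (r\<^sup>2 - (norm x)\<^sup>2)) * indicator {norm x<..1} r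
        \<partial>lborel)
      = ennreal (r ^ DIM('a)) * (\<integral>\<^sup>+v. f ((r *\<^sub>R v) /\<^sub>R r) * ennreal (r / sqrt (r\<^sup>2 - (norm (r *\<^sub>R
          v))\<^sup>2)) * indicator {norm (r *\<^sub>R v)<..1} r \<partial>lborel)"
      by (rule nn_integral_lborel_scale) (use r in \<open>auto simp: indicator_def\<close>)
    also have "(\<integral>\<^sup>+v. f ((r *\<^sub>R v) /\<^sub>R r) * ennreal (r / sqrt (r\<^sup>2 - (norm (r *\<^sub>R v))\<^sup>2)) *
        indicator {norm (r *\<^sub>R v)<..1} r \<partial>lborel) = (\<integral>\<^sup>+v. W v \<partial>lborel)"
    proof (rule nn_integral_cong)
      fix v :: 'a
      have "r\<^sup>2 - (norm (r *\<^sub>R v))\<^sup>2 = r\<^sup>2 * (1 - (norm v)\<^sup>2)"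
        by (simp add: power_mult_distrib algebra_simps)
      then have "r / sqrt (r\<^sup>2 - (norm (r *\<^sub>R v))\<^sup>2) = 1 / sqrt (1 - (norm v)\<^sup>2)"
        using r by (simp add: real_sqrt_mult)
      then show "f ((r *\<^sub>R v) /\<^sub>R r) * ennreal (r / sqrt (r\<^sup>2 - (norm (r *\<^sub>R v))\<^sup>2)) * indicator
          {norm (r *\<^sub>R v)<..1} r = W v"
        using True by (auto simp: W_def indicator_def)
    qed
    finally show ?thesis using True by simp
  next
    case False
    then have "indicator {norm x<..1} r = (0::ennreal)" for x :: 'a
      by (auto simp: indicator_def dest: le_less_trans[OF norm_ge_zero])
    then show ?thesis using False by (auto simp: indicator_def)
  qed
  have "(\<integral>\<^sup>+y. f (fst (sgn y)) * indicator (cball 0 1) y \<partial>(lborel :: ('a \<times> real) measure))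
     = (\<integral>\<^sup>+x. (\<integral>\<^sup>+h. g x h * indicator {h. P x h} h \<partial>lborel) \<partial>lborel)"
    by (subst nn_integral_lborel_pair)
       (auto simp: sgn_div_norm g_def P_def norm_Pair indicator_def intro!: nn_integral_cong)
  also have "\<dots> = (\<integral>\<^sup>+x. 2 * (\<integral>\<^sup>+r. f (x /\<^sub>R r) * ennreal (r / sqrt (r\<^sup>2 - (norm x)\<^sup>2)) * indicator
      {norm x<..1} r \<partial>lborel) \<partial>lborel)"
    by (rule nn_integral_cong_AE, use AE_lborel_singleton[of "0::'a"] in eventually_elim)
       (simp only: half, simp add: g_def P_def nn_integral_halfspace_radial)
  also have "\<dots> = 2 * (\<integral>\<^sup>+x. (\<integral>\<^sup>+r. f (x /\<^sub>R r) * ennreal (r / sqrt (r\<^sup>2 - (norm x)\<^sup>2)) * indicator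
      {norm x<..1} r \<partial>lborel) \<partial>lborel)"
    by (rule nn_integral_cmult) (simp add: indicator_def)
  also have "(\<integral>\<^sup>+x. (\<integral>\<^sup>+r. f (x /\<^sub>R r) * ennreal (r / sqrt (r\<^sup>2 - (norm x)\<^sup>2)) * indicator {norm
      x<..1} r \<partial>lborel) \<partial>lborel)
     = (\<integral>\<^sup>+r. (\<integral>\<^sup>+x. f (x /\<^sub>R r) * ennreal (r / sqrt (r\<^sup>2 - (norm x)\<^sup>2)) * indicator {norm x<..1}
         r \<partial>lborel) \<partial>lborel)"
    by (rule lborel_pair.Fubini') (simp add: indicator_def)
  also have "\<dots> = (\<integral>\<^sup>+r. ennreal (r ^ DIM('a)) * indicator {0<..1} r \<partial>lborel) * (\<integral>\<^sup>+v. W v \<partial>lborel)"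
    by (simp add: slice nn_integral_multc)
  finally show ?thesis
    by (subst nn_integral_sphere_measure) (simp_all add: W_def divide_ennreal_def mult_ac)
qed

text \<open>The factor \<open>k\<close> is finite because the radial integral \<open>q\<close> is at
  most \<open>1\<close> and the ball has nonzero volume; it is nonzero because the total mass is
  \<open>1\<close>.\<close>

lemma sphere_measure_fst_density:
  obtains c :: real where "c > 0"
    "distr (sphere_measure :: ('a::euclidean_space \<times> real) measure) borel fst
      = density lborel (\<lambda>v. if norm v < 1 then ennreal (c / sqrt (1 - (norm v)\<^sup>2)) else 0)"
proof -
  let ?V = "emeasure lborel (cball (0::'a \<times> real) 1)"
  define q where "q = (\<integral>\<^sup>+(r::real). ennreal (r ^ DIM('a)) * indicator {0<..1} r \<partial>lborel)"
  define k where "k = 2 * q / ?V"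
  have "q \<le> (\<integral>\<^sup>+(r::real). indicator {0<..1} r \<partial>lborel)"
    unfolding q_def by (intro nn_integral_mono) (auto simp: indicator_def power_le_one)
  then have "q \<noteq> \<top>" by (auto simp: top_unique)
  then have "k \<noteq> \<top>"
    using emeasure_lborel_cball[where 'a="'a \<times> real"]
    by (auto simp: k_def ennreal_divide_eq_top_iff ennreal_mult_eq_top_iff)
  then obtain c where c: "k = ennreal c" "c \<ge> 0" by (cases k) auto
  have int: "(\<integral>\<^sup>+y. f (fst y) \<partial>(sphere_measure :: ('a \<times> real) measure))
      = (\<integral>\<^sup>+v. (if norm v < 1 then ennreal (c / sqrt (1 - (norm v)\<^sup>2)) else 0) * f v \<partial>lborel)"
    if [measurable]: "f \<in> borel_measurable borel" for f :: "'a \<Rightarrow> ennreal"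
  proof -
    have "(\<integral>\<^sup>+y. f (fst y) \<partial>(sphere_measure :: ('a \<times> real) measure))
      = k * (\<integral>\<^sup>+v. f v * ennreal (1 / sqrt (1 - (norm v)\<^sup>2)) * indicator {v. norm v < 1} v \<partial>lborel)"
      unfolding k_def q_def by (rule nn_integral_sphere_measure_fst) measurable
    also have "\<dots> = (\<integral>\<^sup>+v. k * (f v * ennreal (1 / sqrt (1 - (norm v)\<^sup>2)) * indicator {v. norm v <
        1} v) \<partial>lborel)"
      by (rule nn_integral_cmult[symmetric]) measurable
    also have "\<dots> = (\<integral>\<^sup>+v. (if norm v < 1 then ennreal (c / sqrt (1 - (norm v)\<^sup>2)) else 0) * f v
        \<partial>lborel)"
    proof (rule nn_integral_cong)
      fix v :: 'a
      have "ennreal (1 / sqrt (1 - (norm v)\<^sup>2)) * ennreal c = ennreal (c / sqrt (1 - (norm v)\<^sup>2))"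
        if "norm v < 1"
        using c(2) that by (subst ennreal_mult[symmetric]) (auto simp: power_le_one)
      then show "k * (f v * ennreal (1 / sqrt (1 - (norm v)\<^sup>2)) * indicator {v. norm v < 1} v)
         = (if norm v < 1 then ennreal (c / sqrt (1 - (norm v)\<^sup>2)) else 0) * f v"
        by (auto simp: c(1)) (metis mult.commute mult.left_commute)
    qed
    finally show ?thesis .
  qed
  interpret S: prob_space "sphere_measure :: ('a \<times> real) measure"
      by (rule prob_space_sphere_measure)
  have "c > 0"
  proof (rule ccontr)
    assume "\<not> c > 0"
    then have "c = 0" using c by simp
    then show False using int[of "\<lambda>_. 1"] S.emeasure_space_1 by (simp cong: if_cong)
  qed
  moreover have "distr (sphere_measure :: ('a \<times> real) measure) borel fst
      = density lborel (\<lambda>v. if norm v < 1 then ennreal (c / sqrt (1 - (norm v)\<^sup>2)) else 0)"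
  proof (rule measure_eqI)
    fix A :: "'a set" assume "A \<in> sets (distr (sphere_measure :: ('a \<times> real) measure) borel fst)"
    then have [measurable]: "A \<in> sets borel" by simp
    have "emeasure (distr (sphere_measure :: ('a \<times> real) measure) borel fst) A
      = (\<integral>\<^sup>+y. indicator A (fst y) \<partial>(sphere_measure :: ('a \<times> real) measure))"
      by (subst nn_integral_distr[symmetric, of fst _ borel]) (auto simp: borel_prod[symmetric])
    then show "emeasure (distr (sphere_measure :: ('a \<times> real) measure) borel fst) A
      = emeasure (density lborel (\<lambda>v.
          if norm v < 1 then ennreal (c / sqrt (1 - (norm v)\<^sup>2)) else 0)) A"
      by (subst emeasure_density) (auto simp: int)
  qed simp
  ultimately show ?thesis by (rule that)
qed

section \<open>Haar measure on powers of $SU(2)$\<close>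

lemma distr_PiM_map:
  assumes fin: "finite I"
    and M: "\<And>i. i \<in> I \<Longrightarrow> prob_space (M i)"
    and f [measurable]: "\<And>i. i \<in> I \<Longrightarrow> f i \<in> M i \<rightarrow>\<^sub>M N i"
  shows "distr (PiM I M) (PiM I N) (\<lambda>x. \<lambda>i\<in>I. f i (x i)) = PiM I (\<lambda>i. distr (M i) (N i) (f i))"
proof (cases "I = {}")
  case True
  have "(\<lambda>x. \<lambda>i\<in>{}. f i (x i)) = (\<lambda>x i. undefined)" by (auto simp: restrict_def)
  with True show ?thesis
    by (auto intro!: measure_eqI_finite[where A="{\<lambda>_. undefined}"]
        simp: PiM_empty emeasure_distr space_PiM sets_PiM_empty)
next
  case False
  then obtain i0 where i0: "i0 \<in> I" by auto
  \<comment> \<open>The locale for product measures wants a probability space at every index, not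
    only on \<open>I\<close>. Outside \<open>I\<close> the space at a fixed \<open>i0\<close> is
    repeated; the products over \<open>I\<close> do not see this.\<close>
  define J where "J i = (if i \<in> I then i else i0)" for i
  have J: "J i \<in> I" "i \<in> I \<Longrightarrow> J i = i" for i using i0 by (auto simp: J_def)
  interpret M: product_prob_space "\<lambda>i. M (J i)"
    by (intro product_prob_spaceI M J)
  interpret N: product_prob_space "\<lambda>i. distr (M (J i)) (N (J i)) (f (J i))"
    by (intro product_prob_spaceI prob_space.prob_space_distr M J f)
  have "distr (PiM I (\<lambda>i. M (J i))) (PiM I (\<lambda>i. N (J i))) (\<lambda>x. \<lambda>i\<in>I. f i (x i))
      = PiM I (\<lambda>i. distr (M (J i)) (N (J i)) (f (J i)))"
    (is "?D = _")
  proof (rule N.PiM_eqI[OF fin])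
    show "sets ?D = sets (PiM I (\<lambda>i. distr (M (J i)) (N (J i)) (f (J i))))"
      by (simp cong: sets_PiM_cong)
    fix A assume "\<And>i. i \<in> I \<Longrightarrow> A i \<in> sets (distr (M (J i)) (N (J i)) (f (J i)))"
    then have A: "A i \<in> sets (N i)" if "i \<in> I" for i using that J by fastforce
    have fm: "(\<lambda>x. \<lambda>i\<in>I. f i (x i)) \<in> PiM I (\<lambda>i. M (J i)) \<rightarrow>\<^sub>M PiM I (\<lambda>i. N (J i))"
      using f J by (intro measurable_restrict) (auto intro:
          measurable_compose[OF measurable_component_singleton])
    have "?D (Pi\<^sub>E I A) = emeasure (PiM I (\<lambda>i. M (J i))) (Pi\<^sub>E I (\<lambda>i. f i -` A i \<inter> space (M i)))"
      using A J fin
      by (subst emeasure_distr[OF fm])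
         (auto intro!: sets_PiM_I_finite arg_cong2[where f=emeasure]
             simp: space_PiM PiE_iff extensional_def)
    also have "\<dots> = (\<Prod>i\<in>I. emeasure (M (J i)) (f i -` A i \<inter> space (M i)))"
      using A J f by (intro M.emeasure_PiM fin) (auto intro!: measurable_sets)
    also have "\<dots> = (\<Prod>i\<in>I. emeasure (distr (M (J i)) (N (J i)) (f (J i))) (A i))"
      using A J f by (intro prod.cong) (auto simp: emeasure_distr)
    finally show "?D (Pi\<^sub>E I A) = (\<Prod>i\<in>I. emeasure (distr (M (J i)) (N (J i)) (f (J i))) (A i))" .
  qed
  moreover have "PiM I (\<lambda>i. M (J i)) = PiM I M" "PiM I (\<lambda>i. N (J i)) = PiM I N"
      "PiM I (\<lambda>i. distr (M (J i)) (N (J i)) (f (J i))) = PiM I (\<lambda>i. distr (M i) (N i) (f i))"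
    by (auto intro!: PiM_cong simp: J)
  ultimately show ?thesis by simp
qed

text \<open>The quaternion $p + qi + rj + tk$ stands for the matrix with first row $(p + qi, r + ti)$. The last
  coordinate is split off because it is the one that is recovered from the others up to its sign.\<close>

type_synonym real4 = "(real \<times> real \<times> real) \<times> real"

definition su2_vec :: "complex^2^2 \<Rightarrow> real4" where
  "su2_vec A = ((Re (A $ 1 $ 1), Im (A $ 1 $ 1), Re (A $ 1 $ 2)), Im (A $ 1 $ 2))"

fun vec_su2 :: "real4 \<Rightarrow> complex^2^2" where
  "vec_su2 ((p, q, r), t) =
     vector [vector [Complex p q, Complex r t], vector [- Complex r (- t), Complex p (- q)]]"

fun qmul :: "real4 \<Rightarrow> real4 \<Rightarrow> real4" where
  "qmul ((p, q, r), t) ((p', q', r'), t') =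
     ((p * p' - q * q' - r * r' - t * t', p * q' + q * p' - t * r' + r * t',
       p * r' - q * t' + r * p' + t * q'), p * t' + q * r' + t * p' - r * q')"

lemma real4_norm: "norm (((p, q, r), t) :: real4) = sqrt (p\<^sup>2 + q\<^sup>2 + r\<^sup>2 + t\<^sup>2)"
  by (simp add: norm_Pair add.assoc)

lemma vec_su2_in_SU2:
  assumes "norm y = 1"
  shows "vec_su2 y \<in> SU2"
proof -
  obtain p q r t where y: "y = ((p, q, r), t)" by (metis prod.exhaust)
  have "p * p + q * q + r * r + t * t = 1"
    using assms by (simp add: y real4_norm power2_eq_square)
  then show ?thesis
    by (simp add: SU2_def y vec_eq_iff forall_2 matrix_matrix_mult_def conj_transpose_def sum_2
        mat_def
        det_2 complex_eq_iff algebra_simps)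
qed

lemma norm_su2_vec:
  assumes "A \<in> SU2"
  shows "norm (su2_vec A) = 1"
  using arg_cong[OF SU2_entries(3)[OF assms], of Re]
  by (simp add: su2_vec_def real4_norm power2_eq_square)

lemma su2_vec_mult:
  assumes "A \<in> SU2"
  shows "su2_vec (vec_su2 y ** A) = qmul y (su2_vec A)"
proof -
  obtain p q r t where y: "y = ((p, q, r), t)" by (metis prod.exhaust)
  show ?thesis
    using SU2_entries(1,2)[OF assms]
    by (simp add: y su2_vec_def matrix_matrix_mult_def sum_2 algebra_simps)
qed

lemma qmul_measurable [measurable (raw)]:
  assumes [measurable]: "f \<in> M \<rightarrow>\<^sub>M borel" "g \<in> M \<rightarrow>\<^sub>M borel"
  shows "(\<lambda>x. qmul (f x) (g x)) \<in> M \<rightarrow>\<^sub>M borel"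
proof -
  have "qmul y z = ((fst (fst y) * fst (fst z) - fst (snd (fst y)) * fst (snd (fst z))
       - snd (snd (fst y)) * snd (snd (fst z)) - snd y * snd z,
     fst (fst y) * fst (snd (fst z)) + fst (snd (fst y)) * fst (fst z) - snd y * snd (snd (fst z))
         + snd (snd (fst y)) * snd z,
     fst (fst y) * snd (snd (fst z)) - fst (snd (fst y)) * snd z + snd (snd (fst y)) * fst (fst z)
         + snd y * fst (snd (fst z))),
     fst (fst y) * snd z + fst (snd (fst y)) * snd (snd (fst z))
         + snd y * fst (fst z) - snd (snd (fst y)) * fst (snd (fst z)))" for y z
    by (cases "(y, z)" rule: qmul.cases) simp
  then show ?thesis by simp
qed

text \<open>This is the polarised four-square identity: right multiplication by \<open>x\<close>
  multiplies inner products by the squared norm of \<open>x\<close>.\<close>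

lemma orthogonal_qmul_right:
  assumes "norm x = 1"
  shows "orthogonal_transformation (\<lambda>y. qmul y x)"
proof -
  obtain p q r t where x: "x = ((p, q, r), t)" by (metis prod.exhaust)
  have n: "p * p + q * q + r * r + t * t = 1"
    using assms by (simp add: x real4_norm power2_eq_square)
  have "linear (\<lambda>y. qmul y x)"
    by (rule linearI) (auto simp: x algebra_simps)
  moreover have "qmul y x \<bullet> qmul z x = y \<bullet> z" for y z
  proof -
    have "qmul y x \<bullet> qmul z x = (y \<bullet> z) * (p * p + q * q + r * r + t * t)"
      by (cases "(y, z)" rule: qmul.cases) (simp add: x algebra_simps)
    then show ?thesis by (simp add: n)
  qed
  ultimately show ?thesis by (simp add: orthogonal_transformation_def)
qed

lemma SU2_mult_closed:
  assumes "A \<in> SU2" "B \<in> SU2"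
  shows "A ** B \<in> SU2"
proof -
  have ct: "conj_transpose (A ** B) = conj_transpose B ** conj_transpose A"
    by (simp add: conj_transpose_def matrix_matrix_mult_def vec_eq_iff mult.commute)
  have "A ** B ** (conj_transpose B ** conj_transpose A)
      = A ** (B ** conj_transpose B) ** conj_transpose A"
    "conj_transpose B ** conj_transpose A ** (A ** B)
        = conj_transpose B ** (conj_transpose A ** A) ** B"
    by (simp_all add: matrix_mul_assoc)
  then show ?thesis using assms by (simp add: SU2_def ct det_mul)
qed

lemma measurable_SU2_left_mult:
  assumes "A \<in> SU2"
  shows "(\<lambda>B. A ** B) \<in> restrict_space borel SU2 \<rightarrow>\<^sub>M restrict_space borel SU2"
proof (rule measurable_restrict_space3)
  have "continuous_on UNIV (\<lambda>B :: complex^2^2. A ** B)"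
    unfolding matrix_matrix_mult_def by (intro continuous_intros)
  then show "(\<lambda>B :: complex^2^2. A ** B) \<in> borel \<rightarrow>\<^sub>M borel"
      by (rule borel_measurable_continuous_onI)
qed (use SU2_mult_closed[OF assms] in auto)

lemma measurable_su2_vec: "su2_vec \<in> borel \<rightarrow>\<^sub>M borel"
  unfolding su2_vec_def by (intro borel_measurable_continuous_onI continuous_intros)

lemma measurable_sphere_measure [simp]: "measurable M sphere_measure = borel_measurable M"
  by (rule measurable_cong_sets) simp_all

lemma measurable_from_sphere_measure [simp]: "measurable sphere_measure N = measurable borel N"
  by (rule measurable_cong_sets) simp_all

section \<open>Products of spheres as the image of Haar measure\<close>

abbreviation spheres :: "nat set \<Rightarrow> (nat \<Rightarrow> real4) measure" where
  "spheres I \<equiv> PiM I (\<lambda>_. sphere_measure)"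

lemma AE_spheres_norm:
  assumes "finite I"
  shows "AE y in spheres I. \<forall>j\<in>I. norm (y j) = 1"
  using assms by (intro AE_finite_allI AE_PiM_component prob_space_sphere_measure
      AE_sphere_measure_norm)

lemma distr_spheres_orthogonal:
  assumes "finite I" "\<And>j. j \<in> I \<Longrightarrow> orthogonal_transformation (R j)"
  shows "distr (spheres I) (spheres I) (\<lambda>y. \<lambda>j\<in>I. R j (y j)) = spheres I"
proof -
  have "distr (spheres I) (spheres I) (\<lambda>y. \<lambda>j\<in>I. R j (y j))
      = PiM I (\<lambda>j. distr sphere_measure sphere_measure (R j))"
    using assms(2)[THEN orthogonal_transformation_measurable]
    by (intro distr_PiM_map assms prob_space_sphere_measure) auto
  also have "\<dots> = spheres I"
  proof (rule PiM_cong)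
    fix j assume "j \<in> I"
    then show "distr sphere_measure sphere_measure (R j) = sphere_measure"
      using distr_sphere_measure_orthogonal[OF assms(2)] by (metis distr_cong sets_sphere_measure)
  qed simp
  finally show ?thesis .
qed

text \<open>The left invariance of $\mu$ is averaged over translations drawn from the sphere measures, which in
  turn are preserved by right translations.\<close>

lemma normalized_haar_distr_su2_vec:
  assumes haar: "normalized_haar n \<mu>"
  shows "distr \<mu> (spheres {1..n}) (\<lambda>A. \<lambda>j\<in>{1..n}. su2_vec (A j)) = spheres {1..n}"
    (is "?P = ?S")
proof (rule measure_eqI)
  note One_nat_def [simp del]
  fix E assume "E \<in> sets ?P"
  then have E [measurable]: "E \<in> sets ?S" by simp
  have sets_mu [measurable_cong, simp]: "sets \<mu> = sets (SU2_pow n)" and "prob_space \<mu>"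
    and inv: "\<And>h. h \<in> space (SU2_pow n) \<Longrightarrow> distr \<mu> \<mu> (\<lambda>g. \<lambda>j\<in>{1..n}. h j ** g j) = \<mu>"
    using haar by (auto simp: normalized_haar_def)
  have space_mu: "space \<mu> = {1..n} \<rightarrow>\<^sub>E SU2"
    using sets_eq_imp_space_eq[OF sets_mu]
        by (auto simp: SU2_pow_def space_PiM space_restrict_space)
  interpret mu: prob_space \<mu> by fact
  interpret S: prob_space ?S by (intro prob_space_PiM prob_space_sphere_measure)
  let ?V = "\<lambda>A. \<lambda>j\<in>{1..n}. su2_vec (A j)"
  have V [measurable]: "?V \<in> \<mu> \<rightarrow>\<^sub>M ?S"
    unfolding measurable_cong_sets[OF sets_mu refl] SU2_pow_def
    by (intro measurable_restrict measurable_compose[OF measurable_component_singleton])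
       (auto intro: measurable_restrict_space1 measurable_su2_vec
         simp: measurable_cong_sets[OF refl sets_sphere_measure])
  interpret pair_sigma_finite \<mu> ?S ..
  \<comment> \<open>For unit quaternions \<open>y j\<close> the matrices
    \<open>vec_su2 (y j)\<close> form an element of the group, by which \<open>\<mu>\<close> may be
    translated; in quaternion coordinates the translation is \<open>qmul (y j)\<close>.\<close>
  have left: "emeasure ?P E = (\<integral>\<^sup>+A. indicator E (\<lambda>j\<in>{1..n}. qmul (y j) (su2_vec (A j))) \<partial>\<mu>)"
    if y: "\<forall>j\<in>{1..n}. norm (y j) = 1" for y
  proof -
    define h where "h = (\<lambda>j\<in>{1..n}. vec_su2 (y j))"
    have h: "h \<in> space (SU2_pow n)"
      using y vec_su2_in_SU2 by (auto simp: h_def SU2_pow_def space_PiM space_restrict_space)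
    have hm: "(\<lambda>A. \<lambda>j\<in>{1..n}. h j ** A j) \<in> \<mu> \<rightarrow>\<^sub>M \<mu>"
      unfolding measurable_cong_sets[OF sets_mu sets_mu] SU2_pow_def
      proof (rule measurable_restrict)
      fix j assume "j \<in> {1..n}"
      then show "(\<lambda>A. h j ** A j) \<in> (\<Pi>\<^sub>M j\<in>{1..n}. restrict_space borel SU2) \<rightarrow>\<^sub>M restrict_space
          borel SU2"
        using y by (intro measurable_compose[OF measurable_component_singleton[of j]
            measurable_SU2_left_mult[of "h j"]])
          (auto simp: h_def vec_su2_in_SU2)
    qed
    have "emeasure ?P E = (\<integral>\<^sup>+A. indicator E (?V A) \<partial>\<mu>)"
      by (subst nn_integral_distr[symmetric, of _ _ ?S]) auto
    also have "\<dots> = (\<integral>\<^sup>+A. indicator E (?V A) \<partial>distr \<mu> \<mu> (\<lambda>A. \<lambda>j\<in>{1..n}. h j ** A j))"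
      by (simp add: inv[OF h])
    also have "\<dots> = (\<integral>\<^sup>+A. indicator E (?V (\<lambda>j\<in>{1..n}. h j ** A j)) \<partial>\<mu>)"
      by (rule nn_integral_distr[OF hm]) measurable
    also have "\<dots> = (\<integral>\<^sup>+A. indicator E (\<lambda>j\<in>{1..n}. qmul (y j) (su2_vec (A j))) \<partial>\<mu>)"
      by (intro nn_integral_cong arg_cong[where f="indicator E"])
         (auto simp: h_def space_mu su2_vec_mult PiE_iff intro!: restrict_ext)
    finally show ?thesis .
  qed
  have right: "(\<integral>\<^sup>+y. indicator E (\<lambda>j\<in>{1..n}. qmul (y j) (su2_vec (A j))) \<partial>?S) = emeasure ?S E"
    if "A \<in> space \<mu>" for A
  proof -
    have orth: "orthogonal_transformation (\<lambda>y. qmul y (su2_vec (A j)))" if "j \<in> {1..n}" for j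
      using \<open>A \<in> space \<mu>\<close> that by (auto simp: space_mu intro!: orthogonal_qmul_right norm_su2_vec)
    have "emeasure ?S E = emeasure (distr ?S ?S (\<lambda>y. \<lambda>j\<in>{1..n}. qmul (y j) (su2_vec (A j)))) E"
      using distr_spheres_orthogonal[where I="{1..n}" and R="\<lambda>j y. qmul y (su2_vec (A j))"] orth
          by simp
    also have "\<dots> = (\<integral>\<^sup>+y. indicator E (\<lambda>j\<in>{1..n}. qmul (y j) (su2_vec (A j))) \<partial>?S)"
      by (subst nn_integral_distr[symmetric, of _ _ ?S]) auto
    finally show ?thesis by simp
  qed
  have V1: "(\<lambda>A. su2_vec (A j)) \<in> \<mu> \<rightarrow>\<^sub>M borel" if "j \<in> {1..n}" for j
    unfolding measurable_cong_sets[OF sets_mu refl] SU2_pow_def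
    using that by (intro measurable_compose[OF measurable_component_singleton])
       (auto intro: measurable_restrict_space1 measurable_su2_vec)
  have Q: "(\<lambda>(A, y). \<lambda>j\<in>{1..n}. qmul (y j) (su2_vec (A j))) \<in> \<mu> \<Otimes>\<^sub>M ?S \<rightarrow>\<^sub>M ?S"
    unfolding split_beta'
  proof (rule measurable_restrict)
    fix j assume "j \<in> {1..n}"
    then have [measurable]: "(\<lambda>y. y j) \<in> ?S \<rightarrow>\<^sub>M borel" "(\<lambda>A. su2_vec (A j)) \<in> \<mu> \<rightarrow>\<^sub>M borel"
      using measurable_component_singleton[of j "{1..n}" "\<lambda>_. sphere_measure"] V1 by auto
    show "(\<lambda>x. qmul (snd x j) (su2_vec (fst x j))) \<in> \<mu> \<Otimes>\<^sub>M ?S \<rightarrow>\<^sub>M sphere_measure"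
      by simp
  qed
  \<comment> \<open>The constant is integrated against a probability measure, which costs nothing;
    \<open>left\<close> may then be inserted because almost all \<open>y\<close> have unit
    components.\<close>
  have "emeasure ?P E = (\<integral>\<^sup>+y. emeasure ?P E \<partial>?S)"
    by (simp add: S.emeasure_space_1)
  also have "\<dots> = (\<integral>\<^sup>+y. (\<integral>\<^sup>+A. indicator E (\<lambda>j\<in>{1..n}. qmul (y j) (su2_vec (A j))) \<partial>\<mu>) \<partial>?S)"
    using AE_spheres_norm[of "{1..n}"] left by (intro nn_integral_cong_AE) auto
  also have "\<dots> = (\<integral>\<^sup>+A. (\<integral>\<^sup>+y. indicator E (\<lambda>j\<in>{1..n}. qmul (y j) (su2_vec (A j))) \<partial>?S) \<partial>\<mu>)"
    by (rule Fubini') (use measurable_compose[OF Q borel_measurable_indicator[OF E]] in \<open>simp add: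
        split_beta'\<close>)
  also have "\<dots> = (\<integral>\<^sup>+A. emeasure ?S E \<partial>\<mu>)"
    by (intro nn_integral_cong right)
  also have "\<dots> = emeasure ?S E" by (simp add: mu.emeasure_space_1)
  finally show "emeasure ?P E = emeasure ?S E" .
qed simp

text \<open>The identity is evaluated at the indicator vector of \<open>{i, j}\<close>: the squares
  contribute \<open>2\<close>, the only surviving mixed term is \<open>S i j\<close>, and the
  determinant of \<open>g i + g j\<close> is computed a second time from the entries.\<close>

lemma det_coeffs_eq_inner:
  assumes g: "\<And>j. j \<in> {1..n} \<Longrightarrow> g j \<in> SU2" and S: "det_coeffs n g S"
    and ij: "1 \<le> i" "i < j" "j \<le> n"
  shows "S i j = su2_vec (g i) \<bullet> su2_vec (g j)"
proof -
  define l :: "nat \<Rightarrow> real" where "l k = (if k = i \<or> k = j then 1 else 0)" for k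
  have split: "(\<Sum>k=1..n. f k) = f i + f j" if "\<And>k. k \<noteq> i \<Longrightarrow> k \<noteq> j \<Longrightarrow> f k = 0"
      for f :: "nat \<Rightarrow> 'a::comm_monoid_add"
  proof -
    have "(\<Sum>k=1..n. f k) = (\<Sum>k\<in>{i, j}. f k)"
      using ij that by (intro sum.mono_neutral_right) auto
    then show ?thesis using ij by simp
  qed
  have lhs: "(\<Sum>k=1..n. l k *\<^sub>R g k) = g i + g j"
    using ij by (subst split) (auto simp: l_def)
  have a: "(\<Sum>k=1..n. (l k)\<^sup>2) = 2"
    using ij by (subst split) (auto simp: l_def)
  have "(\<Sum>m=1..<k. S m k * l m * l k) = (if k = j then S i j else 0)" if "k \<in> {1..n}" for k
  proof -
    have "(\<Sum>m=1..<k. S m k * l m * l k) = (\<Sum>m\<in>{1..<k}. if m = i then (if k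
        = j then S i j else 0) else 0)"
      using ij by (intro sum.cong) (auto simp: l_def)
    then show ?thesis using ij that by (auto simp: sum.delta)
  qed
  then have b: "(\<Sum>k=1..n. \<Sum>m=1..<k. S m k * l m * l k) = S i j"
    using ij by simp
  have gi: "g i \<in> SU2" "g j \<in> SU2" using g ij by auto
  have "det (g i + g j) = complex_of_real (2 + 2 * S i j)"
  proof -
    have "det (\<Sum>k=1..n. l k *\<^sub>R g k) =
        complex_of_real ((\<Sum>k=1..n. (l k)\<^sup>2) + 2 * (\<Sum>k=1..n. \<Sum>m=1..<k. S m k * l m * l k))"
      using S unfolding det_coeffs_def by blast
    then show ?thesis by (simp only: lhs a b)
  qed
  moreover have "det (g i + g j) = complex_of_real (2 + 2 * (su2_vec (g i) \<bullet> su2_vec (g j)))"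
    using SU2_entries[OF gi(1)] SU2_entries[OF gi(2)]
    by (simp add: det_2 su2_vec_def complex_eq_iff algebra_simps)
  ultimately show ?thesis by (simp only: of_real_eq_iff)
qed

section \<open>Triangular coordinates of Gram matrices\<close>

type_synonym real3 = "real \<times> real \<times> real"

definition gram3_det :: "real3 \<Rightarrow> real" where
  "gram3_det u = 1 - (fst u)\<^sup>2 - (fst (snd u))\<^sup>2 - (snd (snd u))\<^sup>2
     + 2 * fst u * fst (snd u) * snd (snd u)"

text \<open>By the leading minors, this says that the Gram matrix is positive definite. With $u = (a, b, c)$, its
  Cholesky factor has the rows $(1, 0, 0)$, $(a, \mathit{chol22}, 0)$, $(b, \mathit{chol32}, \mathit{chol33})$.\<close>

definition gram3_pos :: "real3 \<Rightarrow> bool" where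
  "gram3_pos u \<longleftrightarrow> (fst u)\<^sup>2 < 1 \<and> 0 < gram3_det u"

definition chol22 :: "real3 \<Rightarrow> real" where
  "chol22 u = sqrt (1 - (fst u)\<^sup>2)"

definition chol32 :: "real3 \<Rightarrow> real" where
  "chol32 u = (snd (snd u) - fst u * fst (snd u)) / chol22 u"

definition chol33 :: "real3 \<Rightarrow> real" where
  "chol33 u = sqrt (gram3_det u) / chol22 u"

definition chol :: "real3 \<Rightarrow> real3 \<Rightarrow> real3" where
  "chol u v = (fst v, fst u * fst v + chol22 u * fst (snd v),
     fst (snd u) * fst v + chol32 u * fst (snd v) + chol33 u * snd (snd v))"

definition chol_inv :: "real3 \<Rightarrow> real3 \<Rightarrow> real3" where
  "chol_inv u t =
     (let q = (fst (snd t) - fst u * fst t) / chol22 u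
      in (fst t, q, (snd (snd t) - fst (snd u) * fst t - chol32 u * q) / chol33 u))"

lemma chol_pos:
  assumes "gram3_pos u"
  shows "chol22 u > 0" "chol33 u > 0"
  using assms by (simp_all add: gram3_pos_def chol22_def chol33_def)

text \<open>These are the entries (2,2), (3,2) and (3,3) of the factorization of the Gram matrix.
  The last one rests on the Schur complement identity det G + (c - ab)^2 = (1 - a^2)(1 - b^2). Later
  polynomial identities use only these three relations and no square roots.\<close>

lemma chol_relations:
  assumes "gram3_pos (a, b, c)"
  shows "(chol22 (a, b, c))\<^sup>2 = 1 - a\<^sup>2" "c = a * b + chol22 (a, b, c) * chol32 (a, b, c)"
    "(chol33 (a, b, c))\<^sup>2 = 1 - b\<^sup>2 - (chol32 (a, b, c))\<^sup>2"
proof -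
  have a: "1 - a\<^sup>2 > 0" and g: "gram3_det (a, b, c) > 0"
    using assms by (auto simp: gram3_pos_def)
  show "(chol22 (a, b, c))\<^sup>2 = 1 - a\<^sup>2" using a by (simp add: chol22_def)
  show "c = a * b + chol22 (a, b, c) * chol32 (a, b, c)"
    using chol_pos[OF assms] by (simp add: chol32_def)
  have "(chol33 (a, b, c))\<^sup>2 = gram3_det (a, b, c) / (1 - a\<^sup>2)"
    "(chol32 (a, b, c))\<^sup>2 = (c - a * b)\<^sup>2 / (1 - a\<^sup>2)"
    using a g by (simp_all add: chol33_def chol32_def chol22_def power_divide)
  then have "(chol33 (a, b, c))\<^sup>2 + (chol32 (a, b, c))\<^sup>2
      = (gram3_det (a, b, c) + (c - a * b)\<^sup>2) / (1 - a\<^sup>2)"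
    by (simp add: add_divide_distrib)
  also have "gram3_det (a, b, c) + (c - a * b)\<^sup>2 = (1 - b\<^sup>2) * (1 - a\<^sup>2)"
    by (simp add: gram3_det_def power2_eq_square algebra_simps)
  finally show "(chol33 (a, b, c))\<^sup>2 = 1 - b\<^sup>2 - (chol32 (a, b, c))\<^sup>2"
    using a by simp
qed

lemma chol_inv_chol: "gram3_pos u \<Longrightarrow> chol_inv u (chol u v) = v"
  using chol_pos[of u] by (cases v) (simp add: chol_def chol_inv_def Let_def)

lemma chol_chol_inv: "gram3_pos u \<Longrightarrow> chol u (chol_inv u t) = t"
  using chol_pos[of u] by (cases t) (simp add: chol_def chol_inv_def Let_def)

lemma gram3_det_measurable [measurable]: "gram3_det \<in> borel_measurable borel"
  unfolding gram3_det_def by measurable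

lemma gram3_pos_measurable [measurable]: "Measurable.pred borel gram3_pos"
  unfolding gram3_pos_def by measurable

lemma chol_coeff_measurable [measurable]:
  "chol22 \<in> borel_measurable borel" "chol32 \<in> borel_measurable borel" "chol33
      \<in> borel_measurable borel"
  unfolding chol22_def chol32_def chol33_def by measurable

lemma chol_measurable [measurable (raw)]:
  assumes [measurable]: "f \<in> M \<rightarrow>\<^sub>M borel" "g \<in> M \<rightarrow>\<^sub>M borel"
  shows "(\<lambda>x. chol (f x) (g x)) \<in> M \<rightarrow>\<^sub>M borel"
  unfolding chol_def by measurable

lemma chol_inv_measurable [measurable (raw)]:
  assumes [measurable]: "f \<in> M \<rightarrow>\<^sub>M borel" "g \<in> M \<rightarrow>\<^sub>M borel"
  shows "(\<lambda>x. chol_inv (f x) (g x)) \<in> M \<rightarrow>\<^sub>M borel"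
  unfolding chol_inv_def Let_def by measurable

lemma nn_integral_lborel_triple:
  assumes "F \<in> borel_measurable borel"
  shows "(\<integral>\<^sup>+v. F v \<partial>(lborel :: real3 measure))
      = (\<integral>\<^sup>+p. (\<integral>\<^sup>+q. (\<integral>\<^sup>+r. F (p, q, r) \<partial>lborel) \<partial>lborel) \<partial>lborel)"
proof -
  note [measurable] = assms
  have "(\<integral>\<^sup>+v. F v \<partial>(lborel :: real3 measure)) = (\<integral>\<^sup>+p. (\<integral>\<^sup>+w. F (p, w) \<partial>lborel) \<partial>lborel)"
    by (rule nn_integral_lborel_pair) measurable
  also have "\<dots> = (\<integral>\<^sup>+p. (\<integral>\<^sup>+q. (\<integral>\<^sup>+r. F (p, q, r) \<partial>lborel) \<partial>lborel) \<partial>lborel)"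
    by (intro nn_integral_cong) (rule nn_integral_lborel_pair, measurable)
  finally show ?thesis .
qed

text \<open>Because the factor is triangular, the substitution can be made one coordinate at a time,
  with a shift depending on the earlier coordinates. The Jacobian is the product of the diagonal
  entries, the first of which is \<open>1\<close>.\<close>

lemma nn_integral_chol:
  assumes u: "gram3_pos u" and [measurable]: "F \<in> borel_measurable borel"
  shows "(\<integral>\<^sup>+t. F t \<partial>lborel) = ennreal (chol22 u * chol33 u) * (\<integral>\<^sup>+v. F (chol u v) \<partial>lborel)"
proof -
  note pos = chol_pos[OF u]
  obtain a b c where abc: "u = (a, b, c)" by (metis prod.exhaust)
  have "(\<integral>\<^sup>+t. F t \<partial>lborel) = (\<integral>\<^sup>+p. (\<integral>\<^sup>+q. (\<integral>\<^sup>+r. F (p, q, r) \<partial>lborel) \<partial>lborel) \<partial>lborel)"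
    by (rule nn_integral_lborel_triple) measurable
  also have "\<dots> = (\<integral>\<^sup>+p. ennreal (chol22 u) * (\<integral>\<^sup>+q. (\<integral>\<^sup>+r. F (p, a * p
      + chol22 u * q, r) \<partial>lborel) \<partial>lborel) \<partial>lborel)"
    using pos by (intro nn_integral_cong, subst nn_integral_real_affine[where c="chol22 u"
        and t="a * _"]) auto
  also have "\<dots> = (\<integral>\<^sup>+p. ennreal (chol22 u) * (\<integral>\<^sup>+q. ennreal (chol33 u) *
      (\<integral>\<^sup>+r. F (p, a * p + chol22 u * q, b * p + chol32 u * q
          + chol33 u * r) \<partial>lborel) \<partial>lborel) \<partial>lborel)"
    using pos
    by (intro nn_integral_cong arg_cong2[where f="(*)"] refl,
        subst nn_integral_real_affine[where c="chol33 u" and t="b * _ + chol32 u * _"]) auto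
  also have "\<dots> = ennreal (chol22 u * chol33 u) *
      (\<integral>\<^sup>+p. (\<integral>\<^sup>+q. (\<integral>\<^sup>+r. F (p, a * p + chol22 u * q, b * p + chol32 u * q
          + chol33 u * r) \<partial>lborel) \<partial>lborel) \<partial>lborel)"
    using pos by (simp add: nn_integral_cmult ennreal_mult mult.assoc)
  also have "\<dots> = ennreal (chol22 u * chol33 u) * (\<integral>\<^sup>+v. F (chol u v) \<partial>lborel)"
    by (subst nn_integral_lborel_triple) (simp_all add: chol_def abc)
  finally show ?thesis .
qed

section \<open>Determinant and positivity of the bordered Gram matrix\<close>

lemma det_4:
  "det (A :: 'a::comm_ring_1^4^4) =
    A$1$1 * (A$2$2 * (A$3$3 * A$4$4 - A$3$4 * A$4$3) - A$2$3 * (A$3$2 * A$4$4 - A$3$4 * A$4$2)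
        + A$2$4 * (A$3$2 * A$4$3 - A$3$3 * A$4$2))
  - A$1$2 * (A$2$1 * (A$3$3 * A$4$4 - A$3$4 * A$4$3) - A$2$3 * (A$3$1 * A$4$4 - A$3$4 * A$4$1)
      + A$2$4 * (A$3$1 * A$4$3 - A$3$3 * A$4$1))
  + A$1$3 * (A$2$1 * (A$3$2 * A$4$4 - A$3$4 * A$4$2) - A$2$2 * (A$3$1 * A$4$4 - A$3$4 * A$4$1)
      + A$2$4 * (A$3$1 * A$4$2 - A$3$2 * A$4$1))
  - A$1$4 * (A$2$1 * (A$3$2 * A$4$3 - A$3$3 * A$4$2) - A$2$2 * (A$3$1 * A$4$3 - A$3$3 * A$4$1)
      + A$2$3 * (A$3$1 * A$4$2 - A$3$2 * A$4$1))"
proof -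
  have f1234: "finite {2::4, 3, 4}" "1 \<notin> {2::4, 3, 4}" by auto
  have f234: "finite {3::4, 4}" "2 \<notin> {3::4, 4}" by auto
  have f34: "finite {4::4}" "3 \<notin> {4::4}" by auto
  have UNIV_4: "(UNIV :: 4 set) = {1, 2, 3, 4}" using exhaust_4 by auto
  show ?thesis
    unfolding det_def UNIV_4
    unfolding sum_over_permutations_insert[OF f1234]
    unfolding sum_over_permutations_insert[OF f234]
    unfolding sum_over_permutations_insert[OF f34]
    unfolding permutes_sing
    by (simp add: sign_swap_id permutation_swap_id sign_compose sign_id swap_id_eq
        permutation_compose algebra_simps)
qed

lemma vector_4 [simp]:
  "(vector [x, y, z, w] :: 'a::zero^4) $ 1 = x"
  "(vector [x, y, z, w] :: 'a::zero^4) $ 2 = y"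
  "(vector [x, y, z, w] :: 'a::zero^4) $ 3 = z"
  "(vector [x, y, z, w] :: 'a::zero^4) $ 4 = w"
  unfolding vector_def by simp_all

lemma gram3_quadratic:
  "x \<bullet> (gram3 (a, b, c) *v x) = (x$1)\<^sup>2 + (x$2)\<^sup>2 + (x$3)\<^sup>2 + 2 * a * x$1 * x$2
      + 2 * b * x$1 * x$3 + 2 * c * x$2 * x$3"
  by (simp add: inner_vec_def matrix_vector_mult_def sum_3 power2_eq_square algebra_simps)

lemma gram4_quadratic:
  "x \<bullet> (gram4 (a, b, c) (p, q, r) *v x) =
     (x$1)\<^sup>2 + (x$2)\<^sup>2 + (x$3)\<^sup>2 + (x$4)\<^sup>2 + 2 * a * x$1 * x$2 + 2 * b * x$1 * x$3
         + 2 * c * x$2 * x$3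
     + 2 * p * x$1 * x$4 + 2 * q * x$2 * x$4 + 2 * r * x$3 * x$4"
  by (simp add: inner_vec_def matrix_vector_mult_def sum_4 power2_eq_square algebra_simps)

lemma pos_semidef_gram3_iff:
  "pos_semidef (gram3 u) \<longleftrightarrow> (\<forall>x. 0 \<le> x \<bullet> (gram3 u *v x))"
  by (cases u) (auto simp: pos_semidef_def vec_eq_iff forall_3 transpose_def)

lemma pos_semidef_gram4_iff:
  "pos_semidef (gram4 u v) \<longleftrightarrow> (\<forall>x. 0 \<le> x \<bullet> (gram4 u v *v x))"
  by (cases "(u, v)" rule: gram4.cases) (auto simp: pos_semidef_def vec_eq_iff forall_4
      transpose_def)

text \<open>The quadratic form is the squared length of the transposed Cholesky factor applied to
  \<open>x\<close>.\<close>

lemma gram3_pos_imp_pos_semidef: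
  assumes "gram3_pos u"
  shows "pos_semidef (gram3 u)"
  unfolding pos_semidef_gram3_iff
proof
  fix x :: "real^3"
  obtain a b c where u: "u = (a, b, c)" by (metis prod.exhaust)
  note rel = chol_relations[OF assms[unfolded u]]
  define \<beta> d e where "\<beta> = chol22 (a, b, c)" and "d = chol32 (a, b, c)" and "e = chol33 (a, b, c)"
  have "x \<bullet> (gram3 (a, b, c) *v x) = (x$1 + a * x$2 + b * x$3)\<^sup>2 + (\<beta> * x$2 + d * x$3)\<^sup>2
      + (e * x$3)\<^sup>2"
    unfolding gram3_quadratic using rel[folded \<beta>_def d_def e_def] by algebra
  then show "0 \<le> x \<bullet> (gram3 u *v x)" by (simp add: u)
qed

text \<open>Two test vectors give the weak forms of both inequalities; \<open>ne\<close> makes them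
  strict.\<close>

lemma pos_semidef_imp_gram3_pos:
  assumes psd: "pos_semidef (gram3 (a, b, c))" and ne: "a\<^sup>2 \<noteq> 1" "gram3_det (a, b, c) \<noteq> 0"
  shows "gram3_pos (a, b, c)"
proof -
  have Q: "0 \<le> x \<bullet> (gram3 (a, b, c) *v x)" for x using psd by (simp only: pos_semidef_gram3_iff)
  have "0 \<le> 1 - a\<^sup>2"
    using Q[of "vector [-a, 1, 0]"] unfolding gram3_quadratic by (simp add: power2_eq_square)
  then have a: "0 < 1 - a\<^sup>2" using ne by simp
  \<comment> \<open>The test vector is the last column of the adjugate. The Gram matrix sends it to
    the determinant times the third unit vector, whose pairing with it leaves the minor
    \<open>1 - a\<^sup>2\<close>.\<close>
  have "(vector [a * c - b, a * b - c, 1 - a\<^sup>2] :: real^3) \<bullet> (gram3 (a, b, c) *v vector [a * c -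
      b, a * b - c, 1 - a\<^sup>2])
     = gram3_det (a, b, c) * (1 - a\<^sup>2)"
    unfolding gram3_quadratic by (simp add: gram3_det_def power2_eq_square algebra_simps)
  then have "0 \<le> gram3_det (a, b, c) * (1 - a\<^sup>2)" using Q by metis
  then show ?thesis using a ne by (simp add: gram3_pos_def zero_le_mult_iff)
qed

lemma norm_real3: "(norm (v :: real3))\<^sup>2 = (fst v)\<^sup>2 + (fst (snd v))\<^sup>2 + (snd (snd v))\<^sup>2"
  by (cases v) (simp add: norm_Pair)

text \<open>The successive Schur complements of the bordered matrix are 1, the squares of
  \<open>chol22 u\<close> and \<open>chol33 u\<close>, and 1 - |v|^2. So the inverse square root of
  the determinant is (1 - |v|^2)^(-1/2) divided by exactly the Jacobian found in
  \<open>nn_integral_chol\<close>.\<close>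

lemma det_gram4_chol:
  assumes "gram3_pos u"
  shows "det (gram4 u (chol u v)) = (chol22 u * chol33 u)\<^sup>2 * (1 - (norm v)\<^sup>2)"
proof -
  obtain a b c p q r where u: "u = (a, b, c)" and v: "v = (p, q, r)" by (metis prod.exhaust)
  note rel = chol_relations[OF assms[unfolded u]]
  define \<beta> d e where "\<beta> = chol22 (a, b, c)" and "d = chol32 (a, b, c)" and "e = chol33 (a, b, c)"
  have "det (gram4 (a, b, c) (p, a * p + \<beta> * q, b * p + d * q + e * r))
      = (\<beta> * e)\<^sup>2 * (1 - (p\<^sup>2 + q\<^sup>2 + r\<^sup>2))"
    unfolding det_4 using rel[folded \<beta>_def d_def e_def] by simp algebra
  then show ?thesis by (simp add: u v norm_real3 chol_def \<beta>_def d_def e_def)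
qed

text \<open>Completing squares writes the form as three squares plus \<open>(x$4)\<^sup>2\<close>
  times 1 - |v|^2, so its sign is decided where the three squares vanish.\<close>

lemma pos_semidef_gram4_chol_iff:
  assumes "gram3_pos u"
  shows "pos_semidef (gram4 u (chol u v)) \<longleftrightarrow> norm v \<le> 1"
proof -
  obtain a b c p q r where u: "u = (a, b, c)" and v: "v = (p, q, r)" by (metis prod.exhaust)
  note rel = chol_relations[OF assms[unfolded u]]
  define \<beta> d e where "\<beta> = chol22 (a, b, c)" and "d = chol32 (a, b, c)" and "e = chol33 (a, b, c)"
  note rel' = rel[folded \<beta>_def d_def e_def]
  have pos: "\<beta> > 0" "e > 0" using chol_pos[OF assms] by (simp_all add: \<beta>_def e_def u)
  have Q: "x \<bullet> (gram4 u (chol u v) *v x) = (x$1 + a * x$2 + b * x$3 + p * x$4)\<^sup>2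
      + (\<beta> * x$2 + d * x$3 + q * x$4)\<^sup>2 + (e * x$3 + r * x$4)\<^sup>2 + (x$4)\<^sup>2 * (1 - (norm v)\<^sup>2)" for x
  proof -
    have "x \<bullet> (gram4 (a, b, c) (p, a * p + \<beta> * q, b * p + d * q + e * r) *v x)
        = (x$1 + a * x$2 + b * x$3 + p * x$4)\<^sup>2
      + (\<beta> * x$2 + d * x$3 + q * x$4)\<^sup>2 + (e * x$3 + r * x$4)\<^sup>2 + (x$4)\<^sup>2 * (1 - (p\<^sup>2 + q\<^sup>2 + r\<^sup>2))"
      unfolding gram4_quadratic using rel' by algebra
    then show ?thesis by (simp add: u v norm_real3 chol_def \<beta>_def d_def e_def)
  qed
  show ?thesis
  proof
    assume "norm v \<le> 1"
    then have "(norm v)\<^sup>2 \<le> 1" by (simp add: power_le_one)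
    then show "pos_semidef (gram4 u (chol u v))" by (simp add: pos_semidef_gram4_iff Q)
  next
    assume psd: "pos_semidef (gram4 u (chol u v))"
    \<comment> \<open>Back substitution with last entry \<open>1\<close>: these values make the
      three squares in \<open>Q\<close> vanish.\<close>
    define z where "z = - r / e"
    define y where "y = - (q + d * z) / \<beta>"
    have "0 \<le> vector [- (p + a * y + b * z), y, z, 1] \<bullet> (gram4 u (chol u v) *v vector [- (p
        + a * y + b * z), y, z, 1])"
      using psd by (simp only: pos_semidef_gram4_iff)
    then have "0 \<le> 1 - (norm v)\<^sup>2"
      unfolding Q using pos by (simp add: z_def y_def)
    then show "norm v \<le> 1" by (simp add: power2_le_imp_le[of _ 1])
  qed
qed

section \<open>The law of the first Gram matrix\<close>

lemma nn_integral_sphere_measure_orthogonal: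
  fixes R :: "'a::euclidean_space \<Rightarrow> 'a"
  assumes R: "orthogonal_transformation R" and [measurable]: "f \<in> borel_measurable borel"
  shows "(\<integral>\<^sup>+x. f (R x) \<partial>sphere_measure) = (\<integral>\<^sup>+x. f x \<partial>sphere_measure)"
  using orthogonal_transformation_measurable[OF R]
  by (subst (2) distr_sphere_measure_orthogonal[OF R, symmetric]) (simp add: nn_integral_distr)

text \<open>Over a point (p, q) of the open disc the last coordinate runs through a chord of
  half-length m = sqrt(1 - p^2 - q^2). Rescaling by m multiplies the measure by m and divides the
  density by m, so the integral over the chord is the same for all these points.\<close>

lemma nn_integral_inverse_sqrt_scale:
  fixes p q c :: real and w :: "real \<Rightarrow> ennreal"
  assumes w_def: "\<And>t. w t = (if t < 1 then ennreal (c / sqrt (1 - t)) else 0)"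
  shows "(\<integral>\<^sup>+r. w (p\<^sup>2 + q\<^sup>2 + r\<^sup>2) \<partial>lborel)
    = (\<integral>\<^sup>+r. w (r\<^sup>2) \<partial>lborel) * indicator {q. p\<^sup>2 + q\<^sup>2 < 1} q"
proof (cases "p\<^sup>2 + q\<^sup>2 < 1")
  case True
  define m where "m = sqrt (1 - p\<^sup>2 - q\<^sup>2)"
  have m: "m > 0" "m\<^sup>2 = 1 - p\<^sup>2 - q\<^sup>2" using True by (auto simp: m_def)
  have [measurable]: "w \<in> borel_measurable borel" unfolding w_def[abs_def] by measurable
  have "ennreal m * w (p\<^sup>2 + q\<^sup>2 + (m * r)\<^sup>2) = w (r\<^sup>2)" for r
  proof -
    have eq: "1 - (p\<^sup>2 + q\<^sup>2 + (m * r)\<^sup>2) = m\<^sup>2 * (1 - r\<^sup>2)"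
      by (simp add: power_mult_distrib m(2) algebra_simps)
    have "p\<^sup>2 + q\<^sup>2 + (m * r)\<^sup>2 < 1 \<longleftrightarrow> 0 < m\<^sup>2 * (1 - r\<^sup>2)"
      using eq by linarith
    also have "\<dots> \<longleftrightarrow> r\<^sup>2 < 1" using zero_less_power[OF m(1), of 2] by (simp add: zero_less_mult_iff)
    finally have iff: "p\<^sup>2 + q\<^sup>2 + (m * r)\<^sup>2 < 1 \<longleftrightarrow> r\<^sup>2 < 1" .
    have "sqrt (1 - (p\<^sup>2 + q\<^sup>2 + (m * r)\<^sup>2)) = m * sqrt (1 - r\<^sup>2)"
      unfolding eq real_sqrt_mult using m(1) by simp
    moreover have "ennreal m * ennreal (c / (m * sqrt (1 - r\<^sup>2))) = ennreal (c / sqrt (1 - r\<^sup>2))"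
      using m(1) by (subst ennreal_mult'[symmetric]) auto
    ultimately show ?thesis using iff by (simp add: w_def)
  qed
  then show ?thesis
    using m True
    by (subst nn_integral_real_affine[where c=m and t=0]) (auto simp: nn_integral_cmult[symmetric])
next
  case False
  have "w (p\<^sup>2 + q\<^sup>2 + r\<^sup>2) = 0" for r
  proof -
    have "0 \<le> r\<^sup>2" by simp
    then have "\<not> p\<^sup>2 + q\<^sup>2 + r\<^sup>2 < 1" using False by linarith
    then show ?thesis by (simp add: w_def)
  qed
  then show ?thesis using False by simp
qed

text \<open>An analogue for S^3 of Archimedes' theorem: two coordinates of a uniform point are
  uniform in the unit disc. \<open>C\<close> is an extended real at this stage; its finiteness
  follows later from normalization.\<close>

lemma sphere_measure_two_coordinates:
  obtains C :: ennreal where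
    "\<And>G. (\<lambda>(p, q). G p q) \<in> borel_measurable borel \<Longrightarrow>
      (\<integral>\<^sup>+x. G (fst (fst x)) (fst (snd (fst x))) \<partial>(sphere_measure :: real4 measure))
      = C * (\<integral>\<^sup>+p. (\<integral>\<^sup>+q. G p q * indicator {q. p\<^sup>2 + q\<^sup>2 < 1} q \<partial>lborel) \<partial>lborel)"
proof -
  obtain c :: real where c: "c > 0" and dens: "distr (sphere_measure :: real4 measure) borel fst
      = density lborel (\<lambda>v. if norm v < 1 then ennreal (c / sqrt (1 - (norm v)\<^sup>2)) else 0)"
    by (rule sphere_measure_fst_density)
  define w where "w t = (if t < 1 then ennreal (c / sqrt (1 - t)) else 0)" for t :: real
  have [measurable]: "w \<in> borel_measurable borel" unfolding w_def by measurable
  define C where "C = (\<integral>\<^sup>+r. w (r\<^sup>2) \<partial>lborel)"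
  show ?thesis
  proof (rule that)
    fix G :: "real \<Rightarrow> real \<Rightarrow> ennreal"
    assume [measurable]: "(\<lambda>(p, q). G p q) \<in> borel_measurable borel"
    have [measurable]: "(\<lambda>x. G (f x) (g x)) \<in> borel_measurable M"
      if "f \<in> borel_measurable M" "g \<in> borel_measurable M" for f g :: "'x \<Rightarrow> real" and M
      using measurable_compose[of "\<lambda>x. (f x, g x)" M borel "\<lambda>(p, q). G p q"] that by simp
    have wn: "(if norm v < 1 then ennreal (c / sqrt (1 - (norm v)\<^sup>2)) else 0) = w ((norm v)\<^sup>2)"
        for v :: real3
      by (simp add: w_def power_less_one_iff)
    have "(\<integral>\<^sup>+x. G (fst (fst x)) (fst (snd (fst x))) \<partial>(sphere_measure :: real4 measure))
       = (\<integral>\<^sup>+v. G (fst v) (fst (snd v)) \<partial>distr (sphere_measure :: real4 measure) borel fst)"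
      by (subst nn_integral_distr) measurable
    also have "\<dots> = (\<integral>\<^sup>+v. w ((norm v)\<^sup>2) * G (fst v) (fst (snd v)) \<partial>(lborel :: real3 measure))"
      unfolding dens wn by (rule nn_integral_density) measurable
    also have "\<dots> = (\<integral>\<^sup>+p. (\<integral>\<^sup>+q. (\<integral>\<^sup>+r. w (p\<^sup>2 + q\<^sup>2 + r\<^sup>2) * G p q \<partial>lborel) \<partial>lborel) \<partial>lborel)"
      by (subst nn_integral_lborel_triple) (simp_all add: norm_real3)
    also have "\<dots> = (\<integral>\<^sup>+p. (\<integral>\<^sup>+q. C * (G p q * indicator {q. p\<^sup>2 + q\<^sup>2 < 1} q) \<partial>lborel) \<partial>lborel)"
      by (simp add: nn_integral_multc nn_integral_cmult nn_integral_inverse_sqrt_scale[OF w_def]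
          C_def mult_ac)
    also have "\<dots> = C * (\<integral>\<^sup>+p. (\<integral>\<^sup>+q. G p q * indicator {q. p\<^sup>2 + q\<^sup>2 < 1} q \<partial>lborel) \<partial>lborel)"
      by (simp add: nn_integral_cmult)
    finally show "(\<integral>\<^sup>+x. G (fst (fst x)) (fst (snd (fst x))) \<partial>(sphere_measure :: real4 measure))
      = C * (\<integral>\<^sup>+p. (\<integral>\<^sup>+q. G p q * indicator {q. p\<^sup>2 + q\<^sup>2 < 1} q \<partial>lborel) \<partial>lborel)" .
  qed
qed

text \<open>The rows of the Cholesky factor, padded by a last coordinate \<open>0\<close>. Because
  of this zero, inner products with the frame do not see the last coordinate of a point. Every index
  other than \<open>1\<close> and \<open>2\<close> receives the third row.\<close>

definition frame :: "real3 \<Rightarrow> nat \<Rightarrow> real4" where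
  "frame u i = (if i = 1 then ((1, 0, 0), 0) else if i = 2 then ((fst u, chol22 u, 0), 0)
     else ((fst (snd u), chol32 u, chol33 u), 0))"

definition gram_of :: "real4 \<Rightarrow> real4 \<Rightarrow> real4 \<Rightarrow> real3" where
  "gram_of x y z = (x \<bullet> y, x \<bullet> z, y \<bullet> z)"

lemma frame_inner: "(frame u 1 \<bullet> y, frame u 2 \<bullet> y, frame u 3 \<bullet> y) = chol u (fst y)"
  by (cases y) (auto simp: frame_def chol_def inner_prod_def)

lemma gram_of_frame:
  assumes "gram3_pos u"
  shows "gram_of (frame u 1) (frame u 2) (frame u 3) = u"
    "frame u 1 \<bullet> frame u 1 = 1" "frame u 2 \<bullet> frame u 2 = 1" "frame u 3 \<bullet> frame u 3 = 1"
proof -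
  obtain a b c where u: "u = (a, b, c)" by (metis prod.exhaust)
  note rel = chol_relations[OF assms[unfolded u]]
  show "gram_of (frame u 1) (frame u 2) (frame u 3) = u"
    "frame u 1 \<bullet> frame u 1 = 1" "frame u 2 \<bullet> frame u 2 = 1" "frame u 3 \<bullet> frame u 3 = 1"
    using rel by (simp_all add: gram_of_def frame_def u power2_eq_square[symmetric])
qed

text \<open>With \<open>x\<close> and \<open>y\<close> fixed, a rotation moves them into the plane
  of the first two coordinates, and the law of \<open>z\<close> does not notice it. Equality of the
  Gram matrices is enough for the rotation to exist, so parallel \<open>x\<close> and
  \<open>y\<close> are covered.\<close>

lemma nn_integral_gram_third:
  fixes F :: "real3 \<Rightarrow> ennreal"
  assumes F: "F \<in> borel_measurable borel" and n: "norm x = 1" "norm y = 1"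
  shows "(\<integral>\<^sup>+z. F (gram_of x y z) \<partial>sphere_measure)
    = (\<integral>\<^sup>+z. F (x \<bullet> y, fst (fst z), (x \<bullet> y) * fst (fst z)
        + sqrt (1 - (x \<bullet> y)\<^sup>2) * fst (snd (fst z))) \<partial>(sphere_measure :: real4 measure))"
proof -
  note [measurable] = F
  define a where "a = x \<bullet> y"
  define x' y' :: real4 where "x' = ((1, 0, 0), 0)" and "y' = ((a, sqrt (1 - a\<^sup>2), 0), 0)"
  have "\<bar>a\<bar> \<le> 1" using Cauchy_Schwarz_ineq2[of x y] n by (simp add: a_def)
  then have "a\<^sup>2 \<le> 1" by (simp add: abs_square_le_1)
  then have xy': "x' \<bullet> y' = a" "x' \<bullet> x' = 1" "y' \<bullet> y' = 1"
    by (simp_all add: x'_def y'_def power2_eq_square[symmetric])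
  have "\<exists>R :: real4 \<Rightarrow> real4. orthogonal_transformation R
      \<and> (\<forall>i<2::nat. R (if i = 0 then x else y) = (if i = 0 then x' else y'))"
    by (rule gram_eq_imp_orthogonal)
       (use n xy' in \<open>auto simp: norm_eq_1 a_def[symmetric] inner_commute[of y x] inner_commute[of
           y' x'] simp del: inner_Pair\<close>)
  then obtain R :: "real4 \<Rightarrow> real4" where R: "orthogonal_transformation R"
    and eq: "\<forall>i<2::nat. R (if i = 0 then x else y) = (if i = 0 then x' else y')" by blast
  have R': "R x = x'" "R y = y'" using eq[rule_format, of 0] eq[rule_format, of 1] by auto
  have "gram_of x y z = (a, x' \<bullet> R z, y' \<bullet> R z)" for z
    unfolding R'[symmetric] by (simp add: gram_of_def a_def orthogonal_transformation_inner[OF R])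
  then have "(\<integral>\<^sup>+z. F (gram_of x y z) \<partial>sphere_measure)
      = (\<integral>\<^sup>+z. F (a, x' \<bullet> R z, y' \<bullet> R z) \<partial>sphere_measure)"
    by simp
  also have "\<dots> = (\<integral>\<^sup>+z. F (a, x' \<bullet> z, y' \<bullet> z) \<partial>sphere_measure)"
    by (rule nn_integral_sphere_measure_orthogonal[OF R]) measurable
  finally show ?thesis
    by (simp add: a_def x'_def y'_def inner_prod_def)
qed

lemma nn_integral_inner_sphere_measure:
  fixes h :: "real \<Rightarrow> ennreal" and x :: real4
  assumes h: "h \<in> borel_measurable borel" and n: "norm x = 1"
  shows "(\<integral>\<^sup>+y. h (x \<bullet> y) \<partial>sphere_measure)
      = (\<integral>\<^sup>+y. h (fst (fst y)) \<partial>(sphere_measure :: real4 measure))"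
proof -
  note [measurable] = h
  obtain R :: "real4 \<Rightarrow> real4" where R: "orthogonal_transformation R" and eq: "R x = ((1, 0, 0), 0)"
    using householder[of x "((1, 0, 0), 0)"] n by (auto simp: norm_Pair)
  have "x \<bullet> y = fst (fst (R y))" for y
  proof -
    have "x \<bullet> y = R x \<bullet> R y" by (simp only: orthogonal_transformation_inner[OF R])
    then show ?thesis by (simp add: eq inner_prod_def)
  qed
  then show ?thesis using nn_integral_sphere_measure_orthogonal[OF R, of "\<lambda>y. h (fst (fst y))"]
      by simp
qed

text \<open>Here (p, q) is the projection of the third unit vector to the plane of the first two;
  linear independence means that this projection has length less than 1.\<close>

lemma gram3_pos_affine:
  assumes "a\<^sup>2 < 1"
  shows "gram3_pos (a, p, a * p + sqrt (1 - a\<^sup>2) * q) \<longleftrightarrow> p\<^sup>2 + q\<^sup>2 < 1"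
proof -
  define \<beta> where "\<beta> = sqrt (1 - a\<^sup>2)"
  have b: "\<beta>\<^sup>2 = 1 - a\<^sup>2" using assms by (simp add: \<beta>_def)
  then have "gram3_det (a, p, a * p + \<beta> * q) = (1 - a\<^sup>2) * (1 - (p\<^sup>2 + q\<^sup>2))"
    unfolding gram3_det_def by simp algebra
  then show ?thesis using assms by (simp add: gram3_pos_def \<beta>_def[symmetric] zero_less_mult_iff)
qed

lemma emeasure_disc_slice:
  "emeasure lborel {q::real. p\<^sup>2 + q\<^sup>2 < 1} = (if p\<^sup>2 < 1 then 2 * ennreal (sqrt (1 - p\<^sup>2)) else 0)"
proof (cases "p\<^sup>2 < 1")
  case True
  have iff: "p\<^sup>2 + q\<^sup>2 < 1 \<longleftrightarrow> \<bar>q\<bar> < sqrt (1 - p\<^sup>2)" for q :: real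
  proof -
    have "\<bar>q\<bar> < sqrt (1 - p\<^sup>2) \<longleftrightarrow> sqrt (q\<^sup>2) < sqrt (1 - p\<^sup>2)" by (simp only: real_sqrt_abs)
    also have "\<dots> \<longleftrightarrow> p\<^sup>2 + q\<^sup>2 < 1" unfolding real_sqrt_less_iff by linarith
    finally show ?thesis by (rule sym)
  qed
  have "{q::real. p\<^sup>2 + q\<^sup>2 < 1} = {- sqrt (1 - p\<^sup>2)<..<sqrt (1 - p\<^sup>2)}"
    by (rule set_eqI, unfold mem_Collect_eq iff greaterThanLessThan_iff abs_less_iff) linarith
  moreover have "emeasure lborel {- sqrt (1 - p\<^sup>2)<..<sqrt (1 - p\<^sup>2)}
      = ennreal (2 * sqrt (1 - p\<^sup>2))"
    using True by (simp add: emeasure_lborel_Ioo)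
  ultimately show ?thesis using True by (simp add: ennreal_mult)
next
  case False
  have "\<not> p\<^sup>2 + q\<^sup>2 < 1" for q :: real
    using False zero_le_power2[of q] by linarith
  then have "{q::real. p\<^sup>2 + q\<^sup>2 < 1} = {}" by blast
  then show ?thesis using False by simp
qed

text \<open>The first inner product \<open>a\<close> has a density proportional to the chord length
  2 sqrt(1 - a^2) of the disc. Given \<open>a\<close>, the other two are the image of a uniform
  point of the disc under an affine map with Jacobian sqrt(1 - a^2). The roots cancel and a constant
  density is left.\<close>

lemma nn_integral_gram_of:
  obtains k :: ennreal where
    "\<And>F. F \<in> borel_measurable borel \<Longrightarrow>
      (\<integral>\<^sup>+x. (\<integral>\<^sup>+y. (\<integral>\<^sup>+z. F (gram_of x y z) \<partial>sphere_measure) \<partial>sphere_measure) \<partial>sphere_measure)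
      = k * (\<integral>\<^sup>+u. F u * indicator {u. gram3_pos u} u \<partial>lborel)"
proof -
  obtain C :: ennreal where C: "\<And>G. (\<lambda>(p, q). G p q) \<in> borel_measurable borel \<Longrightarrow>
      (\<integral>\<^sup>+x. G (fst (fst x)) (fst (snd (fst x))) \<partial>(sphere_measure :: real4 measure))
      = C * (\<integral>\<^sup>+p. (\<integral>\<^sup>+q. G p q * indicator {q. p\<^sup>2 + q\<^sup>2 < 1} q \<partial>lborel) \<partial>lborel)"
    by (rule sphere_measure_two_coordinates) blast
  interpret S: prob_space "sphere_measure :: real4 measure" by (rule prob_space_sphere_measure)
  show ?thesis
  proof (rule that)
    fix F :: "real3 \<Rightarrow> ennreal"
    assume [measurable]: "F \<in> borel_measurable borel"
    \<comment> \<open>\<open>h a\<close> is the conditional expectation of \<open>F\<close> given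
      that the first two points have inner product \<open>a\<close>.\<close>
    define h where "h a = (\<integral>\<^sup>+z. F (a, fst (fst z), a * fst (fst z)
        + sqrt (1 - a\<^sup>2) * fst (snd (fst z)))
       \<partial>(sphere_measure :: real4 measure))" for a
    have [measurable]: "h \<in> borel_measurable borel"
      unfolding h_def by measurable
    \<comment> \<open>The substitution t = a p + sqrt(1 - a^2) q; the Jacobian is kept on the left
      so that nothing has to be divided by it.\<close>
    have inner: "ennreal (sqrt (1 - a\<^sup>2)) * h a
        = C * (\<integral>\<^sup>+p. (\<integral>\<^sup>+t. F (a, p, t) * indicator {u. gram3_pos u} (a, p, t) \<partial>lborel) \<partial>lborel)"
      if a: "a\<^sup>2 < 1" for a
    proof -
      define \<beta> where "\<beta> = sqrt (1 - a\<^sup>2)"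
      have b: "\<beta> > 0" using a by (simp add: \<beta>_def)
      have "ennreal \<beta> * h a = ennreal \<beta> * (C * (\<integral>\<^sup>+p. (\<integral>\<^sup>+q. F (a, p, a * p
          + \<beta> * q) * indicator {q. p\<^sup>2 + q\<^sup>2 < 1} q \<partial>lborel) \<partial>lborel))"
        unfolding h_def \<beta>_def[symmetric]
        by (subst C[where G="\<lambda>p q. F (a, p, a * p + \<beta> * q)"]) (simp_all add: split_beta')
      also have "\<dots> = C * (\<integral>\<^sup>+p. ennreal \<beta> * (\<integral>\<^sup>+q. F (a, p, a * p + \<beta> * q) * indicator {q. p\<^sup>2
          + q\<^sup>2 < 1} q \<partial>lborel) \<partial>lborel)"
        by (subst nn_integral_cmult) (simp_all add: mult.left_commute)
      also have "\<dots> = C * (\<integral>\<^sup>+p. (\<integral>\<^sup>+t. F (a, p, t) * indicator {u. gram3_pos u} (a, p, t) \<partial>lborel)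
          \<partial>lborel)"
      proof (intro arg_cong2[where f="(*)"] refl nn_integral_cong)
        fix p
        show "ennreal \<beta> * (\<integral>\<^sup>+q. F (a, p, a * p + \<beta> * q) * indicator {q. p\<^sup>2 + q\<^sup>2 < 1} q \<partial>lborel)
            = (\<integral>\<^sup>+t. F (a, p, t) * indicator {u. gram3_pos u} (a, p, t) \<partial>lborel)"
          using b a
          by (subst (2) nn_integral_real_affine[where c="\<beta>" and t="a * p"])
             (auto simp: \<beta>_def gram3_pos_affine indicator_def)
      qed
      finally show ?thesis by (simp add: \<beta>_def)
    qed
    have "(\<integral>\<^sup>+x. (\<integral>\<^sup>+y. (\<integral>\<^sup>+z. F (gram_of x y z) \<partial>sphere_measure) \<partial>sphere_measure) \<partial>sphere_measure)
      = (\<integral>\<^sup>+x. (\<integral>\<^sup>+y. h (fst (fst y)) \<partial>(sphere_measure :: real4 measure)) \<partial>(sphere_measure ::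
          real4 measure))"
    proof (rule nn_integral_cong_AE, use AE_sphere_measure_norm in eventually_elim)
      fix x :: real4 assume x: "norm x = 1"
      have "(\<integral>\<^sup>+y. (\<integral>\<^sup>+z. F (gram_of x y z) \<partial>sphere_measure) \<partial>sphere_measure)
          = (\<integral>\<^sup>+y. h (x \<bullet> y) \<partial>sphere_measure)"
        by (rule nn_integral_cong_AE, use AE_sphere_measure_norm in eventually_elim)
           (simp add: nn_integral_gram_third x h_def)
      then show "(\<integral>\<^sup>+y. (\<integral>\<^sup>+z. F (gram_of x y z) \<partial>sphere_measure) \<partial>sphere_measure)
          = (\<integral>\<^sup>+y. h (fst (fst y)) \<partial>(sphere_measure :: real4 measure))"
        using x by (simp add: nn_integral_inner_sphere_measure)
    qed
    also have "\<dots> = (\<integral>\<^sup>+y. h (fst (fst y)) \<partial>(sphere_measure :: real4 measure))"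
      by (simp add: S.emeasure_space_1[simplified])
    also have "\<dots> = C * (\<integral>\<^sup>+p. (\<integral>\<^sup>+q. h p * indicator {q. p\<^sup>2 + q\<^sup>2 < 1} q \<partial>lborel) \<partial>lborel)"
      by (rule C[where G="\<lambda>p q. h p"]) (simp add: split_beta')
    also have "\<dots> = C * (\<integral>\<^sup>+p. 2 * C * (\<integral>\<^sup>+q. (\<integral>\<^sup>+t. F (p, q, t) * indicator {u. gram3_pos u} (p,
        q, t) \<partial>lborel) \<partial>lborel) \<partial>lborel)"
    proof (intro arg_cong2[where f="(*)"] refl nn_integral_cong)
      fix p :: real
      have "(\<integral>\<^sup>+q. h p * indicator {q. p\<^sup>2 + q\<^sup>2 < 1} q \<partial>lborel)
          = h p * (if p\<^sup>2 < 1 then 2 * ennreal (sqrt (1 - p\<^sup>2)) else 0)"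
        by (subst nn_integral_cmult) (simp_all add: emeasure_disc_slice)
      also have "\<dots> = 2 * C * (\<integral>\<^sup>+q. (\<integral>\<^sup>+t. F (p, q, t) * indicator {u. gram3_pos u} (p, q, t)
          \<partial>lborel) \<partial>lborel)"
      proof (cases "p\<^sup>2 < 1")
        case True
        \<comment> \<open>The chord length supplies precisely the factor that \<open>inner\<close>
          asks for.\<close>
        have "h p * (2 * ennreal (sqrt (1 - p\<^sup>2))) = 2 * (ennreal (sqrt (1 - p\<^sup>2)) * h p)"
          by (simp only: mult_ac)
        then show ?thesis using True by (simp only: inner[OF True] mult.assoc if_True)
      next
        case False
        then have "\<not> gram3_pos (p, q, t)" for q t by (simp add: gram3_pos_def)
        then show ?thesis using False by simp
      qed
      finally show "(\<integral>\<^sup>+q. h p * indicator {q. p\<^sup>2 + q\<^sup>2 < 1} q \<partial>lborel)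
         = 2 * C * (\<integral>\<^sup>+q. (\<integral>\<^sup>+t. F (p, q, t) * indicator {u. gram3_pos u} (p, q, t) \<partial>lborel)
             \<partial>lborel)" .
    qed
    also have "\<dots> = C * (2 * C) * (\<integral>\<^sup>+u. F u * indicator {u. gram3_pos u} u \<partial>lborel)"
      by (subst nn_integral_lborel_triple) (simp_all add: nn_integral_cmult mult.assoc)
    finally show "(\<integral>\<^sup>+x. (\<integral>\<^sup>+y. (\<integral>\<^sup>+z. F (gram_of x y z) \<partial>sphere_measure) \<partial>sphere_measure)
        \<partial>sphere_measure)
      = C * (2 * C) * (\<integral>\<^sup>+u. F u * indicator {u. gram3_pos u} u \<partial>lborel)" .
  qed
qed

section \<open>Configurations in standard position and invariant functions\<close>

definition inner_coeff :: "nat \<Rightarrow> nat \<Rightarrow> (nat \<Rightarrow> real4) \<Rightarrow> real" where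
  "inner_coeff i j x = x i \<bullet> x j"

definition place :: "nat \<Rightarrow> real3 \<Rightarrow> (nat \<Rightarrow> real4) \<Rightarrow> nat \<Rightarrow> real4" where
  "place n u y = (\<lambda>j\<in>{1..n}. if j \<le> 3 then frame u j else y j)"

definition orth_invariant :: "nat \<Rightarrow> ((nat \<Rightarrow> real4) \<Rightarrow> 'b) \<Rightarrow> bool" where
  "orth_invariant n F \<longleftrightarrow>
     (\<forall>R x. orthogonal_transformation R \<longrightarrow> F (\<lambda>j\<in>{1..n}. R (x j)) = F x)"

lemma spheres_component_measurable [measurable]:
  "j \<in> I \<Longrightarrow> (\<lambda>x. x j) \<in> spheres I \<rightarrow>\<^sub>M borel"
  using measurable_component_singleton[of j I "\<lambda>_. sphere_measure :: real4 measure"] by simp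

lemma inner_coeff_measurable [measurable]:
  "i \<in> I \<Longrightarrow> j \<in> I \<Longrightarrow> inner_coeff i j \<in> spheres I \<rightarrow>\<^sub>M borel"
  unfolding inner_coeff_def by measurable

lemma upper3_inner_coeff: "upper3 inner_coeff x = gram_of (x 1) (x 2) (x 3)"
  by (simp add: upper3_def inner_coeff_def gram_of_def)

lemma upper3_measurable [measurable]:
  assumes "3 \<le> n"
  shows "upper3 inner_coeff \<in> spheres {1..n} \<rightarrow>\<^sub>M borel"
  unfolding upper3_def using assms by (intro borel_measurable_Pair inner_coeff_measurable) auto

lemma frame_measurable [measurable]: "(\<lambda>u. frame u j) \<in> borel_measurable borel"
  unfolding frame_def by measurable

lemma place_measurable:
  "(\<lambda>(u, y). place n u y) \<in> borel \<Otimes>\<^sub>M spheres {4..n} \<rightarrow>\<^sub>M spheres {1..n}"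
  unfolding place_def split_beta'
proof (rule measurable_restrict)
  fix j assume j: "j \<in> {1..n}"
  show "(\<lambda>x. if j \<le> 3 then frame (fst x) j else snd x j)
      \<in> borel \<Otimes>\<^sub>M spheres {4..n} \<rightarrow>\<^sub>M sphere_measure"
  proof (cases "j \<le> 3")
    case False
    then have [measurable]: "(\<lambda>y. y j) \<in> spheres {4..n} \<rightarrow>\<^sub>M borel" using j by simp
    show ?thesis using False by simp
  qed simp
qed

lemma upper3_place:
  assumes "3 \<le> n" "gram3_pos u"
  shows "upper3 inner_coeff (place n u y) = u"
  using assms by (simp add: upper3_inner_coeff place_def gram_of_frame(1) del: One_nat_def)

lemma nn_integral_spheres_split:
  assumes n: "3 \<le> n" and F: "F \<in> borel_measurable (spheres {1..n})"
  shows "(\<integral>\<^sup>+x. F x \<partial>spheres {1..n})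
      = (\<integral>\<^sup>+x1. (\<integral>\<^sup>+x2. (\<integral>\<^sup>+x3. (\<integral>\<^sup>+y. F (y(3 := x3, 2 := x2, 1 := x1))
     \<partial>spheres {4..n}) \<partial>sphere_measure) \<partial>sphere_measure) \<partial>sphere_measure)"
proof -
  interpret product_prob_space "\<lambda>_::nat. sphere_measure :: real4 measure"
    by (intro product_prob_spaceI prob_space_sphere_measure)
  have upd: "(\<lambda>y. y(j := x)) \<in> spheres J \<rightarrow>\<^sub>M spheres (insert j J)" for x j J
    by (rule measurable_fun_upd[where J=J]) auto
  have I: "{1..n} = insert 1 (insert 2 (insert 3 {4..n}))" using n by auto
  have F1: "F \<in> borel_measurable (spheres (insert 1 (insert 2 (insert 3 {4..n}))))"
    using F unfolding I .
  have F2: "(\<lambda>y. F (y(1 := x1))) \<in> borel_measurable (spheres (insert 2 (insert 3 {4..n})))" for x1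
    using upd F1 by (rule measurable_compose)
  have F3: "(\<lambda>y. F (y(2 := x2, 1 := x1))) \<in> borel_measurable (spheres (insert 3 {4..n}))" for x1 x2
    using upd F2 by (rule measurable_compose)
  have notin: "1 \<notin> insert 2 (insert 3 {4..n})" "2 \<notin> insert 3 {4..n}" "3 \<notin> {4..n}" by auto
  have fin: "finite (insert 2 (insert 3 {4..n}))" "finite (insert 3 {4..n})" "finite {4..n}" by auto
  show ?thesis
    unfolding I product_nn_integral_insert_rev[OF fin(1) notin(1) F1]
      product_nn_integral_insert_rev[OF fin(2) notin(2) F2] product_nn_integral_insert_rev[OF
          fin(3) notin(3) F3]
    by (rule refl)
qed

text \<open>The points beyond the third integrate to one, so the same \<open>k\<close> serves every
  \<open>n\<close>. Taking \<open>F\<close> to be \<open>1\<close> exhibits \<open>1\<close> as a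
  multiple of \<open>k\<close>, which excludes both \<open>0\<close> and
  \<open>\<top>\<close>.\<close>

lemma nn_integral_upper3:
  obtains k :: ennreal where "k \<noteq> 0" "k \<noteq> \<top>"
    "\<And>n F. 3 \<le> n \<Longrightarrow> F \<in> borel_measurable borel \<Longrightarrow> (\<integral>\<^sup>+x. F (upper3 inner_coeff x) \<partial>spheres {1..n})
      = k * (\<integral>\<^sup>+u. F u * indicator {u. gram3_pos u} u \<partial>lborel)"
    "\<And>F. F \<in> borel_measurable borel \<Longrightarrow>
      (\<integral>\<^sup>+x. (\<integral>\<^sup>+y. (\<integral>\<^sup>+z. F (gram_of x y z) \<partial>sphere_measure) \<partial>sphere_measure) \<partial>sphere_measure)
      = k * (\<integral>\<^sup>+u. F u * indicator {u. gram3_pos u} u \<partial>lborel)"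
proof -
  obtain k :: ennreal where k: "\<And>F. F \<in> borel_measurable borel \<Longrightarrow>
      (\<integral>\<^sup>+x. (\<integral>\<^sup>+y. (\<integral>\<^sup>+z. F (gram_of x y z) \<partial>sphere_measure) \<partial>sphere_measure) \<partial>sphere_measure)
      = k * (\<integral>\<^sup>+u. F u * indicator {u. gram3_pos u} u \<partial>lborel)"
    by (rule nn_integral_gram_of) blast
  interpret S: prob_space "sphere_measure :: real4 measure" by (rule prob_space_sphere_measure)
  have law: "(\<integral>\<^sup>+x. F (upper3 inner_coeff x) \<partial>spheres {1..n})
      = k * (\<integral>\<^sup>+u. F u * indicator {u. gram3_pos u} u \<partial>lborel)"
    if n: "3 \<le> n" and [measurable]: "F \<in> borel_measurable borel" for n F
  proof -
    interpret Y: prob_space "spheres {4..n}" by (intro prob_space_PiM prob_space_sphere_measure)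
    have "(\<lambda>x. F (upper3 inner_coeff x)) \<in> borel_measurable (spheres {1..n})"
      using upper3_measurable[OF n] by measurable
    then show ?thesis
      by (subst nn_integral_spheres_split[OF n]) (simp_all add: upper3_inner_coeff
          Y.emeasure_space_1 k)
  qed
  have one: "1 = k * (\<integral>\<^sup>+u. indicator {u. gram3_pos u} u \<partial>lborel)"
    using k[of "\<lambda>_. 1"] by (simp add: S.emeasure_space_1[simplified])
  then have "k \<noteq> 0" by auto
  moreover have "k \<noteq> \<top>"
  proof
    assume "k = \<top>"
    with one show False by (auto simp: ennreal_top_mult split: if_splits)
  qed
  ultimately show ?thesis using law k by (rule that)
qed

section \<open>Conditioning on the first Gram matrix\<close>

text \<open>Otherwise the simplifier rewrites the index set $\{1,\dots,n\}$ in the product measures.\<close>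

declare One_nat_def [simp del]

lemma prob_space_spheres: "prob_space (spheres I)"
  by (intro prob_space_PiM prob_space_sphere_measure)

text \<open>The law just found is carried by the positive definite matrices, so linearly dependent
  triples need no separate argument.\<close>

lemma AE_gram3_pos_upper3:
  assumes n: "3 \<le> n"
  shows "AE x in spheres {1..n}. gram3_pos (upper3 inner_coeff x)"
proof -
  note [measurable] = upper3_measurable[OF n]
  obtain k :: ennreal where k: "\<And>n F. 3 \<le> n \<Longrightarrow> F \<in> borel_measurable borel \<Longrightarrow>
      (\<integral>\<^sup>+x. F (upper3 inner_coeff x) \<partial>spheres {1..n})
          = k * (\<integral>\<^sup>+u. F u * indicator {u. gram3_pos u} u \<partial>lborel)"
    by (rule nn_integral_upper3) blast
  have "(\<integral>\<^sup>+x. indicator {u. \<not> gram3_pos u} (upper3 inner_coeff x) \<partial>spheres {1..n})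
      = k * (\<integral>\<^sup>+u. indicator {u. \<not> gram3_pos u} u * indicator {u. gram3_pos u} u \<partial>lborel)"
    by (rule k[OF n]) measurable
  also have "(\<integral>\<^sup>+u. indicator {u. \<not> gram3_pos u} u * indicator {u. gram3_pos u} u \<partial>lborel)
      = (\<integral>\<^sup>+(u::real3). 0 \<partial>lborel)"
    by (intro nn_integral_cong) (auto simp: indicator_def)
  finally have 0: "(\<integral>\<^sup>+x. indicator {u. \<not> gram3_pos u} (upper3 inner_coeff x) \<partial>spheres {1..n}) = 0"
    by simp
  have "AE x in spheres {1..n}. indicator {u. \<not> gram3_pos u} (upper3 inner_coeff x) = (0::ennreal)"
    by (subst nn_integral_0_iff_AE[symmetric]) (use 0 in simp_all)
  then show ?thesis by eventually_elim (auto simp: indicator_def split: if_splits)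
qed

lemma AE_gram3_pos_distr:
  assumes "3 \<le> n"
  shows "AE u in distr (spheres {1..n}) borel (upper3 inner_coeff). gram3_pos u"
  using AE_gram3_pos_upper3[OF assms] upper3_measurable[OF assms]
  by (subst AE_distr_iff) simp_all

lemma nn_integral_spheres_orthogonal:
  assumes R: "\<And>j. j \<in> I \<Longrightarrow> orthogonal_transformation (R j)" and "finite I"
    and F: "F \<in> borel_measurable (spheres I)"
  shows "(\<integral>\<^sup>+y. F (\<lambda>j\<in>I. R j (y j)) \<partial>spheres I) = (\<integral>\<^sup>+y. F y \<partial>spheres I)"
proof -
  have "(\<lambda>y. \<lambda>j\<in>I. R j (y j)) \<in> spheres I \<rightarrow>\<^sub>M spheres I"
    using R[THEN orthogonal_transformation_measurable]
    by (intro measurable_restrict measurable_compose[OF measurable_component_singleton]) auto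
  then have "(\<integral>\<^sup>+y. F (\<lambda>j\<in>I. R j (y j)) \<partial>spheres I)
      = (\<integral>\<^sup>+y. F y \<partial>distr (spheres I) (spheres I) (\<lambda>y. \<lambda>j\<in>I. R j (y j)))"
    using F by (simp add: nn_integral_distr)
  then show ?thesis using distr_spheres_orthogonal[of I R] R \<open>finite I\<close> by simp
qed

text \<open>A rotation carries \<open>x\<close>, \<open>y\<close>, \<open>z\<close> to the frame
  with the same Gram matrix. Invariance of \<open>F\<close> lets it act on the whole configuration;
  on the other points it can then be removed, since it is a fixed orthogonal map and their law is
  invariant.\<close>

lemma orth_invariant_place:
  assumes n: "3 \<le> n" and F: "F \<in> borel_measurable (spheres {1..n})" and inv: "orth_invariant n F"
    and norms: "norm x = 1" "norm y = 1" "norm z = 1" and pos: "gram3_pos (gram_of x y z)"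
  shows "(\<integral>\<^sup>+t. F (t(3 := z, 2 := y, 1 := x)) \<partial>spheres {4..n})
    = (\<integral>\<^sup>+t. F (place n (gram_of x y z) t) \<partial>spheres {4..n})"
proof -
  define u where "u = gram_of x y z"
  note pos' = pos[folded u_def]
  have u: "(x \<bullet> y, x \<bullet> z, y \<bullet> z) = (frame u 1 \<bullet> frame u 2, frame u 1 \<bullet> frame u 3, frame u 2 \<bullet>
      frame u 3)"
    using gram_of_frame(1)[OF pos'] by (simp only: gram_of_def[symmetric] u_def[symmetric])
  \<comment> \<open>Indices are shifted to start at \<open>0\<close>, and all indices from
    \<open>2\<close> on repeat the third point, so the Gram identity can be checked without a bound
    on the indices.\<close>
  define X where "X i = (if i = 0 then x else if i = 1 then y else z)" for i :: nat
  define Y where "Y i = (if i = 0 then frame u 1 else if i = 1 then frame u 2 else frame u 3)"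
      for i :: nat
  have xyz: "x \<bullet> y = frame u 1 \<bullet> frame u 2" "x \<bullet> z = frame u 1 \<bullet> frame u 3" "y \<bullet> z
      = frame u 2 \<bullet> frame u 3"
    using u by (simp_all only: prod.inject)
  have sq: "x \<bullet> x = 1" "y \<bullet> y = 1" "z \<bullet> z = 1" using norms by (simp_all only: norm_eq_1)
  have yx: "y \<bullet> x = frame u 2 \<bullet> frame u 1" "z \<bullet> x = frame u 3 \<bullet> frame u 1" "z \<bullet> y
      = frame u 3 \<bullet> frame u 2"
    using xyz by (metis inner_commute)+
  have "\<exists>R :: real4 \<Rightarrow> real4. orthogonal_transformation R \<and> (\<forall>i<3. R (X i) = Y i)"
  proof (rule gram_eq_imp_orthogonal)
    fix i j :: nat
    consider "i = 0" | "i = 1" | "i \<noteq> 0" "i \<noteq> 1" by blast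
    then show "X i \<bullet> X j = Y i \<bullet> Y j"
      by cases (simp_all add: X_def Y_def xyz yx sq gram_of_frame(2-4)[OF pos'])
  qed
  then obtain R :: "real4 \<Rightarrow> real4" where R: "orthogonal_transformation R" and "\<forall>i<3. R (X i)
      = Y i" by blast
  then have "R (X 0) = Y 0" "R (X 1) = Y 1" "R (X 2) = Y 2" by auto
  then have RX: "R x = frame u 1" "R y = frame u 2" "R z = frame u 3"
    by (simp_all add: X_def Y_def)
  have eq: "F (t(3 := z, 2 := y, 1 := x)) = F (place n u (\<lambda>j\<in>{4..n}. R (t j)))" for t
  proof -
    have "F (t(3 := z, 2 := y, 1 := x)) = F (\<lambda>j\<in>{1..n}. R ((t(3 := z, 2 := y, 1 := x)) j))"
      using inv R unfolding orth_invariant_def by metis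
    also have "(\<lambda>j\<in>{1..n}. R ((t(3 := z, 2 := y, 1 := x)) j)) = place n u (\<lambda>j\<in>{4..n}. R (t j))"
    proof
      fix j
      have "j \<notin> {1..n} \<or> j = 1 \<or> j = 2 \<or> j = 3 \<or> j \<in> {4..n}"
        unfolding atLeastAtMost_iff by linarith
      then consider "j \<notin> {1..n}" | "j = 1" | "j = 2" | "j = 3" | "j \<in> {4..n}" by blast
      then show "(\<lambda>j\<in>{1..n}. R ((t(3 := z, 2 := y, 1 := x)) j)) j
          = place n u (\<lambda>j\<in>{4..n}. R (t j)) j"
        by cases (use n in \<open>auto simp: place_def RX\<close>)
    qed
    finally show ?thesis .
  qed
  have "(\<lambda>t. F (place n u t)) \<in> borel_measurable (spheres {4..n})"
    using measurable_compose[OF measurable_Pair1' measurable_compose[OF place_measurable F], of u]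
        by simp
  then show ?thesis
    unfolding u_def[symmetric] eq using R
        by (intro nn_integral_spheres_orthogonal[where R="\<lambda>_. R"]) auto
qed

lemma nn_integral_place_measurable:
  assumes F: "F \<in> borel_measurable (spheres {1..n})"
  shows "(\<lambda>u. \<integral>\<^sup>+y. F (place n u y) \<partial>spheres {4..n}) \<in> borel_measurable borel"
proof -
  interpret Y: prob_space "spheres {4..n}" by (rule prob_space_spheres)
  show ?thesis
    using measurable_compose[OF place_measurable F]
    by (intro Y.borel_measurable_nn_integral) (simp add: split_beta')
qed

text \<open>This disintegration over the first Gram matrix is the tool behind all conditional laws
  below. The indicator of positive definiteness equals one almost surely and is inserted so that the
  frame is available whenever the inner integral is rewritten.\<close>

lemma nn_integral_orth_invariant:
  assumes n: "3 \<le> n" and F: "F \<in> borel_measurable (spheres {1..n})" and inv: "orth_invariant n F"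
  shows "(\<integral>\<^sup>+x. F x \<partial>spheres {1..n})
    = (\<integral>\<^sup>+u. (\<integral>\<^sup>+y. F (place n u y) \<partial>spheres {4..n}) \<partial>distr (spheres {1..n}) borel (upper3
        inner_coeff))"
proof -
  note [measurable] = upper3_measurable[OF n] F nn_integral_place_measurable[OF F]
  interpret Y: prob_space "spheres {4..n}" by (rule prob_space_spheres)
  obtain k :: ennreal where k: "\<And>n F. 3 \<le> n \<Longrightarrow> F \<in> borel_measurable borel \<Longrightarrow>
      (\<integral>\<^sup>+x. F (upper3 inner_coeff x) \<partial>spheres {1..n})
          = k * (\<integral>\<^sup>+u. F u * indicator {u. gram3_pos u} u \<partial>lborel)"
    "\<And>F. F \<in> borel_measurable borel \<Longrightarrow>
      (\<integral>\<^sup>+x. (\<integral>\<^sup>+y. (\<integral>\<^sup>+z. F (gram_of x y z) \<partial>sphere_measure) \<partial>sphere_measure) \<partial>sphere_measure)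
      = k * (\<integral>\<^sup>+u. F u * indicator {u. gram3_pos u} u \<partial>lborel)"
    by (rule nn_integral_upper3) blast
  let ?H = "\<lambda>u. \<integral>\<^sup>+y. F (place n u y) \<partial>spheres {4..n}"
  let ?g = "\<lambda>x. indicator {u. gram3_pos u} x :: ennreal"
  have "(\<integral>\<^sup>+x. F x \<partial>spheres {1..n}) = (\<integral>\<^sup>+x. F x * ?g (upper3 inner_coeff x) \<partial>spheres {1..n})"
    by (rule nn_integral_cong_AE) (use AE_gram3_pos_upper3[OF n] in eventually_elim, simp)
  also have "\<dots> = (\<integral>\<^sup>+x1. (\<integral>\<^sup>+x2. (\<integral>\<^sup>+x3. (\<integral>\<^sup>+y. F (y(3 := x3, 2 := x2, 1 := x1)) * ?g (gram_of x1
      x2 x3)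
     \<partial>spheres {4..n}) \<partial>sphere_measure) \<partial>sphere_measure) \<partial>sphere_measure)"
  proof -
    have m: "(\<lambda>x. F x * ?g (upper3 inner_coeff x)) \<in> borel_measurable (spheres {1..n})"
        by measurable
    show ?thesis unfolding nn_integral_spheres_split[OF n m] by (simp add: upper3_inner_coeff)
  qed
  also have "\<dots> = (\<integral>\<^sup>+x1. (\<integral>\<^sup>+x2. (\<integral>\<^sup>+x3. ?H (gram_of x1 x2 x3) * ?g (gram_of x1 x2 x3)
      \<partial>sphere_measure) \<partial>sphere_measure) \<partial>sphere_measure)"
  proof (rule nn_integral_cong_AE, use AE_sphere_measure_norm in eventually_elim, rule
      nn_integral_cong_AE,
      use AE_sphere_measure_norm in eventually_elim, rule nn_integral_cong_AE,
      use AE_sphere_measure_norm in eventually_elim)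
    fix x1 x2 x3 :: real4 assume norms: "norm x1 = 1" "norm x2 = 1" "norm x3 = 1"
    show "(\<integral>\<^sup>+y. F (y(3 := x3, 2 := x2, 1 := x1)) * ?g (gram_of x1 x2 x3) \<partial>spheres {4..n})
      = ?H (gram_of x1 x2 x3) * ?g (gram_of x1 x2 x3)"
      using orth_invariant_place[OF n F inv norms]
      by (cases "gram3_pos (gram_of x1 x2 x3)") simp_all
  qed
  \<comment> \<open>The triple integral and the integral over all points are both equal to the same
    Lebesgue integral, by the two forms of the law of the Gram matrix.\<close>
  also have "\<dots> = (\<integral>\<^sup>+x. ?H (upper3 inner_coeff x) * ?g (upper3 inner_coeff x) \<partial>spheres {1..n})"
    by (subst k(1)[OF n], measurable, subst k(2), measurable)
  also have "\<dots> = (\<integral>\<^sup>+x. ?H (upper3 inner_coeff x) \<partial>spheres {1..n})"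
    by (rule nn_integral_cong_AE) (use AE_gram3_pos_upper3[OF n] in eventually_elim, simp)
  finally show ?thesis by (simp add: nn_integral_distr)
qed

text \<open>The disintegration is applied to the indicator of the exceptional set.\<close>

lemma AE_orth_invariant:
  assumes n: "3 \<le> n" and P: "Measurable.pred (spheres {1..n}) P" and inv: "orth_invariant n P"
    and pos: "\<And>u. gram3_pos u \<Longrightarrow> AE y in spheres {4..n}. P (place n u y)"
  shows "AE x in spheres {1..n}. P x"
proof -
  note [measurable] = P
  let ?F = "\<lambda>x. if P x then 0 else 1 :: ennreal"
  have F: "?F \<in> borel_measurable (spheres {1..n})"
    by measurable
  have "orth_invariant n ?F"
    using inv by (simp add: orth_invariant_def)
  then have "(\<integral>\<^sup>+x. ?F x \<partial>spheres {1..n})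
      = (\<integral>\<^sup>+u. (\<integral>\<^sup>+y. ?F (place n u y) \<partial>spheres {4..n}) \<partial>distr (spheres {1..n}) borel (upper3
      inner_coeff))"
    by (rule nn_integral_orth_invariant[OF n F])
  also have "\<dots> = (\<integral>\<^sup>+u. 0 \<partial>distr (spheres {1..n}) borel (upper3 inner_coeff))"
  proof (rule nn_integral_cong_AE, use AE_gram3_pos_distr[OF n] in eventually_elim)
    fix u assume "gram3_pos u"
    from pos[OF this] have "AE y in spheres {4..n}. ?F (place n u y) = 0"
      by eventually_elim simp
    then have "(\<integral>\<^sup>+y. ?F (place n u y) \<partial>spheres {4..n}) = (\<integral>\<^sup>+y. 0 \<partial>spheres {4..n})"
      by (rule nn_integral_cong_AE)
    then show "(\<integral>\<^sup>+y. ?F (place n u y) \<partial>spheres {4..n}) = 0" by simp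
  qed
  finally have 0: "(\<integral>\<^sup>+x. ?F x \<partial>spheres {1..n}) = 0" by simp
  have "AE x in spheres {1..n}. ?F x = 0"
    by (subst nn_integral_0_iff_AE[OF F, symmetric]) (rule 0)
  then show ?thesis by eventually_elim (simp split: if_splits)
qed

text \<open>The conditional law is presented by a noise variable of law \<open>Q\<close>: given the
  value \<open>x\<close>, the variable behaves like \<open>\<Phi> x\<close> applied to the noise. In
  this form kernel measurability follows from joint measurability of \<open>\<Phi>\<close>.\<close>

lemma cond_law_distrI:
  assumes X: "X \<in> M \<rightarrow>\<^sub>M N" and Y: "Y \<in> M \<rightarrow>\<^sub>M L" and Q: "prob_space Q"
    and Phi: "(\<lambda>(x, y). \<Phi> x y) \<in> N \<Otimes>\<^sub>M Q \<rightarrow>\<^sub>M L"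
    and eq: "\<And>A B. A \<in> sets N \<Longrightarrow> B \<in> sets L \<Longrightarrow>
      (\<integral>\<^sup>+\<omega>. indicator A (X \<omega>) * indicator B (Y \<omega>) \<partial>M)
      = (\<integral>\<^sup>+\<omega>. indicator A (X \<omega>) * (\<integral>\<^sup>+y. indicator B (\<Phi> (X \<omega>) y) \<partial>Q) \<partial>M)"
  shows "cond_law M N X L Y (\<lambda>x. distr Q L (\<Phi> x))"
  unfolding cond_law_def
proof (intro conjI ballI)
  note [measurable] = X Y
  have "Q \<in> space (prob_algebra Q)" using Q by (simp add: space_prob_algebra)
  then show K: "(\<lambda>x. distr Q L (\<Phi> x)) \<in> N \<rightarrow>\<^sub>M prob_algebra L"
    using Phi by (intro measurable_distr_prob_space2[where M=Q] measurable_const)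
  fix A B assume [measurable]: "A \<in> sets N" "B \<in> sets L"
  have [measurable]: "(\<lambda>x. emeasure (distr Q L (\<Phi> x)) B) \<in> borel_measurable N"
    by (rule measurable_emeasure_kernel[OF measurable_prob_algebraD[OF K]]) simp
  have "emeasure M {\<omega>\<in>space M. X \<omega> \<in> A \<and> Y \<omega> \<in> B} = (\<integral>\<^sup>+\<omega>. indicator {\<omega>\<in>space M. X \<omega> \<in> A \<and> Y \<omega>
      \<in> B} \<omega> \<partial>M)"
    by (subst nn_integral_indicator) simp_all
  also have "\<dots> = (\<integral>\<^sup>+\<omega>. indicator A (X \<omega>) * indicator B (Y \<omega>) \<partial>M)"
    by (intro nn_integral_cong) (auto simp: indicator_def)
  also have "\<dots> = (\<integral>\<^sup>+\<omega>. indicator A (X \<omega>) * emeasure (distr Q L (\<Phi> (X \<omega>))) B \<partial>M)"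
  proof (subst eq, simp, simp, intro nn_integral_cong arg_cong2[where f="(*)"] refl)
    fix \<omega> assume "\<omega> \<in> space M"
    then have "\<Phi> (X \<omega>) \<in> Q \<rightarrow>\<^sub>M L"
      using measurable_compose[OF measurable_Pair1' Phi] measurable_space[OF X] by simp
    then show "(\<integral>\<^sup>+y. indicator B (\<Phi> (X \<omega>) y) \<partial>Q) = emeasure (distr Q L (\<Phi> (X \<omega>))) B"
      by (subst nn_integral_distr[symmetric, of _ _ L]) simp_all
  qed
  also have "\<dots> = (\<integral>\<^sup>+x\<in>A. emeasure (distr Q L (\<Phi> x)) B \<partial>distr M N X)"
    by (subst nn_integral_distr) (simp_all add: mult.commute)
  finally show "emeasure M {\<omega>\<in>space M. X \<omega> \<in> A \<and> Y \<omega> \<in> B}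
      = (\<integral>\<^sup>+x\<in>A. emeasure (distr Q L (\<Phi> x)) B \<partial>distr M N X)" .
qed (use X Y in auto)

lemma orth_invariant_inner_coeff:
  assumes "orthogonal_transformation R" "i \<in> {1..n}" "j \<in> {1..n}"
  shows "inner_coeff i j (\<lambda>j\<in>{1..n}. R (x j)) = inner_coeff i j x"
  using assms by (simp add: inner_coeff_def orthogonal_transformation_inner)

lemma orth_invariant_upper3: "3 \<le> n \<Longrightarrow> orth_invariant n (upper3 inner_coeff)"
  by (simp add: orth_invariant_def upper3_def orth_invariant_inner_coeff)

text \<open>In standard position the first Gram matrix is \<open>u\<close> itself, so the indicator
  of the conditioning event is constant in \<open>y\<close> and leaves the inner integral. The
  values \<open>u\<close> not covered by \<open>eq\<close> form a null set.\<close>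

lemma cond_law_upper3:
  assumes n: "3 \<le> n" and Y: "Y \<in> spheres {1..n} \<rightarrow>\<^sub>M L" and inv: "orth_invariant n Y"
    and Phi: "(\<lambda>(u, y). \<Phi> u y) \<in> borel \<Otimes>\<^sub>M spheres {4..n} \<rightarrow>\<^sub>M L"
    and eq: "\<And>u y. gram3_pos u \<Longrightarrow> Y (place n u y) = \<Phi> u y"
  shows "cond_law (spheres {1..n}) borel (upper3 inner_coeff) L Y (\<lambda>u. distr (spheres {4..n}) L (\<Phi>
      u))"
proof (rule cond_law_distrI[OF upper3_measurable[OF n] Y prob_space_spheres Phi])
  note [measurable] = upper3_measurable[OF n] Y
  fix A :: "real3 set" and B assume [measurable]: "A \<in> sets borel" "B \<in> sets L"
  interpret Y: prob_space "spheres {4..n}" by (rule prob_space_spheres)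
  have [measurable]: "(\<lambda>u. \<integral>\<^sup>+y. indicator B (\<Phi> u y) \<partial>spheres {4..n}) \<in> borel_measurable borel"
    by (rule Y.borel_measurable_nn_integral)
       (use measurable_compose[OF Phi borel_measurable_indicator, of B] in \<open>simp add: split_beta'\<close>)
  have PhiB: "(\<lambda>y. indicator B (\<Phi> u y)) \<in> borel_measurable (spheres {4..n})" for u
    using measurable_compose[OF measurable_Pair1' measurable_compose[OF Phi
        borel_measurable_indicator], of u B]
    by simp
  have "(\<integral>\<^sup>+x. indicator A (upper3 inner_coeff x) * indicator B (Y x) \<partial>spheres {1..n})
      = (\<integral>\<^sup>+u. (\<integral>\<^sup>+y. indicator A (upper3 inner_coeff (place n u y)) * indicator B (Y (place n u
          y)) \<partial>spheres {4..n})
         \<partial>distr (spheres {1..n}) borel (upper3 inner_coeff))"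
    by (rule nn_integral_orth_invariant[OF n])
       (use inv orth_invariant_upper3[OF n] in \<open>simp_all add: orth_invariant_def\<close>)
  also have "\<dots> = (\<integral>\<^sup>+u. indicator A u * (\<integral>\<^sup>+y. indicator B (\<Phi> u y) \<partial>spheres {4..n})
         \<partial>distr (spheres {1..n}) borel (upper3 inner_coeff))"
    by (rule nn_integral_cong_AE, use AE_gram3_pos_distr[OF n] in eventually_elim)
       (simp add: upper3_place[OF n] eq nn_integral_cmult[OF PhiB])
  also have "\<dots> = (\<integral>\<^sup>+x. indicator A (upper3 inner_coeff x) *
      (\<integral>\<^sup>+y. indicator B (\<Phi> (upper3 inner_coeff x) y) \<partial>spheres {4..n}) \<partial>spheres {1..n})"
    by (subst nn_integral_distr) simp_all
  finally show "(\<integral>\<^sup>+x. indicator A (upper3 inner_coeff x) * indicator B (Y x) \<partial>spheres {1..n})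
      = (\<integral>\<^sup>+x. indicator A (upper3 inner_coeff x) *
          (\<integral>\<^sup>+y. indicator B (\<Phi> (upper3 inner_coeff x) y) \<partial>spheres {4..n}) \<partial>spheres {1..n})" .
qed

lemma col_place:
  assumes "j \<in> {4..n}"
  shows "col inner_coeff j (place n u y) = chol u (fst (y j))"
  using assms frame_inner[of u "y j"] by (simp add: col_def inner_coeff_def place_def)

lemma col_measurable:
  "j \<in> {4..n} \<Longrightarrow> col inner_coeff j \<in> spheres {1..n} \<rightarrow>\<^sub>M borel"
  unfolding col_def by (intro borel_measurable_Pair inner_coeff_measurable) auto

lemma orth_invariant_col: "j \<in> {4..n} \<Longrightarrow> orth_invariant n (col inner_coeff j)"
  by (simp add: orth_invariant_def col_def orth_invariant_inner_coeff)

lemma cond_law_col: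
  assumes j: "j \<in> {4..n}"
  shows "cond_law (spheres {1..n}) borel (upper3 inner_coeff) borel (col inner_coeff j)
    (\<lambda>u. distr (spheres {4..n}) borel (\<lambda>y. chol u (fst (y j))))"
proof (rule cond_law_upper3)
  have [measurable]: "(\<lambda>y. y j) \<in> spheres {4..n} \<rightarrow>\<^sub>M borel" using j by simp
  show "(\<lambda>(u, y). chol u (fst (y j))) \<in> borel \<Otimes>\<^sub>M spheres {4..n} \<rightarrow>\<^sub>M borel"
    unfolding split_beta' by measurable
qed (use j in \<open>auto simp: col_measurable orth_invariant_col col_place\<close>)

lemma cond_law_cols:
  assumes n: "4 \<le> n"
  shows "cond_law (spheres {1..n}) borel (upper3 inner_coeff) (\<Pi>\<^sub>M j\<in>{4..n}. borel)
    (\<lambda>x. \<lambda>j\<in>{4..n}. col inner_coeff j x)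
    (\<lambda>u. distr (spheres {4..n}) (\<Pi>\<^sub>M j\<in>{4..n}. borel) (\<lambda>y. \<lambda>j\<in>{4..n}. chol u (fst (y j))))"
proof (rule cond_law_upper3)
  show "(\<lambda>(u, y). \<lambda>j\<in>{4..n}. chol u (fst (y j)))
      \<in> borel \<Otimes>\<^sub>M spheres {4..n} \<rightarrow>\<^sub>M (\<Pi>\<^sub>M j\<in>{4..n}. borel)"
    unfolding split_beta'
  proof (rule measurable_restrict)
    fix j assume "j \<in> {4..n}"
    then have [measurable]: "(\<lambda>y. y j) \<in> spheres {4..n} \<rightarrow>\<^sub>M borel" by simp
    show "(\<lambda>x. chol (fst x) (fst (snd x j))) \<in> borel \<Otimes>\<^sub>M spheres {4..n} \<rightarrow>\<^sub>M borel" by simp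
  qed
  show "(\<lambda>x. \<lambda>j\<in>{4..n}. col inner_coeff j x) \<in> spheres {1..n} \<rightarrow>\<^sub>M (\<Pi>\<^sub>M j\<in>{4..n}. borel)"
    by (intro measurable_restrict col_measurable)
  show "orth_invariant n (\<lambda>x. \<lambda>j\<in>{4..n}. col inner_coeff j x)"
    using orth_invariant_col by (auto simp: orth_invariant_def intro!: restrict_ext)
qed (use n in \<open>auto simp: col_place intro!: restrict_ext\<close>)

lemma indep_vars_PiM_coordinates:
  assumes I: "finite I" "I \<noteq> {}" and M: "\<And>i. i \<in> I \<Longrightarrow> prob_space (M i)" "\<And>i. i \<in> I \<Longrightarrow> sets (M i)
      = sets (N i)"
  shows "prob_space.indep_vars (PiM I M) N (\<lambda>i z. z i) I"
proof -
  interpret prob_space "PiM I M" by (intro prob_space_PiM M)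
  have sets: "sets (PiM I N) = sets (PiM I M)" by (intro sets_PiM_cong) (auto simp: M)
  have rv: "(\<lambda>z. z i) \<in> PiM I M \<rightarrow>\<^sub>M N i" if "i \<in> I" for i
    using measurable_component_singleton[OF that, of M] measurable_cong_sets[OF refl M(2)[OF
        that]] by metis
  have "distr (PiM I M) (PiM I N) (\<lambda>z. \<lambda>i\<in>I. z i) = distr (PiM I M) (PiM I M) (\<lambda>z. z)"
    by (intro distr_cong) (auto simp: sets space_PiM PiE_def extensional_restrict)
  also have "\<dots> = PiM I (\<lambda>i. distr (PiM I M) (N i) (\<lambda>z. z i))"
  proof -
    have "PiM I M = PiM I (\<lambda>i. distr (PiM I M) (N i) (\<lambda>z. z i))"
    proof (rule PiM_cong)
      fix i assume i: "i \<in> I"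
      have "distr (PiM I M) (N i) (\<lambda>z. z i) = distr (PiM I M) (M i) (\<lambda>z. z i)"
        by (intro distr_cong) (auto simp: M i)
      then show "M i = distr (PiM I M) (N i) (\<lambda>z. z i)"
        using distr_PiM_component[of I M i] M i by simp
    qed simp
    then show ?thesis by (simp add: distr_id)
  qed
  finally show ?thesis
    by (subst indep_vars_iff_distr_eq_PiM'[OF I(2) rv])
qed

text \<open>For a fixed \<open>u\<close> the points are mapped coordinate by coordinate, so the
  conditional law is again a product measure.\<close>

lemma indep_vars_cols:
  assumes "4 \<le> n"
  shows "prob_space.indep_vars
    (distr (spheres {4..n}) (\<Pi>\<^sub>M j\<in>{4..n}. borel) (\<lambda>y. \<lambda>j\<in>{4..n}. chol u (fst (y j))))
    (\<lambda>j. borel) (\<lambda>j v. v j) {4..n}"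
proof -
  have m: "(\<lambda>x. chol u (fst x)) \<in> borel_measurable (borel :: real4 measure)" by measurable
  have "distr (spheres {4..n}) (\<Pi>\<^sub>M j\<in>{4..n}. borel) (\<lambda>y. \<lambda>j\<in>{4..n}. chol u (fst (y j)))
      = (\<Pi>\<^sub>M j\<in>{4..n}. distr (sphere_measure :: real4 measure) borel (\<lambda>x. chol u (fst x)))"
    by (rule distr_PiM_map[where f="\<lambda>_ x. chol u (fst x)" and N="\<lambda>_. borel"])
       (simp_all add: prob_space_sphere_measure)
  then show ?thesis
    using assms m by (simp only:) (intro indep_vars_PiM_coordinates prob_space.prob_space_distr
        prob_space_sphere_measure, auto)
qed

text \<open>The Jacobian \<open>b\<close> of the triangular map is absorbed by the determinant, so
  the constant is that of the projected sphere and does not vary with \<open>n\<close>,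
  \<open>j\<close> or \<open>u\<close>.\<close>

lemma distr_chol_density:
  obtains c :: real where "c > 0"
    "\<And>n j u. j \<in> {4..n} \<Longrightarrow> gram3_pos u \<Longrightarrow> distr (spheres {4..n}) borel (\<lambda>y. chol u (fst (y j)))
     = density lborel (\<lambda>v. if pos_semidef (gram4 u v) then ennreal (c * det (gram4 u v) powr
         (-1/2)) else 0)"
proof -
  obtain c :: real where c: "c > 0" and dens: "distr (sphere_measure :: real4 measure) borel fst
      = density lborel (\<lambda>v. if norm v < 1 then ennreal (c / sqrt (1 - (norm v)\<^sup>2)) else 0)"
    by (rule sphere_measure_fst_density)
  show ?thesis
  proof (rule that[OF c])
    fix n j :: nat and u assume j: "j \<in> {4..n}" and u: "gram3_pos u"
    define b where "b = chol22 u * chol33 u"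
    have b: "b > 0" using chol_pos[OF u] by (simp add: b_def)
    define D where "D v = (if pos_semidef (gram4 u v) then ennreal (c * det (gram4 u v) powr
        (-1/2)) else 0)" for v
    define w where "w v = (if norm v < 1 then ennreal (c / sqrt (1 - (norm v)\<^sup>2)) else 0)"
        for v :: real3
    have [measurable]: "w \<in> borel_measurable borel" unfolding w_def by measurable
    \<comment> \<open>Measurability of \<open>D\<close> becomes visible once positivity is expressed
      by the norm of \<open>chol_inv u v\<close>.\<close>
    have "D v = (if norm (chol_inv u v) \<le> 1 then ennreal (c * ((b\<^sup>2 * (1 - (norm (chol_inv u
        v))\<^sup>2)) powr (-1/2))) else 0)" for v
      using det_gram4_chol[OF u, of "chol_inv u v"] pos_semidef_gram4_chol_iff[OF u, of "chol_inv
          u v"]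
      by (simp add: D_def chol_chol_inv[OF u] b_def)
    then have [measurable]: "D \<in> borel_measurable borel" by (subst measurable_cong) measurable
    have Dw: "ennreal b * D (chol u v) = w v" for v
    proof (cases "norm v < 1")
      case True
      then have v: "1 - (norm v)\<^sup>2 > 0" by (simp add: power_less_one_iff)
      have "(b\<^sup>2 * (1 - (norm v)\<^sup>2)) powr (-1/2) = 1 / (b * sqrt (1 - (norm v)\<^sup>2))"
        using b v by (simp add: powr_minus_divide powr_half_sqrt real_sqrt_mult)
      then show ?thesis
        using True b det_gram4_chol[OF u, of v] pos_semidef_gram4_chol_iff[OF u, of v]
        by (simp add: D_def w_def b_def[symmetric] ennreal_mult'[symmetric])
    next
      case False
      \<comment> \<open>On the unit sphere the matrix is positive semidefinite with determinant
        \<open>0\<close>; there \<open>powr\<close> returns \<open>0\<close>, in agreement with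
        \<open>w\<close>. Outside, positivity fails.\<close>
      then consider "norm v = 1" | "norm v > 1" by linarith
      then show ?thesis
        using det_gram4_chol[OF u, of v] pos_semidef_gram4_chol_iff[OF u, of v]
        by cases (simp_all add: D_def w_def)
    qed
    have [measurable]: "(\<lambda>y. y j) \<in> spheres {4..n} \<rightarrow>\<^sub>M borel" using j by simp
    have comp: "distr (spheres {4..n}) sphere_measure (\<lambda>y. y j) = sphere_measure"
      by (rule distr_PiM_component) (use j prob_space_sphere_measure in auto)
    show "distr (spheres {4..n}) borel (\<lambda>y. chol u (fst (y j))) = density lborel D"
    proof (rule measure_eqI)
      fix A assume "A \<in> sets (distr (spheres {4..n}) borel (\<lambda>y. chol u (fst (y j))))"
      then have [measurable]: "A \<in> sets borel" by simp
      have "emeasure (distr (spheres {4..n}) borel (\<lambda>y. chol u (fst (y j)))) A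
          = (\<integral>\<^sup>+y. indicator A (chol u (fst (y j))) \<partial>spheres {4..n})"
        by (subst nn_integral_distr[symmetric, of _ _ borel]) simp_all
      also have "\<dots> = (\<integral>\<^sup>+x. indicator A (chol u (fst x)) \<partial>distr (spheres {4..n}) sphere_measure
          (\<lambda>y. y j))"
        by (subst nn_integral_distr) simp_all
      also have "\<dots> = (\<integral>\<^sup>+v. indicator A (chol u v) \<partial>distr (sphere_measure :: real4 measure) borel
          fst)"
        unfolding comp by (subst nn_integral_distr) simp_all
      also have "\<dots> = (\<integral>\<^sup>+v. w v * indicator A (chol u v) \<partial>lborel)"
        unfolding dens w_def[symmetric] by (rule nn_integral_density) measurable
      also have "\<dots> = ennreal b * (\<integral>\<^sup>+v. D (chol u v) * indicator A (chol u v) \<partial>lborel)"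
        by (simp add: Dw[symmetric] nn_integral_cmult mult.assoc)
      also have "\<dots> = (\<integral>\<^sup>+t. D t * indicator A t \<partial>lborel)"
        by (subst nn_integral_chol[OF u]) (simp_all add: b_def)
      also have "\<dots> = emeasure (density lborel D) A"
        by (simp add: emeasure_density)
      finally show "emeasure (distr (spheres {4..n}) borel (\<lambda>y. chol u (fst (y j)))) A
          = emeasure (density lborel D) A" .
    qed simp
  qed
qed

text \<open>Off this null set positive semidefinite and positive definite mean the same. For fixed
  \<open>a\<close> and \<open>b\<close> the determinant is a quadratic polynomial in
  \<open>c\<close>, hence has at most two real zeros.\<close>

lemma AE_gram3_nondegenerate:
  "AE u in (lborel :: real3 measure). (fst u)\<^sup>2 \<noteq> 1 \<and> gram3_det u \<noteq> 0"
proof -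
  have "AE u in lborel \<Otimes>\<^sub>M (lborel :: (real \<times> real) measure). (fst u)\<^sup>2 \<noteq> 1 \<and> gram3_det u \<noteq> 0"
  proof (rule lborel_pair.AE_pair_measure)
    have "Measurable.pred borel (\<lambda>u. (fst u)\<^sup>2 \<noteq> 1 \<and> gram3_det u \<noteq> 0)" by measurable
    then show "{u \<in> space (lborel \<Otimes>\<^sub>M (lborel :: (real \<times> real) measure)). (fst u)\<^sup>2 \<noteq> 1
        \<and> gram3_det u \<noteq> 0}
      \<in> sets (lborel \<Otimes>\<^sub>M (lborel :: (real \<times> real) measure))"
      by (simp only: pred_def lborel_prod sets_lborel space_lborel space_borel)
    show "AE a in lborel. AE t in (lborel :: (real \<times> real) measure). (fst (a, t))\<^sup>2 \<noteq> 1
        \<and> gram3_det (a, t) \<noteq> 0"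
      using AE_lborel_singleton[of "1::real"] AE_lborel_singleton[of "-1::real"]
    proof eventually_elim
      fix a :: real assume "a \<noteq> 1" "a \<noteq> -1"
      then have a: "a\<^sup>2 \<noteq> 1" by (simp add: power2_eq_1_iff)
      have "AE t in (lborel \<Otimes>\<^sub>M lborel :: (real \<times> real) measure). (fst (a, t))\<^sup>2 \<noteq> 1
          \<and> gram3_det (a, t) \<noteq> 0"
      proof (rule lborel_pair.AE_pair_measure)
        have "Measurable.pred borel (\<lambda>t. (fst (a, t))\<^sup>2 \<noteq> 1 \<and> gram3_det (a, t) \<noteq> 0)" by measurable
        then show "{t \<in> space (lborel \<Otimes>\<^sub>M lborel :: (real \<times> real) measure). (fst (a, t))\<^sup>2 \<noteq> 1
            \<and> gram3_det (a, t) \<noteq> 0}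
          \<in> sets (lborel \<Otimes>\<^sub>M lborel :: (real \<times> real) measure)"
          by (simp only: pred_def lborel_prod sets_lborel space_lborel space_borel)
        show "AE b in lborel. AE c in lborel. (fst (a, b, c))\<^sup>2 \<noteq> 1 \<and> gram3_det (a, b, c) \<noteq> 0"
        proof (rule AE_I2)
          fix b :: real
          \<comment> \<open>The zeros in \<open>c\<close> can only be \<open>a * b + r\<close> and
            \<open>a * b - r\<close>.\<close>
          define r where "r = sqrt ((1 - a\<^sup>2) * (1 - b\<^sup>2))"
          show "AE c in lborel. (fst (a, b, c))\<^sup>2 \<noteq> 1 \<and> gram3_det (a, b, c) \<noteq> 0"
            using AE_lborel_singleton[of "a * b + r"] AE_lborel_singleton[of "a * b - r"]
          proof eventually_elim
            fix c assume c: "c \<noteq> a * b + r" "c \<noteq> a * b - r"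
            have "gram3_det (a, b, c) \<noteq> 0"
            proof
              assume "gram3_det (a, b, c) = 0"
              then have "(c - a * b)\<^sup>2 = (1 - a\<^sup>2) * (1 - b\<^sup>2)"
                by (simp add: gram3_det_def power2_eq_square algebra_simps)
              then have "\<bar>c - a * b\<bar> = r" unfolding r_def by (metis real_sqrt_abs)
              with c show False by linarith
            qed
            then show "(fst (a, b, c))\<^sup>2 \<noteq> 1 \<and> gram3_det (a, b, c) \<noteq> 0" using a by simp
          qed
        qed
      qed
      then show "AE t in (lborel :: (real \<times> real) measure). (fst (a, t))\<^sup>2 \<noteq> 1
          \<and> gram3_det (a, t) \<noteq> 0"
        by (simp only: lborel_prod)
    qed
  qed
  then show ?thesis by (simp only: lborel_prod)
qed

text \<open>For each fixed vector the quadratic form is affine in \<open>u\<close>, so the set is an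
  intersection of closed sets.\<close>

lemma pos_semidef_gram3_measurable: "{u. pos_semidef (gram3 u)} \<in> sets borel"
proof (rule borel_closed)
  have "{u. pos_semidef (gram3 u)} = (\<Inter>x. {u. 0 \<le> x \<bullet> (gram3 u *v x)})"
    by (auto simp: pos_semidef_gram3_iff)
  moreover have "closed {u. 0 \<le> x \<bullet> (gram3 u *v x)}" for x
  proof -
    have "x \<bullet> (gram3 u *v x) = (x$1)\<^sup>2 + (x$2)\<^sup>2 + (x$3)\<^sup>2 + 2 * fst u * x$1 * x$2
        + 2 * fst (snd u) * x$1 * x$3 + 2 * snd (snd u) * x$2 * x$3" for u
      using gram3_quadratic[of x "fst u" "fst (snd u)" "snd (snd u)"] by simp
    then show ?thesis by (simp only:) (intro closed_Collect_le continuous_intros)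
  qed
  ultimately show "closed {u. pos_semidef (gram3 u)}" by (simp add: closed_INT)
qed

lemma distr_upper3_density:
  obtains c :: real where "c > 0"
    "\<And>n. 3 \<le> n \<Longrightarrow> distr (spheres {1..n}) borel (upper3 inner_coeff)
      = density lborel (\<lambda>u. if pos_semidef (gram3 u) then ennreal c else 0)"
proof -
  obtain k :: ennreal where k: "k \<noteq> 0" "k \<noteq> \<top>" "\<And>n F. 3 \<le> n \<Longrightarrow> F \<in> borel_measurable borel \<Longrightarrow>
      (\<integral>\<^sup>+x. F (upper3 inner_coeff x) \<partial>spheres {1..n})
          = k * (\<integral>\<^sup>+u. F u * indicator {u. gram3_pos u} u \<partial>lborel)"
    by (rule nn_integral_upper3) blast
  obtain c where c: "k = ennreal c" "c > 0" using k(1,2)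
      by (cases k) (auto simp: ennreal_eq_0_iff not_le)
  note [measurable] = pos_semidef_gram3_measurable
  have m: "(\<lambda>u. if pos_semidef (gram3 u) then ennreal c else 0) \<in> borel_measurable borel"
    using pos_semidef_gram3_measurable by (intro measurable_If) (auto simp: pred_def)
  show ?thesis
  proof (rule that[OF c(2)], rule measure_eqI)
    fix n :: nat and A assume n: "3 \<le> n" and "A
        \<in> sets (distr (spheres {1..n}) borel (upper3 inner_coeff))"
    then have [measurable]: "A \<in> sets borel" by simp
    note [measurable] = upper3_measurable[OF n] m
    have "emeasure (distr (spheres {1..n}) borel (upper3 inner_coeff)) A
        = (\<integral>\<^sup>+x. indicator A (upper3 inner_coeff x) \<partial>spheres {1..n})"
      by (subst nn_integral_distr[symmetric, of _ _ borel]) simp_all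
    also have "\<dots> = (\<integral>\<^sup>+u. k * (indicator A u * indicator {u. gram3_pos u} u) \<partial>lborel)"
      by (subst k(3)[OF n]) (simp_all add: nn_integral_cmult)
    also have "\<dots> = (\<integral>\<^sup>+u. (if pos_semidef (gram3 u) then ennreal c else 0) * indicator A u \<partial>lborel)"
    proof (rule nn_integral_cong_AE, use AE_gram3_nondegenerate in eventually_elim)
      fix u :: real3 assume "(fst u)\<^sup>2 \<noteq> 1 \<and> gram3_det u \<noteq> 0"
      then have "gram3_pos u \<longleftrightarrow> pos_semidef (gram3 u)"
        using gram3_pos_imp_pos_semidef[of u] pos_semidef_imp_gram3_pos[of "fst u" "fst (snd u)"
            "snd (snd u)"] by auto
      then show "k * (indicator A u * indicator {u. gram3_pos u} u)
          = (if pos_semidef (gram3 u) then ennreal c else 0) * indicator A u"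
        by (simp add: c indicator_def)
    qed
    also have "\<dots> = emeasure (density lborel (\<lambda>u. if pos_semidef (gram3 u) then ennreal c else 0)) A"
      by (simp add: emeasure_density)
    finally show "emeasure (distr (spheres {1..n}) borel (upper3 inner_coeff)) A
      = emeasure (density lborel (\<lambda>u. if pos_semidef (gram3 u) then ennreal c else 0)) A" .
  qed simp
qed

section \<open>The fourth row and the remaining entries\<close>

text \<open>A fair sign with the discrete sigma-algebra, so that every map out of it into a whole
  space is measurable.\<close>

definition coin :: "real measure" where
  "coin = measure_pmf (pmf_of_set {-1, 1})"

abbreviation coins :: "nat set \<Rightarrow> (nat \<Rightarrow> real) measure" where
  "coins I \<equiv> PiM I (\<lambda>_. coin)"

lemma sets_coin [simp]: "sets coin = UNIV" and space_coin [simp]: "space coin = UNIV"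
  by (simp_all add: coin_def)

lemma measurable_from_coin [simp]: "measurable coin N = UNIV \<rightarrow> space N"
  by (simp add: coin_def)

lemma prob_space_coin: "prob_space coin"
  unfolding coin_def by (rule measure_pmf.prob_space_axioms)

lemma coin_component_measurable [measurable]:
  assumes "j \<in> I"
  shows "(\<lambda>x. x j) \<in> coins I \<rightarrow>\<^sub>M borel"
proof -
  have "(\<lambda>t::real. t) \<in> coin \<rightarrow>\<^sub>M borel" by simp
  from measurable_compose[OF measurable_component_singleton[OF assms] this] show ?thesis .
qed

lemma AE_coins:
  assumes "finite I"
  shows "AE e in coins I. \<forall>j\<in>I. e j = 1 \<or> e j = -1"
proof -
  have "AE t in coin. t = 1 \<or> t = -1"
    unfolding coin_def by (auto simp: AE_measure_pmf_iff)
  then show ?thesis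
    using assms prob_space_coin by (intro AE_finite_allI AE_PiM_component) auto
qed

lemma distr_coin_flip:
  assumes "d = 1 \<or> d = -1"
  shows "distr coin coin (\<lambda>t. d * t) = coin"
proof -
  have "map_pmf (\<lambda>t. d * t) (pmf_of_set {-1, 1}) = pmf_of_set {-1, 1 :: real}"
    using assms by (intro map_pmf_of_set_bij_betw) (auto simp: bij_betw_def inj_on_def)
  then have "distr coin (count_space UNIV) (\<lambda>t. d * t) = coin"
    by (simp only: coin_def map_pmf_rep_eq[symmetric])
  moreover have "distr coin coin (\<lambda>t. d * t) = distr coin (count_space UNIV) (\<lambda>t. d * t)"
    by (intro distr_cong) (simp_all add: coin_def)
  ultimately show ?thesis by simp
qed

lemma measure_coin:
  assumes "t = 1 \<or> t = -1"
  shows "measure coin {t} = 1 / 2"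
  using assms by (auto simp: coin_def measure_pmf_single)

lemma nn_integral_coins_flip:
  assumes I: "finite I" and d: "\<And>j. j \<in> I \<Longrightarrow> d j = 1 \<or> d j = (-1::real)"
    and F: "F \<in> borel_measurable (coins I)"
  shows "(\<integral>\<^sup>+e. F (\<lambda>j\<in>I. d j * e j) \<partial>coins I) = (\<integral>\<^sup>+e. F e \<partial>coins I)"
proof -
  have "(\<lambda>e. \<lambda>j\<in>I. d j * e j) \<in> coins I \<rightarrow>\<^sub>M coins I"
  proof (rule measurable_restrict)
    fix j assume j: "j \<in> I"
    have "(\<lambda>t::real. d j * t) \<in> coin \<rightarrow>\<^sub>M coin" by simp
    from measurable_compose[OF measurable_component_singleton[OF j] this]
    show "(\<lambda>e. d j * e j) \<in> coins I \<rightarrow>\<^sub>M coin" .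
  qed
  then have "(\<integral>\<^sup>+e. F (\<lambda>j\<in>I. d j * e j) \<partial>coins I)
     = (\<integral>\<^sup>+e. F e \<partial>distr (coins I) (coins I) (\<lambda>e. \<lambda>j\<in>I. d j * e j))"
    using F by (simp add: nn_integral_distr)
  also have "distr (coins I) (coins I) (\<lambda>e. \<lambda>j\<in>I. d j * e j)
      = PiM I (\<lambda>j. distr coin coin (\<lambda>t. d j * t))"
    by (rule distr_PiM_map[where f="\<lambda>j t. d j * t" and N="\<lambda>_. coin"]) (use I prob_space_coin in
        auto)
  also have "\<dots> = coins I"
    using d by (intro PiM_cong refl distr_coin_flip)
  finally show ?thesis .
qed

text \<open>The fourth point is the reference and keeps its sign; accordingly the signs are indexed
  from \<open>5\<close>.\<close>

definition flip_last :: "nat \<Rightarrow> (nat \<Rightarrow> real) \<Rightarrow> (nat \<Rightarrow> real4) \<Rightarrow> nat \<Rightarrow> real4" where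
  "flip_last n e y = (\<lambda>j\<in>{4..n}. (fst (y j), (if j = 4 then 1 else e j) * snd (y j)))"

text \<open>For fixed signs each point undergoes the identity or a reflection, both orthogonal. The
  resulting identity is averaged over the signs, and Fubini brings that average inside.\<close>

lemma nn_integral_spheres_flip_last:
  assumes F: "F \<in> borel_measurable (spheres {4..n})"
  shows "(\<integral>\<^sup>+y. F y \<partial>spheres {4..n})
      = (\<integral>\<^sup>+y. (\<integral>\<^sup>+e. F (flip_last n e y) \<partial>coins {5..n}) \<partial>spheres {4..n})"
proof -
  interpret E: prob_space "coins {5..n}" by (intro prob_space_PiM prob_space_coin)
  interpret Y: prob_space "spheres {4..n}" by (rule prob_space_spheres)
  interpret pair_sigma_finite "spheres {4..n}" "coins {5..n}" ..
  have flip: "(\<lambda>(y, e). flip_last n e y) \<in> spheres {4..n} \<Otimes>\<^sub>M coins {5..n} \<rightarrow>\<^sub>M spheres {4..n}"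
    unfolding flip_last_def split_beta'
  proof (rule measurable_restrict)
    fix j assume j: "j \<in> {4..n}"
    then have [measurable]: "(\<lambda>y. y j) \<in> spheres {4..n} \<rightarrow>\<^sub>M borel" by simp
    have [measurable]: "(\<lambda>x. if j = 4 then 1 else snd x j)
        \<in> spheres {4..n} \<Otimes>\<^sub>M coins {5..n} \<rightarrow>\<^sub>M borel"
    proof (cases "j = 4")
      case False
      then have [measurable]: "(\<lambda>e. e j) \<in> coins {5..n} \<rightarrow>\<^sub>M borel" using j by simp
      show ?thesis using False by simp
    qed simp
    show "(\<lambda>x. (fst (fst x j), (if j = 4 then 1 else snd x j) * snd (fst x j)))
        \<in> spheres {4..n} \<Otimes>\<^sub>M coins {5..n} \<rightarrow>\<^sub>M sphere_measure"
      unfolding measurable_sphere_measure by measurable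
  qed
  have "(\<integral>\<^sup>+y. F y \<partial>spheres {4..n}) = (\<integral>\<^sup>+e. (\<integral>\<^sup>+y. F y \<partial>spheres {4..n}) \<partial>coins {5..n})"
    by (simp add: E.emeasure_space_1)
  also have "\<dots> = (\<integral>\<^sup>+e. (\<integral>\<^sup>+y. F (flip_last n e y) \<partial>spheres {4..n}) \<partial>coins {5..n})"
  proof (rule nn_integral_cong_AE)
    have "AE e in coins {5..n}. \<forall>j\<in>{5..n}. e j = 1 \<or> e j = -1" by (rule AE_coins) simp
    then show "AE e in coins {5..n}. (\<integral>\<^sup>+y. F y \<partial>spheres {4..n})
        = (\<integral>\<^sup>+y. F (flip_last n e y) \<partial>spheres {4..n})"
    proof eventually_elim
      fix e :: "nat \<Rightarrow> real" assume e: "\<forall>j\<in>{5..n}. e j = 1 \<or> e j = -1"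
      have "orthogonal_transformation (\<lambda>x :: real4. (fst x, (if j = 4 then 1 else e j) * snd x))"
          if "j \<in> {4..n}" for j
      proof -
        define t where "t = (if j = 4 then 1 else e j)"
        have "t = 1 \<or> t = -1" using e that by (auto simp: t_def)
        then have "t * t = 1" by auto
        then have "t * a * (t * b) = a * b" for a b by (metis mult.assoc mult.commute mult_1)
        then show ?thesis
          unfolding orthogonal_transformation_def t_def[symmetric]
          by (auto intro!: linearI simp: inner_prod_def algebra_simps)
      qed
      from nn_integral_spheres_orthogonal[OF this _ F]
      show "(\<integral>\<^sup>+y. F y \<partial>spheres {4..n}) = (\<integral>\<^sup>+y. F (flip_last n e y) \<partial>spheres {4..n})"
        unfolding flip_last_def by simp
    qed
  qed
  also have "\<dots> = (\<integral>\<^sup>+y. (\<integral>\<^sup>+e. F (flip_last n e y) \<partial>coins {5..n}) \<partial>spheres {4..n})"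
    using measurable_compose[OF flip F] by (intro Fubini') (simp add: split_beta')
  finally show ?thesis .
qed

text \<open>The first three coordinates of the point \<open>j\<close> in the frame, as a function of
  the conditioning data alone. Through it the kernels depend on coefficients rather than on
  points.\<close>

definition local_vec :: "(nat \<times> nat \<Rightarrow> real) \<Rightarrow> nat \<Rightarrow> real3" where
  "local_vec w j = chol_inv (w (1, 2), w (1, 3), w (2, 3)) (w (1, j), w (2, j), w (3, j))"

definition sphere_height :: "real3 \<Rightarrow> real" where
  "sphere_height v = sqrt (1 - (norm v)\<^sup>2)"

lemma sphere_height_eq:
  assumes "norm y = 1"
  shows "sphere_height (fst y) = \<bar>snd y\<bar>"
proof -
  have "(norm (fst y))\<^sup>2 + (snd y)\<^sup>2 = 1"
    using assms norm_Pair[of "fst y" "snd y"] by simp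
  then have "1 - (norm (fst y))\<^sup>2 = (snd y)\<^sup>2" by linarith
  then show ?thesis by (simp add: sphere_height_def)
qed

text \<open>The number \<open>k\<close> of known rows is left open because the same reconstruction
  is used with three rows and with four.\<close>

lemma entries_place:
  fixes y :: "nat \<Rightarrow> real4" and w :: "nat \<times> nat \<Rightarrow> real"
  assumes n: "4 \<le> n" and u: "gram3_pos u" and k: "3 \<le> k"
  defines "w \<equiv> entries inner_coeff (first_rows n k) (place n u y)"
  shows "(w (1, 2), w (1, 3), w (2, 3)) = u"
    and "j \<in> {4..n} \<Longrightarrow> local_vec w j = fst (y j)"
proof -
  have w: "w (i, j) = inner_coeff i j (place n u y)" if "1 \<le> i" "i \<le> 3" "i < j" "j \<le> n" for i j
    using that k by (simp add: w_def entries_def first_rows_def)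
  show 1: "(w (1, 2), w (1, 3), w (2, 3)) = u"
    using upper3_place[of n u y] n u by (simp add: upper3_def w)
  assume j: "j \<in> {4..n}"
  then have "(w (1, j), w (2, j), w (3, j)) = chol u (fst (y j))"
    using col_place[OF j, of u y] by (simp add: col_def w)
  then show "local_vec w j = fst (y j)"
    unfolding local_vec_def 1 by (simp add: chol_inv_chol[OF u])
qed

lemma real_families_component_measurable:
  "p \<in> I \<Longrightarrow> (\<lambda>w. w p) \<in> real_families I \<rightarrow>\<^sub>M borel"
  by (rule measurable_component_singleton)

lemma local_vec_measurable:
  assumes "3 \<le> k" "j \<in> {4..n}"
  shows "(\<lambda>w. local_vec w j) \<in> real_families (first_rows n k) \<rightarrow>\<^sub>M borel"
  unfolding local_vec_def using assms
  by (intro chol_inv_measurable borel_measurable_Pair real_families_component_measurable)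
     (auto simp: first_rows_def)

lemma sphere_height_measurable [measurable]: "sphere_height \<in> borel_measurable borel"
  unfolding sphere_height_def by measurable

lemma entries_measurable:
  assumes "\<And>i j. (i, j) \<in> I \<Longrightarrow> i \<in> {1..n} \<and> j \<in> {1..n}"
  shows "entries inner_coeff I \<in> spheres {1..n} \<rightarrow>\<^sub>M real_families I"
  unfolding entries_def
proof (rule measurable_restrict)
  fix p assume "p \<in> I"
  then show "(\<lambda>x. case p of (i, j) \<Rightarrow> inner_coeff i j x) \<in> spheres {1..n} \<rightarrow>\<^sub>M borel"
    using assms by (cases p) (auto intro: inner_coeff_measurable)
qed

lemma orth_invariant_entries:
  assumes "\<And>i j. (i, j) \<in> I \<Longrightarrow> i \<in> {1..n} \<and> j \<in> {1..n}"
  shows "orth_invariant n (entries inner_coeff I)"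
  unfolding orth_invariant_def entries_def
  using assms by (auto intro!: restrict_ext orth_invariant_inner_coeff)

lemma first_rows_bounds: "(i, j) \<in> first_rows n k \<Longrightarrow> i \<in> {1..n} \<and> j \<in> {1..n}"
  by (auto simp: first_rows_def)

lemma other_entries_bounds: "(i, j) \<in> other_entries n \<Longrightarrow> i \<in> {1..n} \<and> j \<in> {1..n}"
  by (auto simp: other_entries_def)

text \<open>The inner product of two points of the sphere whose last coordinates are known up to
  sign; \<open>e j\<close> plays the sign of the product of these two coordinates.\<close>

definition fourth_row :: "nat \<Rightarrow> (nat \<times> nat \<Rightarrow> real) \<Rightarrow> (nat \<Rightarrow> real) \<Rightarrow> nat \<Rightarrow> real" where
  "fourth_row n w e = (\<lambda>j\<in>{5..n}. local_vec w 4 \<bullet> local_vec w j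
     + e j * (sphere_height (local_vec w 4) * sphere_height (local_vec w j)))"

lemma fourth_row_measurable:
  "(\<lambda>(w, e). fourth_row n w e)
    \<in> real_families (first_rows n 3) \<Otimes>\<^sub>M coins {5..n} \<rightarrow>\<^sub>M (\<Pi>\<^sub>M j\<in>{5..n}. borel)"
  unfolding fourth_row_def split_beta'
proof (rule measurable_restrict)
  fix j assume j: "j \<in> {5..n}"
  then have [measurable]: "(\<lambda>e. e j) \<in> coins {5..n} \<rightarrow>\<^sub>M borel"
    "(\<lambda>w. local_vec w j) \<in> real_families (first_rows n 3) \<rightarrow>\<^sub>M borel"
    "(\<lambda>w. local_vec w 4) \<in> real_families (first_rows n 3) \<rightarrow>\<^sub>M borel"
    by (auto intro: local_vec_measurable)
  show "(\<lambda>x. local_vec (fst x) 4 \<bullet> local_vec (fst x) j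
     + snd x j * (sphere_height (local_vec (fst x) 4) * sphere_height (local_vec (fst x) j)))
     \<in> real_families (first_rows n 3) \<Otimes>\<^sub>M coins {5..n} \<rightarrow>\<^sub>M borel" by measurable
qed

lemma frame_snd [simp]: "snd (frame u i) = 0"
  by (simp add: frame_def)

text \<open>Each of these pairs contains a frame vector, whose last coordinate is
  \<open>0\<close>.\<close>

lemma entries_flip_last:
  assumes n: "4 \<le> n"
  shows "entries inner_coeff (first_rows n 3) (place n u (flip_last n e y))
    = entries inner_coeff (first_rows n 3) (place n u y)"
  unfolding entries_def
proof (rule restrict_ext, clarify)
  fix i j assume "(i, j) \<in> first_rows n 3"
  then have ij: "1 \<le> i" "i \<le> 3" "i < j" "j \<le> n" by (auto simp: first_rows_def)
  show "inner_coeff i j (place n u (flip_last n e y)) = inner_coeff i j (place n u y)"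
    using ij by (auto simp: inner_coeff_def place_def inner_prod_def flip_last_def)
qed

text \<open>The law of the points is unchanged if the last coordinates $h_j$, $j \ge 5$, are multiplied by
  independent fair signs. These leave the first three rows alone and randomise the signs of the
  products $h_4 h_j$, whose absolute values are determined by the first three rows.\<close>

lemma cond_law_fourth_row:
  assumes n: "5 \<le> n"
  shows "cond_law (spheres {1..n}) (real_families (first_rows n 3)) (entries inner_coeff
      (first_rows n 3))
    (\<Pi>\<^sub>M j\<in>{5..n}. borel) (\<lambda>x. \<lambda>j\<in>{5..n}. inner_coeff 4 j x)
    (\<lambda>w. distr (coins {5..n}) (\<Pi>\<^sub>M j\<in>{5..n}. borel) (fourth_row n w))"
proof (rule cond_law_distrI)
  let ?X = "entries inner_coeff (first_rows n 3)" and ?Y = "\<lambda>x. \<lambda>j\<in>{5..n}. inner_coeff 4 j x"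
  let ?L = "\<Pi>\<^sub>M j\<in>{5..n}. (borel :: real measure)"
  have n3: "3 \<le> n" "4 \<le> n" using n by auto
  show X: "?X \<in> spheres {1..n} \<rightarrow>\<^sub>M real_families (first_rows n 3)"
    by (rule entries_measurable) (rule first_rows_bounds)
  show Y: "?Y \<in> spheres {1..n} \<rightarrow>\<^sub>M ?L"
    by (intro measurable_restrict inner_coeff_measurable) auto
  show "prob_space (coins {5..n})" by (intro prob_space_PiM prob_space_coin)
  interpret E: prob_space "coins {5..n}" by fact
  show "(\<lambda>(w, e). fourth_row n w e) \<in> real_families (first_rows n 3) \<Otimes>\<^sub>M coins {5..n} \<rightarrow>\<^sub>M ?L"
    by (rule fourth_row_measurable)
  fix A B assume A [measurable]: "A \<in> sets (real_families (first_rows n 3))"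
      and B [measurable]: "B \<in> sets ?L"
  note [measurable] = X Y
  let ?J = "\<lambda>w. \<integral>\<^sup>+e. indicator B (fourth_row n w e) \<partial>coins {5..n}"
  have J [measurable]: "?J \<in> borel_measurable (real_families (first_rows n 3))"
    using measurable_compose[OF fourth_row_measurable borel_measurable_indicator[OF B]]
    by (intro E.borel_measurable_nn_integral) (simp add: split_beta')
  let ?F = "\<lambda>x. indicator A (?X x) * indicator B (?Y x) :: ennreal"
  let ?G = "\<lambda>x. indicator A (?X x) * ?J (?X x)"
  have F: "?F \<in> borel_measurable (spheres {1..n})" and G: "?G \<in> borel_measurable (spheres {1..n})"
    by measurable
  have "orth_invariant n ?X" by (rule orth_invariant_entries) (rule first_rows_bounds)
  moreover have "orth_invariant n ?Y"
    unfolding orth_invariant_def by (auto intro!: restrict_ext orth_invariant_inner_coeff)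
  ultimately have inv: "orth_invariant n ?F" "orth_invariant n ?G"
    by (simp_all add: orth_invariant_def)
  have "(\<integral>\<^sup>+y. ?F (place n u y) \<partial>spheres {4..n}) = (\<integral>\<^sup>+y. ?G (place n u y) \<partial>spheres {4..n})"
    if u: "gram3_pos u" for u
  proof -
    have pm: "place n u \<in> spheres {4..n} \<rightarrow>\<^sub>M spheres {1..n}"
      using measurable_compose[OF measurable_Pair1' place_measurable, of u] by simp
    have "(\<integral>\<^sup>+y. ?F (place n u y) \<partial>spheres {4..n})
        = (\<integral>\<^sup>+y. (\<integral>\<^sup>+e. ?F (place n u (flip_last n e y)) \<partial>coins {5..n}) \<partial>spheres {4..n})"
      by (rule nn_integral_spheres_flip_last) (rule measurable_compose[OF pm F])
    also have "\<dots> = (\<integral>\<^sup>+y. ?G (place n u y) \<partial>spheres {4..n})"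
    proof (rule nn_integral_cong_AE)
      have "AE y in spheres {4..n}. \<forall>j\<in>{4..n}. norm (y j) = 1" by (rule AE_spheres_norm) simp
      then show "AE y in spheres {4..n}. (\<integral>\<^sup>+e. ?F (place n u (flip_last n e y)) \<partial>coins {5..n})
          = ?G (place n u y)"
      proof eventually_elim
        fix y :: "nat \<Rightarrow> real4" assume y: "\<forall>j\<in>{4..n}. norm (y j) = 1"
        define w where "w = ?X (place n u y)"
        have loc: "local_vec w j = fst (y j)" if "j \<in> {4..n}" for j
          unfolding w_def using that n u by (intro entries_place(2)) auto
        \<comment> \<open>A sign of h_4 h_j, set to \<open>1\<close> when the product vanishes so
          that it is always an admissible coin value.\<close>
        define d where "d j = (if snd (y 4) * snd (y j) < 0 then -1 else 1 :: real)" for j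
        have row: "?Y (place n u (flip_last n e y)) = fourth_row n w (\<lambda>j\<in>{5..n}. d j * e j)" for e
          unfolding fourth_row_def
        proof (rule restrict_ext)
          fix j assume j: "j \<in> {5..n}"
          have h: "sphere_height (local_vec w 4) = \<bar>snd (y 4)\<bar>" "sphere_height (local_vec w j)
              = \<bar>snd (y j)\<bar>"
            using y j n by (simp_all add: loc sphere_height_eq)
          have "d j * (\<bar>snd (y 4)\<bar> * \<bar>snd (y j)\<bar>) = snd (y 4) * snd (y j)"
            by (simp add: d_def abs_mult[symmetric])
          then have "(d j * e j) * (sphere_height (local_vec w 4) * sphere_height (local_vec w j))
              = snd (y 4) * (e j * snd (y j))"
            unfolding h by (metis mult.assoc mult.commute)
          moreover have "(\<lambda>j\<in>{5..n}. d j * e j) j = d j * e j" using j by simp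
          ultimately have "(\<lambda>j\<in>{5..n}. d j * e j) j * (sphere_height (local_vec w 4) *
              sphere_height (local_vec w j))
              = snd (y 4) * (e j * snd (y j))" by (simp only:)
          then show "inner_coeff 4 j (place n u (flip_last n e y)) = local_vec w 4 \<bullet> local_vec w j
            + (\<lambda>j\<in>{5..n}. d j * e j) j * (sphere_height (local_vec w 4) * sphere_height (local_vec
                w j))"
            by (simp only:) (use j n in \<open>simp add: inner_coeff_def place_def flip_last_def loc
                inner_prod_def\<close>)
        qed
        have Bm: "(\<lambda>e. indicator B (fourth_row n w e) :: ennreal) \<in> borel_measurable (coins {5..n})"
          using measurable_compose[OF measurable_Pair1'
              measurable_compose[OF fourth_row_measurable borel_measurable_indicator[OF B]], of w]
          by (simp add: w_def entries_def space_PiM)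
        \<comment> \<open>Multiplying fair signs by fixed ones does not change their law. This
          removes \<open>d\<close>, the only quantity here not determined by
          \<open>w\<close>.\<close>
        have dm: "(\<integral>\<^sup>+e. indicator B (fourth_row n w (\<lambda>j\<in>{5..n}. d j * e j)) \<partial>coins {5..n}) = ?J w"
          by (rule nn_integral_coins_flip[OF _ _ Bm]) (auto simp: d_def)
        have "(\<lambda>e. \<lambda>j\<in>{5..n}. d j * e j) \<in> coins {5..n} \<rightarrow>\<^sub>M coins {5..n}"
        proof (rule measurable_restrict)
          fix j assume j: "j \<in> {5..n}"
          have "(\<lambda>t::real. d j * t) \<in> coin \<rightarrow>\<^sub>M coin" by simp
          from measurable_compose[OF measurable_component_singleton[OF j] this]
          show "(\<lambda>e. d j * e j) \<in> coins {5..n} \<rightarrow>\<^sub>M coin" .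
        qed
        note m = measurable_compose[OF this Bm]
        show "(\<integral>\<^sup>+e. ?F (place n u (flip_last n e y)) \<partial>coins {5..n}) = ?G (place n u y)"
          unfolding row entries_flip_last[OF n3(2)] w_def[symmetric] nn_integral_cmult[OF m] dm ..
      qed
    qed
    finally show ?thesis .
  qed
  then show "(\<integral>\<^sup>+x. ?F x \<partial>spheres {1..n}) = (\<integral>\<^sup>+x. ?G x \<partial>spheres {1..n})"
    unfolding nn_integral_orth_invariant[OF n3(1) F inv(1)] nn_integral_orth_invariant[OF n3(1) G
        inv(2)]
    by (intro nn_integral_cong_AE) (use AE_gram3_pos_distr[OF n3(1)] in eventually_elim, simp)
qed

lemma distr_fourth_row:
  "distr (coins {5..n}) (\<Pi>\<^sub>M j\<in>{5..n}. borel) (fourth_row n w)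
    = (\<Pi>\<^sub>M j\<in>{5..n}. distr coin borel (\<lambda>t. local_vec w 4 \<bullet> local_vec w j
        + t * (sphere_height (local_vec w 4) * sphere_height (local_vec w j))))"
  unfolding fourth_row_def
  by (rule distr_PiM_map[where N="\<lambda>_. borel" and f="\<lambda>j t. local_vec w 4 \<bullet> local_vec w j
        + t * (sphere_height (local_vec w 4) * sphere_height (local_vec w j))"]) (auto
            simp: prob_space_coin)

lemma indep_vars_fourth_row:
  assumes "5 \<le> n"
  shows "prob_space.indep_vars (distr (coins {5..n}) (\<Pi>\<^sub>M j\<in>{5..n}. borel) (fourth_row n w))
    (\<lambda>j. borel) (\<lambda>j z. z j) {5..n}"
  unfolding distr_fourth_row
  using assms by (intro indep_vars_PiM_coordinates prob_space.prob_space_distr prob_space_coin) auto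

text \<open>The coordinate \<open>j\<close> is the image of a coin under t -> p + t q, where q is
  the product of the two heights. It is nonzero, so the two values differ; with mass 1/2 each they
  exhaust the law.\<close>

lemma fourth_row_two_values:
  assumes j: "j \<in> {5..n}" and pos: "sphere_height (local_vec w 4) \<noteq> 0" "sphere_height (local_vec w
      j) \<noteq> 0"
  defines "K \<equiv> distr (coins {5..n}) (\<Pi>\<^sub>M j\<in>{5..n}. borel) (fourth_row n w)"
  shows "\<exists>a b. a \<noteq> b \<and> measure K {z \<in> space K. z j = a} = 1/2 \<and> measure K {z \<in> space K. z j = b}
      = 1/2"
proof -
  define p q where "p = local_vec w 4 \<bullet> local_vec w j" and "q
      = sphere_height (local_vec w 4) * sphere_height (local_vec w j)"
  define M where "M j = distr coin borel (\<lambda>t. local_vec w 4 \<bullet> local_vec w j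
        + t * (sphere_height (local_vec w 4) * sphere_height (local_vec w j)))" for j
  have q: "q \<noteq> 0" using pos by (simp add: q_def)
  have K: "K = PiM {5..n} M" unfolding K_def distr_fourth_row M_def ..
  have half: "measure K {z \<in> space K. z j = p + t * q} = 1 / 2" if t: "t = 1 \<or> t = -1" for t
  proof -
    have "measure K {z \<in> space K. z j = p + t * q} = measure (distr K (M j) (\<lambda>z. z j)) {p + t * q}"
      unfolding K
      by (subst measure_distr[OF measurable_component_singleton[OF j]]) (auto
          simp: M_def vimage_def Int_def conj_commute)
    also have "distr K (M j) (\<lambda>z. z j) = M j"
      unfolding K using j
      by (intro distr_PiM_component) (auto simp: M_def intro!: prob_space.prob_space_distr
          prob_space_coin)
    also have "measure (M j) {p + t * q}
        = measure coin ((\<lambda>s. p + s * q) -` {p + t * q} \<inter> space coin)"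
      unfolding M_def p_def[symmetric] q_def[symmetric] by (rule measure_distr) auto
    also have "(\<lambda>s. p + s * q) -` {p + t * q} \<inter> space coin = {t}"
      using q by auto
    finally show ?thesis using measure_coin[OF t] by simp
  qed
  show ?thesis
    using half[of 1] half[of "-1"] q by (intro exI[of _ "p + 1 * q"] exI[of _ "p + (-1) * q"]) auto
qed

text \<open>The projected law has a density that vanishes outside the open ball. For points of the
  sphere this says that the last coordinate is nonzero.\<close>

lemma AE_spheres_fst_norm:
  assumes "finite I"
  shows "AE y in spheres I. \<forall>j\<in>I. norm (fst (y j)) < 1"
proof (intro AE_finite_allI assms AE_PiM_component prob_space_sphere_measure)
  obtain c :: real where dens: "distr (sphere_measure :: real4 measure) borel fst
      = density lborel (\<lambda>v. if norm v < 1 then ennreal (c / sqrt (1 - (norm v)\<^sup>2)) else 0)"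
    by (rule sphere_measure_fst_density)
  have "AE v in distr (sphere_measure :: real4 measure) borel fst. norm v < 1"
    unfolding dens by (subst AE_density) (auto split: if_splits)
  then show "AE x in (sphere_measure :: real4 measure). norm (fst x) < 1"
    by (subst (asm) AE_distr_iff) simp_all
qed

lemma sphere_height_pos: "norm v < 1 \<Longrightarrow> sphere_height v > 0"
  by (simp add: sphere_height_def power_less_one_iff)

text \<open>This is the general position under which the two variants of an entry of the fourth row
  are really different.\<close>

lemma AE_height_local_vec:
  assumes n: "4 \<le> n" and k: "3 \<le> k"
  shows "AE w in distr (spheres {1..n}) (real_families (first_rows n k)) (entries inner_coeff
      (first_rows n k)).
    \<forall>j\<in>{4..n}. sphere_height (local_vec w j) \<noteq> 0"
proof -
  let ?X = "entries inner_coeff (first_rows n k)"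
  have X [measurable]: "?X \<in> spheres {1..n} \<rightarrow>\<^sub>M real_families (first_rows n k)"
    by (rule entries_measurable) (rule first_rows_bounds)
  have pm: "Measurable.pred (real_families (first_rows n k)) (\<lambda>w. \<forall>j\<in>{4..n}. sphere_height
      (local_vec w j) \<noteq> 0)"
  proof (rule pred_intros_finite(3))
    fix j assume "j \<in> {4..n}"
    then have [measurable]: "(\<lambda>w. local_vec w j) \<in> real_families (first_rows n k) \<rightarrow>\<^sub>M borel"
      by (rule local_vec_measurable[OF k])
    show "Measurable.pred (real_families (first_rows n k)) (\<lambda>w. sphere_height (local_vec w j) \<noteq> 0)"
      by measurable
  qed simp
  have "AE x in spheres {1..n}. \<forall>j\<in>{4..n}. sphere_height (local_vec (?X x) j) \<noteq> 0"
  proof (rule AE_orth_invariant)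
    show "3 \<le> n" using n by simp
    show "Measurable.pred (spheres {1..n}) (\<lambda>x. \<forall>j\<in>{4..n}. sphere_height (local_vec (?X x) j) \<noteq> 0)"
      by (rule measurable_compose[OF X pm])
    have "orth_invariant n ?X" by (rule orth_invariant_entries) (rule first_rows_bounds)
    then show "orth_invariant n (\<lambda>x. \<forall>j\<in>{4..n}. sphere_height (local_vec (?X x) j) \<noteq> 0)"
      by (simp add: orth_invariant_def)
    fix u assume u: "gram3_pos u"
    have "AE y in spheres {4..n}. \<forall>j\<in>{4..n}. norm (fst (y j)) < 1"
        by (rule AE_spheres_fst_norm) simp
    then show "AE y in spheres {4..n}. \<forall>j\<in>{4..n}. sphere_height (local_vec (?X (place n u y)) j) \<noteq>
        0"
    proof eventually_elim
      fix y :: "nat \<Rightarrow> real4" assume y: "\<forall>j\<in>{4..n}. norm (fst (y j)) < 1"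
      show "\<forall>j\<in>{4..n}. sphere_height (local_vec (?X (place n u y)) j) \<noteq> 0"
      proof
        fix j assume j: "j \<in> {4..n}"
        then have "sphere_height (fst (y j)) > 0" using y by (intro sphere_height_pos) auto
        then show "sphere_height (local_vec (?X (place n u y)) j) \<noteq> 0"
          by (simp add: entries_place(2)[OF n u k j])
      qed
    qed
  qed
  then show ?thesis
    using pm by (subst AE_distr_iff) (auto simp: pred_def)
qed

text \<open>The last coordinates satisfy $h_i h_j = (h_4 h_i)(h_4 h_j) / h_4^2$.\<close>

definition remaining_entries :: "nat \<Rightarrow> (nat \<times> nat \<Rightarrow> real) \<Rightarrow> nat \<times> nat \<Rightarrow> real" where
  "remaining_entries n w = (\<lambda>p\<in>other_entries n. local_vec w (fst p) \<bullet> local_vec w (snd p)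
     + (w (4, fst p) - local_vec w 4 \<bullet> local_vec w (fst p)) * (w (4, snd p) - local_vec w 4 \<bullet>
         local_vec w (snd p))
       / (1 - (norm (local_vec w 4))\<^sup>2))"

lemma remaining_entries_measurable:
  "remaining_entries n \<in> real_families (first_rows n 4) \<rightarrow>\<^sub>M real_families (other_entries n)"
  unfolding remaining_entries_def
proof (rule measurable_restrict)
  fix p assume "p \<in> other_entries n"
  then have p: "fst p \<in> {5..n}" "snd p \<in> {5..n}" by (auto simp: other_entries_def)
  have [measurable]: "(\<lambda>w. local_vec w j) \<in> real_families (first_rows n 4) \<rightarrow>\<^sub>M borel" if "j
      = 4 \<or> j = fst p \<or> j = snd p" for j
    using p that by (intro local_vec_measurable) auto
  have [measurable]: "(\<lambda>w. w (4, fst p)) \<in> real_families (first_rows n 4) \<rightarrow>\<^sub>M borel"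
    "(\<lambda>w. w (4, snd p)) \<in> real_families (first_rows n 4) \<rightarrow>\<^sub>M borel"
    using p by (auto intro!: real_families_component_measurable simp: first_rows_def)
  show "(\<lambda>w. local_vec w (fst p) \<bullet> local_vec w (snd p)
     + (w (4, fst p) - local_vec w 4 \<bullet> local_vec w (fst p)) * (w (4, snd p) - local_vec w 4 \<bullet>
         local_vec w (snd p))
       / (1 - (norm (local_vec w 4))\<^sup>2)) \<in> real_families (first_rows n 4) \<rightarrow>\<^sub>M borel"
    by measurable
qed

lemma finite_other_entries: "finite (other_entries n)"
  by (rule finite_subset[of _ "{1..n} \<times> {1..n}"]) (auto simp: other_entries_def)

text \<open>In standard position subtracting the known part of s_4j leaves h_4 h_j, and 1 - |v_4|^2
  is h_4^2, which is almost surely nonzero. Both sides depend on inner products only, so the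
  identity extends to all configurations.\<close>

lemma AE_remaining_entries:
  assumes n: "5 \<le> n"
  shows "AE x in spheres {1..n}. entries inner_coeff (other_entries n) x
    = remaining_entries n (entries inner_coeff (first_rows n 4) x)"
proof -
  let ?X = "entries inner_coeff (first_rows n 4)" and ?Y = "entries inner_coeff (other_entries n)"
  have X: "?X \<in> spheres {1..n} \<rightarrow>\<^sub>M real_families (first_rows n 4)"
    by (rule entries_measurable) (rule first_rows_bounds)
  have Y: "?Y \<in> spheres {1..n} \<rightarrow>\<^sub>M real_families (other_entries n)"
    by (rule entries_measurable) (rule other_entries_bounds)
  have "AE x in spheres {1..n}. \<forall>p\<in>other_entries n. ?Y x p = remaining_entries n (?X x) p"
  proof (rule AE_orth_invariant)
    show "3 \<le> n" using n by simp
    show "Measurable.pred (spheres {1..n}) (\<lambda>x. \<forall>p\<in>other_entries n. ?Y x p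
        = remaining_entries n (?X x) p)"
    proof (rule pred_intros_finite(3)[OF finite_other_entries])
      fix p assume p: "p \<in> other_entries n"
      have m: "(\<lambda>x. ?Y x p) \<in> spheres {1..n} \<rightarrow>\<^sub>M borel"
        "(\<lambda>x. remaining_entries n (?X x) p) \<in> spheres {1..n} \<rightarrow>\<^sub>M borel"
        by (rule measurable_compose[OF Y real_families_component_measurable[OF p]],
            rule measurable_compose[OF measurable_compose[OF X remaining_entries_measurable]
                real_families_component_measurable[OF p]])
      show "Measurable.pred (spheres {1..n}) (\<lambda>x. ?Y x p = remaining_entries n (?X x) p)"
        unfolding pred_def by (rule borel_measurable_eq[OF m])
    qed
    have "orth_invariant n ?X" by (rule orth_invariant_entries) (rule first_rows_bounds)
    moreover have "orth_invariant n ?Y" by (rule orth_invariant_entries) (rule other_entries_bounds)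
    ultimately show "orth_invariant n (\<lambda>x. \<forall>p\<in>other_entries n. ?Y x p
        = remaining_entries n (?X x) p)"
      by (simp add: orth_invariant_def)
    fix u assume u: "gram3_pos u"
    have "AE y in spheres {4..n}. \<forall>j\<in>{4..n}. norm (fst (y j)) < 1"
        by (rule AE_spheres_fst_norm) simp
    moreover have "AE y in spheres {4..n}. \<forall>j\<in>{4..n}. norm (y j) = 1" by (rule AE_spheres_norm) simp
    ultimately show "AE y in spheres {4..n}. \<forall>p\<in>other_entries n. ?Y (place n u y) p
        = remaining_entries n (?X (place n u y)) p"
    proof eventually_elim
      fix y :: "nat \<Rightarrow> real4"
      assume y: "\<forall>j\<in>{4..n}. norm (fst (y j)) < 1" "\<forall>j\<in>{4..n}. norm (y j) = 1"
      define w where "w = ?X (place n u y)"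
      have loc: "local_vec w j = fst (y j)" if "j \<in> {4..n}" for j
        unfolding w_def using that n u by (intro entries_place(2)) auto
      have row: "w (4, j) - local_vec w 4 \<bullet> local_vec w j = snd (y 4) * snd (y j)" if "j \<in> {5..n}"
          for j
        using that n by (simp add: loc) (simp add: w_def entries_def first_rows_def
            inner_coeff_def place_def inner_prod_def)
      have "(norm (fst (y 4)))\<^sup>2 + (snd (y 4))\<^sup>2 = 1"
        using y(2) n norm_Pair[of "fst (y 4)" "snd (y 4)"] by simp
      then have h: "1 - (norm (local_vec w 4))\<^sup>2 = (snd (y 4))\<^sup>2" using n by (simp add: loc)
      have "norm (fst (y 4)) < 1" using y(1) n by simp
      then have "(norm (local_vec w 4))\<^sup>2 < 1" using n by (simp add: loc power_less_one_iff)
      then have nz: "snd (y 4) \<noteq> 0" using h by auto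
      show "\<forall>p\<in>other_entries n. ?Y (place n u y) p = remaining_entries n (?X (place n u y)) p"
      proof
        fix p assume p: "p \<in> other_entries n"
        obtain i j where ij: "p = (i, j)" "i \<in> {5..n}" "j \<in> {5..n}"
          using p by (auto simp: other_entries_def)
        have "(snd (y 4) * snd (y i)) * (snd (y 4) * snd (y j)) / (snd (y 4))\<^sup>2
            = snd (y i) * snd (y j)"
          using nz by (simp add: power2_eq_square)
        then have "remaining_entries n w p = y i \<bullet> y j"
          using p ij by (simp add: remaining_entries_def row h) (simp add: loc inner_prod_def)
        moreover have "?Y (place n u y) p = y i \<bullet> y j"
          using p ij by (simp add: entries_def inner_coeff_def place_def)
        ultimately show "?Y (place n u y) p = remaining_entries n (?X (place n u y)) p"
          by (simp add: w_def)
      qed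
    qed
  qed
  \<comment> \<open>Agreement on the index set is equality, as both families are
    \<open>undefined\<close> elsewhere.\<close>
  then show ?thesis
    by eventually_elim (auto simp: entries_def remaining_entries_def fun_eq_iff)
qed

section \<open>Dirac kernels and transfer to the given random matrices\<close>

lemma cond_law_return:
  assumes X: "X \<in> M \<rightarrow>\<^sub>M N" and Y: "Y \<in> M \<rightarrow>\<^sub>M L" and f: "f \<in> N \<rightarrow>\<^sub>M L"
    and eq: "AE x in M. Y x = f (X x)"
  shows "cond_law M N X L Y (\<lambda>x. return L (f x))"
  unfolding cond_law_def
proof (intro conjI ballI)
  note [measurable] = X Y f
  show "(\<lambda>x. return L (f x)) \<in> N \<rightarrow>\<^sub>M prob_algebra L" by measurable
  fix A B assume [measurable]: "A \<in> sets N" "B \<in> sets L"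
  have "emeasure M {\<omega>\<in>space M. X \<omega> \<in> A \<and> Y \<omega> \<in> B} = (\<integral>\<^sup>+\<omega>. indicator {\<omega>\<in>space M. X \<omega> \<in> A \<and> Y \<omega>
      \<in> B} \<omega> \<partial>M)"
    by (subst nn_integral_indicator) simp_all
  also have "\<dots> = (\<integral>\<^sup>+\<omega>. indicator B (f (X \<omega>)) * indicator A (X \<omega>) \<partial>M)"
    by (rule nn_integral_cong_AE, use eq AE_space in eventually_elim) (auto simp: indicator_def)
  also have "\<dots> = (\<integral>\<^sup>+x\<in>A. indicator B (f x) \<partial>distr M N X)"
    by (subst nn_integral_distr) simp_all
  finally show "emeasure M {\<omega>\<in>space M. X \<omega> \<in> A \<and> Y \<omega> \<in> B}
      = (\<integral>\<^sup>+x\<in>A. emeasure (return L (f x)) B \<partial>distr M N X)"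
    by simp
qed (use X Y in auto)

text \<open>A conditional law depends only on the joint law of the two variables, so it can be
  computed on the model space \<open>S\<close> that carries the law of \<open>V\<close>.\<close>

lemma cond_law_compose:
  assumes V: "V \<in> M \<rightarrow>\<^sub>M S" "distr M S V = S" and law: "cond_law S N \<xi> L \<psi> K"
    and X: "\<And>\<omega>. \<omega> \<in> space M \<Longrightarrow> X \<omega> = \<xi> (V \<omega>)" and Y: "\<And>\<omega>. \<omega> \<in> space M \<Longrightarrow> Y \<omega> = \<psi> (V \<omega>)"
  shows "cond_law M N X L Y K" "distr M N X = distr S N \<xi>"
proof -
  have xi: "\<xi> \<in> S \<rightarrow>\<^sub>M N" and psi: "\<psi> \<in> S \<rightarrow>\<^sub>M L" and K: "K \<in> N \<rightarrow>\<^sub>M prob_algebra L"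
    and eq: "\<And>A B. A \<in> sets N \<Longrightarrow> B \<in> sets L \<Longrightarrow>
        emeasure S {x\<in>space S. \<xi> x \<in> A \<and> \<psi> x \<in> B} = (\<integral>\<^sup>+x\<in>A. emeasure (K x) B \<partial>distr S N \<xi>)"
    using law by (auto simp: cond_law_def)
  have Xm: "X \<in> M \<rightarrow>\<^sub>M N" and Ym: "Y \<in> M \<rightarrow>\<^sub>M L"
    using measurable_compose[OF V(1) xi] measurable_compose[OF V(1) psi]
      measurable_cong[of M X "\<lambda>\<omega>. \<xi> (V \<omega>)"] measurable_cong[of M Y "\<lambda>\<omega>. \<psi> (V \<omega>)"] X Y by auto
  have "distr M N X = distr M N (\<xi> \<circ> V)" by (intro distr_cong) (auto simp: X)
  also have "\<dots> = distr S N \<xi>" using distr_distr[OF xi V(1)] by (simp add: V(2))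
  finally show d: "distr M N X = distr S N \<xi>" .
  show "cond_law M N X L Y K"
    unfolding cond_law_def
  proof (intro conjI ballI Xm Ym K)
    note [measurable] = xi psi
    fix A B assume [measurable]: "A \<in> sets N" "B \<in> sets L"
    have "emeasure M {\<omega> \<in> space M. X \<omega> \<in> A \<and> Y \<omega> \<in> B} = emeasure (distr M S V) {x\<in>space S. \<xi> x
        \<in> A \<and> \<psi> x \<in> B}"
      by (subst emeasure_distr[OF V(1)], measurable)
         (intro arg_cong2[where f=emeasure] refl, use measurable_space[OF V(1)] in \<open>auto simp: X Y\<close>)
    then show "emeasure M {\<omega> \<in> space M. X \<omega> \<in> A \<and> Y \<omega> \<in> B}
        = (\<integral>\<^sup>+x\<in>A. emeasure (K x) B \<partial>distr M N X)"
      by (simp add: V(2) eq d)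
  qed
qed

theorem theorem3p5:
  fixes n :: nat and M :: "'w measure"
    and g :: "'w \<Rightarrow> nat \<Rightarrow> complex^2^2"
    and s :: "nat \<Rightarrow> nat \<Rightarrow> 'w \<Rightarrow> real"
  assumes "prob_space M"
    and "g \<in> M \<rightarrow>\<^sub>M SU2_pow n"
    and "normalized_haar n (distr M (SU2_pow n) g)"
    and "\<And>\<omega>. \<omega> \<in> space M \<Longrightarrow> det_coeffs n (g \<omega>) (\<lambda>i j. s i j \<omega>)"
  shows
    "(n \<ge> 3 \<longrightarrow>
       (\<exists>c>0. distributed M lborel (upper3 s) (\<lambda>u. if pos_semidef (gram3 u) then ennreal c else 0))) \<and>
     (n \<ge> 4 \<longrightarrow>
       (\<forall>j\<in>{4..n}. \<exists>K. cond_law M borel (upper3 s) borel (col s j) K \<and>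
         (AE u in distr M borel (upper3 s). \<exists>c>0.
            K u = density lborel
              (\<lambda>v. if pos_semidef (gram4 u v) then ennreal (c * det (gram4 u v) powr (-1/2)) else 0)))) \<and>
     (n \<ge> 4 \<longrightarrow>
       (\<exists>K. cond_law M borel (upper3 s) (\<Pi>\<^sub>M j\<in>{4..n}. borel) (\<lambda>\<omega>. \<lambda>j\<in>{4..n}. col s j \<omega>) K \<and>
         (AE u in distr M borel (upper3 s).
            prob_space.indep_vars (K u) (\<lambda>j. borel) (\<lambda>j v. v j) {4..n}))) \<and>
     (n \<ge> 5 \<longrightarrow>
       (\<exists>K. cond_law M (real_families (first_rows n 3)) (entries s (first_rows n 3))
              (\<Pi>\<^sub>M j\<in>{5..n}. borel) (\<lambda>\<omega>. \<lambda>j\<in>{5..n}. s 4 j \<omega>) K \<and>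
         (AE w in distr M (real_families (first_rows n 3)) (entries s (first_rows n 3)).
            (\<forall>j\<in>{5..n}. \<exists>a b. a \<noteq> b \<and>
               measure (K w) {z \<in> space (K w). z j = a} = 1/2 \<and>
               measure (K w) {z \<in> space (K w). z j = b} = 1/2) \<and>
            prob_space.indep_vars (K w) (\<lambda>j. borel) (\<lambda>j z. z j) {5..n}))) \<and>
     (n \<ge> 5 \<longrightarrow>
       (\<exists>K. cond_law M (real_families (first_rows n 4)) (entries s (first_rows n 4))
              (real_families (other_entries n)) (entries s (other_entries n)) K \<and>
         (AE w in distr M (real_families (first_rows n 4)) (entries s (first_rows n 4)).
            \<exists>z\<in>space (real_families (other_entries n)).
              K w = return (real_families (other_entries n)) z)))"
proof -
  \<comment> \<open>From here on the sample space enters only through these points of S^3, whose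
    joint law is the model \<open>?S\<close>.\<close>
  define V where "V \<omega> = (\<lambda>j\<in>{1..n}. su2_vec (g \<omega> j))" for \<omega>
  let ?S = "spheres {1..n}"
  have gS: "g \<omega> j \<in> SU2" if "\<omega> \<in> space M" "j \<in> {1..n}" for \<omega> j
    using measurable_space[OF assms(2) that(1)] that(2)
    by (auto simp: SU2_pow_def space_PiM space_restrict_space)
  have T: "(\<lambda>A. \<lambda>j\<in>{1..n}. su2_vec (A j)) \<in> SU2_pow n \<rightarrow>\<^sub>M ?S"
    unfolding SU2_pow_def
    by (intro measurable_restrict measurable_compose[OF measurable_component_singleton])
       (auto intro: measurable_restrict_space1 measurable_su2_vec)
  have V: "V \<in> M \<rightarrow>\<^sub>M ?S"
    unfolding V_def by (rule measurable_compose[OF assms(2) T])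
  have dV: "distr M ?S V = ?S"
    using normalized_haar_distr_su2_vec[OF assms(3)] distr_distr[OF T assms(2)]
    by (simp add: V_def[abs_def] o_def)
  \<comment> \<open>Only positions above the diagonal are compared; these are the ones occurring in
    all the families below.\<close>
  have s: "s i j \<omega> = inner_coeff i j (V \<omega>)" if "\<omega> \<in> space M" "1 \<le> i" "i < j" "j \<le> n" for i j \<omega>
    using det_coeffs_eq_inner[OF gS[OF that(1)] assms(4)[OF that(1)] that(2-4)] that
    by (simp add: inner_coeff_def V_def)
  have up: "upper3 s \<omega> = upper3 inner_coeff (V \<omega>)" if "3 \<le> n" "\<omega> \<in> space M" for \<omega>
    using that by (simp add: upper3_def s)
  have cl: "col s j \<omega> = col inner_coeff j (V \<omega>)" if "j \<in> {4..n}" "\<omega> \<in> space M" for j \<omega>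
    using that by (simp add: col_def s)
  have en: "entries s I \<omega> = entries inner_coeff I (V \<omega>)"
    if "\<And>i j. (i, j) \<in> I \<Longrightarrow> 1 \<le> i \<and> i < j \<and> j \<le> n" "\<omega> \<in> space M" for I \<omega>
    unfolding entries_def using that by (auto intro!: restrict_ext s)
  have fr: "entries s (first_rows n k) \<omega> = entries inner_coeff (first_rows n k) (V \<omega>)" if "\<omega>
      \<in> space M" for k \<omega>
    using that by (intro en) (auto simp: first_rows_def)
  have oe: "entries s (other_entries n) \<omega> = entries inner_coeff (other_entries n) (V \<omega>)" if "\<omega>
      \<in> space M" for \<omega>
    using that by (intro en) (auto simp: other_entries_def)
  show ?thesis
  proof (intro conjI impI)
    assume n: "3 \<le> n"
    obtain c :: real where c: "c > 0" "distr ?S borel (upper3 inner_coeff)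
      = density lborel (\<lambda>u. if pos_semidef (gram3 u) then ennreal c else 0)"
      using distr_upper3_density n by metis
    have Xm: "upper3 s \<in> M \<rightarrow>\<^sub>M borel"
      using measurable_cong[of M "upper3 s" "\<lambda>\<omega>. upper3 inner_coeff (V \<omega>)"]
        measurable_compose[OF V upper3_measurable[OF n]] up[OF n] by auto
    \<comment> \<open>The change of target from \<open>lborel\<close> to \<open>borel\<close> is
      immaterial, since only the sigma-algebra of the target matters for an image measure.\<close>
    have "distr M lborel (upper3 s) = distr M borel (upper3 inner_coeff \<circ> V)"
      by (intro distr_cong) (auto simp: up[OF n])
    also have "\<dots> = distr ?S borel (upper3 inner_coeff)"
      using distr_distr[OF upper3_measurable[OF n] V] by (simp add: dV)
    finally have "distr M lborel (upper3 s) = density lborel (\<lambda>u.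
        if pos_semidef (gram3 u) then ennreal c else 0)"
      by (simp add: c(2))
    moreover have "(\<lambda>u. if pos_semidef (gram3 u) then ennreal c else 0) \<in> borel_measurable lborel"
      using pos_semidef_gram3_measurable by (intro measurable_If) (auto simp: pred_def)
    ultimately show "\<exists>c>0. distributed M lborel (upper3 s) (\<lambda>u.
        if pos_semidef (gram3 u) then ennreal c else 0)"
      using c(1) Xm by (auto simp: distributed_def intro!: exI[of _ c])
  next
    assume "4 \<le> n"
    then have n: "3 \<le> n" by simp
    obtain c :: real where c: "c > 0" "\<And>n j u. j \<in> {4..n} \<Longrightarrow> gram3_pos u \<Longrightarrow>
        distr (spheres {4..n}) borel (\<lambda>y. chol u (fst (y j)))
        = density lborel (\<lambda>v. if pos_semidef (gram4 u v) then ennreal (c * det (gram4 u v) powr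
            (-1/2)) else 0)"
      by (rule distr_chol_density) blast
    show "\<forall>j\<in>{4..n}. \<exists>K. cond_law M borel (upper3 s) borel (col s j) K \<and>
         (AE u in distr M borel (upper3 s). \<exists>c>0.
            K u = density lborel
              (\<lambda>v. if pos_semidef (gram4 u v) then ennreal (c * det (gram4 u v) powr (-1/2)) else
                  0))"
    proof
      fix j assume j: "j \<in> {4..n}"
      have law: "cond_law M borel (upper3 s) borel (col s j) (\<lambda>u. distr (spheres {4..n}) borel
          (\<lambda>y. chol u (fst (y j))))"
          "distr M borel (upper3 s) = distr ?S borel (upper3 inner_coeff)"
        by (rule cond_law_compose[OF V dV cond_law_col[OF j]]; simp only: up[OF n] cl[OF j])+
      have "AE u in distr M borel (upper3 s). \<exists>c>0. distr (spheres {4..n}) borel (\<lambda>y. chol u (fst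
          (y j))) = density lborel
              (\<lambda>v. if pos_semidef (gram4 u v) then ennreal (c * det (gram4 u v) powr (-1/2)) else
                  0)"
        unfolding law(2) using AE_gram3_pos_distr[OF n] by eventually_elim (use c j in blast)
      then show "\<exists>K. cond_law M borel (upper3 s) borel (col s j) K \<and>
         (AE u in distr M borel (upper3 s). \<exists>c>0.
            K u = density lborel
              (\<lambda>v. if pos_semidef (gram4 u v) then ennreal (c * det (gram4 u v) powr (-1/2)) else
                  0))"
        using law(1) by blast
    qed
  next
    assume n: "4 \<le> n"
    then have n3: "3 \<le> n" by simp
    have "cond_law M borel (upper3 s) (\<Pi>\<^sub>M j\<in>{4..n}. borel) (\<lambda>\<omega>. \<lambda>j\<in>{4..n}. col s j \<omega>)
      (\<lambda>u. distr (spheres {4..n}) (\<Pi>\<^sub>M j\<in>{4..n}. borel) (\<lambda>y. \<lambda>j\<in>{4..n}. chol u (fst (y j))))"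
      by (rule cond_law_compose(1)[OF V dV cond_law_cols[OF n]]) (auto
          simp: up[OF n3] cl intro!: restrict_ext)
    then show "\<exists>K. cond_law M borel (upper3 s) (\<Pi>\<^sub>M j\<in>{4..n}. borel) (\<lambda>\<omega>. \<lambda>j\<in>{4..n}. col s j \<omega>) K \<and>
         (AE u in distr M borel (upper3 s).
            prob_space.indep_vars (K u) (\<lambda>j. borel) (\<lambda>j v. v j) {4..n})"
      using indep_vars_cols[OF n] by (intro exI conjI) (assumption, simp)
  next
    assume n: "5 \<le> n"
    then have n4: "4 \<le> n" by simp
    let ?K = "\<lambda>w. distr (coins {5..n}) (\<Pi>\<^sub>M j\<in>{5..n}. borel) (fourth_row n w)"
    have rows: "(\<lambda>j\<in>{5..n}. s 4 j \<omega>) = (\<lambda>j\<in>{5..n}. inner_coeff 4 j (V \<omega>))" if "\<omega> \<in> space M" for \<omega>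
      using that by (intro restrict_ext s) auto
    have law: "cond_law M (real_families (first_rows n 3)) (entries s (first_rows n 3))
        (\<Pi>\<^sub>M j\<in>{5..n}. borel) (\<lambda>\<omega>. \<lambda>j\<in>{5..n}. s 4 j \<omega>) ?K"
      "distr M (real_families (first_rows n 3)) (entries s (first_rows n 3))
        = distr ?S (real_families (first_rows n 3)) (entries inner_coeff (first_rows n 3))"
      by (rule cond_law_compose[OF V dV cond_law_fourth_row[OF n]]; simp only: fr rows)+
    have "AE w in distr M (real_families (first_rows n 3)) (entries s (first_rows n 3)).
            (\<forall>j\<in>{5..n}. \<exists>a b. a \<noteq> b \<and>
               measure (?K w) {z \<in> space (?K w). z j = a} = 1/2 \<and>
               measure (?K w) {z \<in> space (?K w). z j = b} = 1/2) \<and>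
            prob_space.indep_vars (?K w) (\<lambda>j. borel) (\<lambda>j z. z j) {5..n}"
      \<comment> \<open>General position for the first three rows means that all heights are
        nonzero.\<close>
      unfolding law(2) using AE_height_local_vec[OF n4, of 3, simplified]
    proof eventually_elim
      fix w assume h: "\<forall>j\<in>{4..n}. sphere_height (local_vec w j) \<noteq> 0"
      show "(\<forall>j\<in>{5..n}. \<exists>a b. a \<noteq> b \<and>
               measure (?K w) {z \<in> space (?K w). z j = a} = 1/2 \<and>
               measure (?K w) {z \<in> space (?K w). z j = b} = 1/2) \<and>
            prob_space.indep_vars (?K w) (\<lambda>j. borel) (\<lambda>j z. z j) {5..n}"
        using h n by (intro conjI ballI indep_vars_fourth_row fourth_row_two_values) auto
    qed
    then show "\<exists>K. cond_law M (real_families (first_rows n 3)) (entries s (first_rows n 3))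
              (\<Pi>\<^sub>M j\<in>{5..n}. borel) (\<lambda>\<omega>. \<lambda>j\<in>{5..n}. s 4 j \<omega>) K \<and>
         (AE w in distr M (real_families (first_rows n 3)) (entries s (first_rows n 3)).
            (\<forall>j\<in>{5..n}. \<exists>a b. a \<noteq> b \<and>
               measure (K w) {z \<in> space (K w). z j = a} = 1/2 \<and>
               measure (K w) {z \<in> space (K w). z j = b} = 1/2) \<and>
            prob_space.indep_vars (K w) (\<lambda>j. borel) (\<lambda>j z. z j) {5..n})"
      using law(1) by (intro exI[of _ ?K] conjI)
  next
    assume n: "5 \<le> n"
    let ?K = "\<lambda>w. return (real_families (other_entries n)) (remaining_entries n w)"
    have "cond_law ?S (real_families (first_rows n 4)) (entries inner_coeff (first_rows n 4))
        (real_families (other_entries n)) (entries inner_coeff (other_entries n)) ?K"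
      by (intro cond_law_return remaining_entries_measurable AE_remaining_entries[OF n]
          entries_measurable
          first_rows_bounds other_entries_bounds)
    then have law: "cond_law M (real_families (first_rows n 4)) (entries s (first_rows n 4))
        (real_families (other_entries n)) (entries s (other_entries n)) ?K"
      by (rule cond_law_compose(1)[OF V dV]; simp only: fr oe)
    have "remaining_entries n w \<in> space (real_families (other_entries n))" for w
      by (auto simp: remaining_entries_def space_PiM)
    then show "\<exists>K. cond_law M (real_families (first_rows n 4)) (entries s (first_rows n 4))
              (real_families (other_entries n)) (entries s (other_entries n)) K \<and>
         (AE w in distr M (real_families (first_rows n 4)) (entries s (first_rows n 4)).
            \<exists>z\<in>space (real_families (other_entries n)).
              K w = return (real_families (other_entries n)) z)"
      using law by (intro exI[of _ ?K] conjI AE_I2) auto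
  qed
qed

end
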